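(* Let $x_1,\ldots,x_n\sim\mathrm{N}_d(\mu,\sigma^2I_d)$ independently, with $\mu\in\mathbb{R}^d$ and $\sigma>0$ unknown, and consider prediction of $y\sim\mathrm{N}_d(\mu,\sigma^2I_d)$. Put $\tau=\sigma^{-2}$ and let $\theta$ denote the mean parameter, $\theta=\mu$. If $(n-3)(d-4)\ge 8$, then the Bayes solution (Bayesian predictive density) with respect to the hierarchical prior $$\theta\mid\lambda,\tau\sim\mathrm{N}_d\big(0,\tau^{-1}\lambda^{-1}(1-\lambda)I_d\big),\qquad \lambda\sim\lambda^{-1}1_{[0,1]},\qquad \tau\sim 1_{(0,\infty)}$$ dominates the best equivariant predictive density under the $L^2$ Wasserstein loss.
   Context: The notation $\lambda\sim\lambda^{-1}1_{[0,1]}$ and $\tau\sim1_{(0,\infty)}$ means that $\lambda$ and $\tau$ have the (improper) prior densities $\lambda^{-1}$ on $[0,1]$ and $1$ on $(0,\infty)$. Write $x^n=(x_1,\ldots,x_n)$, let $p(\cdot\mid\mu,\sigma)$ be the density of $\mathrm{N}_d(\mu,\sigma^2I_d)$, and $p(x^n\mid\mu,\sigma)=\prod_ip(x_i\mid\mu,\sigma)$. A predictive density $\hat{p}(y\mid x^n)$ is, for each $x^n$, a probability density in $y\in\mathbb{R}^d$. For probability distributions $p_1,p_2$ on $\mathbb{R}^d$, $W_2(p_1,p_2)=\inf_{X,Y}\mathrm{E}[\|X-Y\|^2]^{1/2}$, the infimum being over all joint distributions of $(X,Y)$ with marginals $p_1$ and $p_2$. The $L^2$ Wasserstein loss is $W_2(p(y\mid\mu,\sigma),\hat{p}(y\mid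 x^n))^2$ and the risk is $R((\mu,\sigma),\hat{p})=\int W_2(p(y\mid\mu,\sigma),\hat{p}(y\mid x^n))^2\,p(x^n\mid\mu,\sigma)\,\mathrm{d}x^n$. The (generalized) Bayesian predictive density under this loss is the density of $\mathrm{N}_d(\hat{\mu}^\pi(x^n),\hat{\sigma}^\pi(x^n)^2I_d)$, where $\hat{\mu}^\pi(x^n)$ and $\hat{\sigma}^\pi(x^n)$ are the posterior means of $\mu$ and $\sigma$. The best equivariant predictive density is the plug-in density $\mathrm{N}_d(\hat{\mu}_0,\hat{\sigma}_0^2I_d)$ in which $\hat{\mu}_0,\hat{\sigma}_0$ are the best (minimum risk) location-scale equivariant estimators of $\mu$ and $\sigma$ under the unscaled quadratic losses $\|\hat{\mu}-\mu\|^2$ and $(\hat{\sigma}-\sigma)^2$. In terms of $\bar{x}=\frac1n\sum_{i=1}^n x_i$ and $s=\sum_{i=1}^n(x_i-\bar{x})^2$, the source writes it as $\mathrm{N}_d(\bar{x},c^2sI_d)$ with $c=\frac{1}{\sqrt{2}}\,\Gamma\left(\frac{n+1}{2}\right)/\Gamma\left(\frac{n+2}{2}\right)$, and gives $s\sim\sigma^2\chi^2_{n-1}$. A predictive density $\hat{p}_1$ dominates $\hat{p}_2$ if $R((\mu,\sigma),\hat{p}_1)\le R((\mu,\sigma),\hat{p}_2)$ for every $(\mu,\sigma)$ and $R((\mu,\sigma),\hat{p}_1)<R((\mu,\sigma),\hat{p}_2)$ for some $(\mu,\sigma)$. *)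

theory Defs
  imports "HOL-Probability.Probability"
begin

text \<open>
  The sample size is CARD('n) and the dimension is CARD('d); a sample is
  x :: (real ^ 'd) ^ 'n, with i-th observation x $ i.
\<close>

definition mvn_density :: "real ^ 'd \<Rightarrow> real \<Rightarrow> real ^ 'd \<Rightarrow> real" where
  "mvn_density \<mu> \<sigma> y =
     (1 / sqrt (2 * pi * \<sigma>\<^sup>2)) ^ CARD('d) * exp (- (norm (y - \<mu>))\<^sup>2 / (2 * \<sigma>\<^sup>2))"

definition sample_density :: "real ^ 'd \<Rightarrow> real \<Rightarrow> (real ^ 'd) ^ 'n \<Rightarrow> real" where
  "sample_density \<mu> \<sigma> x = (\<Prod>i\<in>UNIV. mvn_density \<mu> \<sigma> (x $ i))"


subsection \<open>Wasserstein loss and risk\<close>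

definition couplings ::
  "(real ^ 'd) measure \<Rightarrow> (real ^ 'd) measure \<Rightarrow> ((real ^ 'd) \<times> (real ^ 'd)) measure set" where
  "couplings P Q =
     {M. prob_space M \<and> sets M = sets borel \<and> distr M borel fst = P \<and> distr M borel snd = Q}"

definition esqrt :: "ennreal \<Rightarrow> ennreal" where
  "esqrt t = (if t = \<infinity> then \<infinity> else ennreal (sqrt (enn2real t)))"

definition W2 :: "(real ^ 'd) measure \<Rightarrow> (real ^ 'd) measure \<Rightarrow> ennreal" where
  "W2 P Q = (INF M\<in>couplings P Q. esqrt (\<integral>\<^sup>+ (X, Y). ennreal ((norm (X - Y))\<^sup>2) \<partial>M))"

text \<open>
  A predictive density is a function phat with phat x y the density at y given the sample x.
  If phat x is not a probability density, then there are no couplings and the loss is infinite;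
  the predictive densities below are proper only for almost every x.
\<close>

definition W2_loss :: "real ^ 'd \<Rightarrow> real \<Rightarrow> (real ^ 'd \<Rightarrow> real) \<Rightarrow> ennreal" where
  "W2_loss \<mu> \<sigma> q =
     (W2 (density lborel (\<lambda>y. ennreal (mvn_density \<mu> \<sigma> y)))
         (density lborel (\<lambda>y. ennreal (q y))))\<^sup>2"

definition W2_risk ::
  "real ^ 'd \<Rightarrow> real \<Rightarrow> ((real ^ 'd) ^ 'n \<Rightarrow> real ^ 'd \<Rightarrow> real) \<Rightarrow> ennreal" where
  "W2_risk \<mu> \<sigma> phat =
     (\<integral>\<^sup>+ x. W2_loss \<mu> \<sigma> (phat x) * ennreal (sample_density \<mu> \<sigma> x) \<partial>lborel)"

definition dominates ::
  "((real ^ 'd) ^ 'n \<Rightarrow> real ^ 'd \<Rightarrow> real) \<Rightarrow> ((real ^ 'd) ^ 'n \<Rightarrow> real ^ 'd \<Rightarrow> real) \<Rightarrow> bool" where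
  "dominates p1 p2 \<longleftrightarrow>
     (\<forall>\<mu> \<sigma>. \<sigma> > 0 \<longrightarrow> W2_risk \<mu> \<sigma> p1 \<le> W2_risk \<mu> \<sigma> p2) \<and>
     (\<exists>\<mu> \<sigma>. \<sigma> > 0 \<and> W2_risk \<mu> \<sigma> p1 < W2_risk \<mu> \<sigma> p2)"

definition plug_in ::
  "((real ^ 'd) ^ 'n \<Rightarrow> real ^ 'd) \<Rightarrow> ((real ^ 'd) ^ 'n \<Rightarrow> real) \<Rightarrow>
   (real ^ 'd) ^ 'n \<Rightarrow> real ^ 'd \<Rightarrow> real" where
  "plug_in m s x = mvn_density (m x) (s x)"


subsection \<open>Best location-scale equivariant estimators\<close>

definition loc_scale :: "real \<Rightarrow> real ^ 'd \<Rightarrow> (real ^ 'd) ^ 'n \<Rightarrow> (real ^ 'd) ^ 'n" where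
  "loc_scale a b x = (\<chi> i. a *\<^sub>R (x $ i) + b)"

definition equivariant_mean :: "((real ^ 'd) ^ 'n \<Rightarrow> real ^ 'd) \<Rightarrow> bool" where
  "equivariant_mean m \<longleftrightarrow> m \<in> borel_measurable borel \<and>
     (\<forall>a b x. a > 0 \<longrightarrow> m (loc_scale a b x) = a *\<^sub>R m x + b)"

definition equivariant_scale :: "((real ^ 'd) ^ 'n \<Rightarrow> real) \<Rightarrow> bool" where
  "equivariant_scale s \<longleftrightarrow> s \<in> borel_measurable borel \<and>
     (\<forall>a b x. a > 0 \<longrightarrow> s (loc_scale a b x) = a * s x)"

definition mean_risk :: "real ^ 'd \<Rightarrow> real \<Rightarrow> ((real ^ 'd) ^ 'n \<Rightarrow> real ^ 'd) \<Rightarrow> ennreal" where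
  "mean_risk \<mu> \<sigma> m =
     (\<integral>\<^sup>+ x. ennreal ((norm (m x - \<mu>))\<^sup>2) * ennreal (sample_density \<mu> \<sigma> x) \<partial>lborel)"

definition scale_risk :: "real ^ 'd \<Rightarrow> real \<Rightarrow> ((real ^ 'd) ^ 'n \<Rightarrow> real) \<Rightarrow> ennreal" where
  "scale_risk \<mu> \<sigma> s =
     (\<integral>\<^sup>+ x. ennreal ((s x - \<sigma>)\<^sup>2) * ennreal (sample_density \<mu> \<sigma> x) \<partial>lborel)"

definition best_equivariant_mean :: "((real ^ 'd) ^ 'n \<Rightarrow> real ^ 'd) \<Rightarrow> bool" where
  "best_equivariant_mean m \<longleftrightarrow> equivariant_mean m \<and>
     (\<forall>m' :: (real ^ 'd) ^ 'n \<Rightarrow> real ^ 'd. equivariant_mean m' \<longrightarrow>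
        (\<forall>\<mu> \<sigma>. \<sigma> > 0 \<longrightarrow> mean_risk \<mu> \<sigma> m \<le> mean_risk \<mu> \<sigma> m'))"

definition best_equivariant_scale :: "((real ^ 'd) ^ 'n \<Rightarrow> real) \<Rightarrow> bool" where
  "best_equivariant_scale s \<longleftrightarrow> equivariant_scale s \<and>
     (\<forall>s' :: (real ^ 'd) ^ 'n \<Rightarrow> real. equivariant_scale s' \<longrightarrow>
        (\<forall>\<mu> \<sigma>. \<sigma> > 0 \<longrightarrow> scale_risk \<mu> \<sigma> s \<le> scale_risk \<mu> \<sigma> s'))"

text \<open>
  The minimisers are unique up to null sets: m is the sample mean and s is c times the square root
  of the residual sum of squares, which is \<open>\<sigma>\<^sup>2\<close> times a chi-square with k = CARD('d) * (CARD('n) - 1)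
  degrees of freedom, with \<open>c = Gamma ((k + 1) / 2) / (sqrt 2 * Gamma ((k + 2) / 2))\<close>.
\<close>

definition best_equivariant_predictive :: "((real ^ 'd) ^ 'n \<Rightarrow> real ^ 'd \<Rightarrow> real) \<Rightarrow> bool" where
  "best_equivariant_predictive phat \<longleftrightarrow>
     (\<exists>m s. best_equivariant_mean m \<and> best_equivariant_scale s \<and> phat = plug_in m s)"


subsection \<open>Bayes solution\<close>

definition posterior_expectation ::
  "((real ^ 'd) \<times> real) measure \<Rightarrow> (real ^ 'd \<Rightarrow> real \<Rightarrow> 'b) \<Rightarrow> (real ^ 'd) ^ 'n \<Rightarrow>
   'b :: {banach, second_countable_topology}" where
  "posterior_expectation prior f x =
     (\<integral>(\<mu>, \<sigma>). sample_density \<mu> \<sigma> x *\<^sub>R f \<mu> \<sigma> \<partial>prior) /\<^sub>R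
     (\<integral>(\<mu>, \<sigma>). sample_density \<mu> \<sigma> x \<partial>prior)"

definition bayes_predictive ::
  "((real ^ 'd) \<times> real) measure \<Rightarrow> (real ^ 'd) ^ 'n \<Rightarrow> real ^ 'd \<Rightarrow> real" where
  "bayes_predictive prior =
     plug_in (posterior_expectation prior (\<lambda>\<mu> \<sigma>. \<mu>)) (posterior_expectation prior (\<lambda>\<mu> \<sigma>. \<sigma>))"

text \<open>
  The normal factor has variance \<open>(1 - lam) / (lam * \<tau>)\<close>; it is degenerate only at the endpoints of
  the range of \<open>lam\<close>, which are a null set.
\<close>

definition hierarchical_density :: "real ^ 'd \<Rightarrow> real \<Rightarrow> real \<Rightarrow> real" where
  "hierarchical_density \<theta> lam \<tau> =
     mvn_density 0 (sqrt (inverse \<tau> * inverse lam * (1 - lam))) \<theta> *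
     (inverse lam * indicator {0..1} lam) * indicator {0<..} \<tau>"

text \<open>The induced (improper) prior of \<open>(\<mu>, \<sigma>) = (\<theta>, \<tau> powr (- 1 / 2))\<close>.\<close>

definition hierarchical_prior :: "((real ^ 'd) \<times> real) measure" where
  "hierarchical_prior =
     distr (density lborel (\<lambda>(\<theta>, lam, \<tau>). ennreal (hierarchical_density \<theta> lam \<tau>)))
       borel (\<lambda>(\<theta>, lam, \<tau>). (\<theta>, 1 / sqrt \<tau>))"

end

theory Submission
  imports Defs
begin

text \<open>
  Between \<open>N(m\<^sub>1, s\<^sub>1\<^sup>2 I)\<close> and \<open>N(m\<^sub>2, s\<^sub>2\<^sup>2 I)\<close> the squared Wasserstein distance is
  \<open>|m\<^sub>1 - m\<^sub>2|\<^sup>2 + d (s\<^sub>1 - s\<^sub>2)\<^sup>2\<close> (\<open>W2_loss_ge\<close>, \<open>W2_loss_le\<close>). The risk of a plug-in density is therefore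
  the quadratic risk of its location estimator plus \<open>d\<close> times that of its scale estimator, and
  two pairs of estimators have to be compared. Write \<open>xbar\<close> for the sample mean, \<open>S\<close> for the residual
  sum of squares, \<open>k = d (n - 1)\<close>, \<open>m = n - 1\<close> and \<open>W = n |xbar|\<^sup>2 / S\<close>.

  The best equivariant pair is \<open>(xbar, c sqrt S)\<close>. Both halves follow from averaging over a
  transformation that an equivariant estimator commutes with: reflecting the sample mean about
  \<open>\<mu>\<close> for the location, dilating the residuals for the scale (\<open>mean_risk_minimal\<close>,
  \<open>scale_risk_minimal\<close>).

  For the Bayes pair, integrate out \<open>\<theta>\<close> by completing the square and \<open>\<tau>\<close> by a gamma integral. What
  is left is an integral over \<open>lam\<close>; in the variable \<open>u = \<kappa> W\<close>, where \<open>\<kappa> = lam / (n - m lam)\<close> is the factor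
  by which the conditional posterior mean shrinks \<open>xbar\<close>, it is the beta prime density
  proportional to \<open>u\<^bsup>d/2 - 1\<^esup> (1 + u)\<^bsup>- nd/2 - 1\<^esup>\<close>, cut off at \<open>W\<close> and tilted by \<open>1 / (1 + m u / W)\<close>. With \<open>E\<close> the
  mean under this law, \<open>\<phi> = E u\<close> and \<open>h = \<phi> / W\<close>, the Bayes pair is
  \<open>((1 - h) xbar, C E[sqrt (1 + u)] sqrt S)\<close> (\<open>hierarchical_posterior\<close>). The laws increase with \<open>W\<close> in likelihood
  ratio order, so \<open>E u\<close> and \<open>E[sqrt (1 + u)]\<close> increase, to the limits \<open>1 / m\<close> and \<open>c / C\<close>.

  The Bayes scale estimator need not improve on \<open>c sqrt S\<close> by itself, so the gain in location has
  to pay for a possible loss in scale. Dilating the sample mean or the residuals by a factor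
  \<open>t\<close> and comparing expectations to first order at \<open>t = 1\<close> gives one-sided forms of Stein's identity
  and of the chi-square identity that hold for monotone functions without differentiability
  (\<open>dilation_inequality_up\<close>, \<open>dilation_inequality_down\<close>). They bound the risk difference below by
  the expectation of a function of \<open>W\<close> alone. That function is positive (\<open>risk_margin_pos\<close>): with
  \<open>\<eta> = 1 / m - \<phi>\<close>, the relative deficit of the scale estimator is at most \<open>\<eta> / 2\<close>, because
  \<open>sqrt (1 + u)\<close> has slope at most one half (\<open>post_sqrt_deficit\<close>), and \<open>\<eta> \<le> h\<close> by an integration by parts
  (\<open>post_id_deficit\<close>); the condition \<open>(n - 3) (d - 4) \<ge> 8\<close> then leaves enough room.
\<close>

section \<open>Lebesgue measure under dilations of the mean and of the residuals\<close>

lemma nn_integral_lborel_translate: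
  fixes g :: "'a::euclidean_space \<Rightarrow> ennreal"
  assumes [measurable]: "g \<in> borel_measurable borel"
  shows "(\<integral>\<^sup>+x. g (x + a) \<partial>lborel) = (\<integral>\<^sup>+x. g x \<partial>lborel)"
proof -
  have "(\<integral>\<^sup>+x. g (x + a) \<partial>lborel) = (\<integral>\<^sup>+x. g x \<partial>distr lborel borel ((+) a))"
    by (subst nn_integral_distr) (auto simp: add.commute)
  then show ?thesis by (simp add: lborel_distr_plus)
qed

lemma nn_integral_lborel_scale:
  fixes g :: "'a::euclidean_space \<Rightarrow> ennreal"
  assumes [measurable]: "g \<in> borel_measurable borel" and "t \<noteq> 0"
  shows "ennreal (\<bar>t\<bar> ^ DIM('a)) * (\<integral>\<^sup>+x. g (t *\<^sub>R x) \<partial>lborel) = (\<integral>\<^sup>+x. g x \<partial>lborel)"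
proof -
  have "(\<integral>\<^sup>+x. g x \<partial>lborel) = (\<integral>\<^sup>+x. g x \<partial>density (distr lborel borel (\<lambda>x. 0 + t *\<^sub>R x)) (\<lambda>_. \<bar>t\<bar> ^ DIM('a)))"
    using lborel_affine[OF assms(2), of "0::'a"] by simp
  also have "\<dots> = (\<integral>\<^sup>+x. ennreal (\<bar>t\<bar> ^ DIM('a)) * g (t *\<^sub>R x) \<partial>lborel)"
    by (simp add: nn_integral_density nn_integral_distr)
  also have "\<dots> = ennreal (\<bar>t\<bar> ^ DIM('a)) * (\<integral>\<^sup>+x. g (t *\<^sub>R x) \<partial>lborel)"
    by (rule nn_integral_cmult) simp
  finally show ?thesis by simp
qed

lemma nn_integral_lborel_reflect:
  fixes g :: "'a::euclidean_space \<Rightarrow> ennreal"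
  assumes [measurable]: "g \<in> borel_measurable borel"
  shows "(\<integral>\<^sup>+x. g (a - x) \<partial>lborel) = (\<integral>\<^sup>+x. g x \<partial>lborel)"
proof -
  have "(\<integral>\<^sup>+x. g (a - x) \<partial>lborel) = (\<integral>\<^sup>+x. g (- x) \<partial>lborel)"
    using nn_integral_lborel_translate[of "\<lambda>x. g (- x)" "-a"] by simp
  also have "\<dots> = (\<integral>\<^sup>+x. g x \<partial>lborel)"
    using nn_integral_lborel_scale[of g "-1"] by simp
  finally show ?thesis .
qed

text \<open>
  Uniqueness of translation-invariant measures: evaluate \<open>\<integral>\<integral> g (f x) h (y + f x)\<close> in both orders.
  Every linear bijection thus scales Lebesgue measure by a constant, whose value will cancel below.
\<close>
lemma nn_integral_linear_proportional:
  fixes f f' :: "'a::euclidean_space \<Rightarrow> 'a" and g h :: "'a \<Rightarrow> ennreal"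
  assumes f: "linear f" and inv: "\<And>y. f (f' y) = y"
    and [measurable]: "g \<in> borel_measurable borel" "h \<in> borel_measurable borel"
  shows "(\<integral>\<^sup>+x. g (f x) \<partial>lborel) * (\<integral>\<^sup>+y. h y \<partial>lborel) =
         (\<integral>\<^sup>+x. h (f x) \<partial>lborel) * (\<integral>\<^sup>+y. g y \<partial>lborel)"
proof -
  have [measurable]: "f \<in> borel_measurable borel"
    using f by (intro borel_measurable_continuous_onI linear_continuous_on) (simp add: linear_conv_bounded_linear)
  interpret pair_sigma_finite "lborel :: 'a measure" "lborel :: 'a measure" ..
  have "(\<integral>\<^sup>+x. g (f x) \<partial>lborel) * (\<integral>\<^sup>+y. h y \<partial>lborel) =
        (\<integral>\<^sup>+x. \<integral>\<^sup>+y. g (f x) * h y \<partial>lborel \<partial>lborel)"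
    by (simp add: nn_integral_multc nn_integral_cmult)
  also have "\<dots> = (\<integral>\<^sup>+x. \<integral>\<^sup>+y. g (f x) * h (y + f x) \<partial>lborel \<partial>lborel)"
    by (rule nn_integral_cong) (rule nn_integral_lborel_translate[symmetric], simp)
  also have "\<dots> = (\<integral>\<^sup>+y. \<integral>\<^sup>+x. g (f x) * h (y + f x) \<partial>lborel \<partial>lborel)"
    by (rule lborel_pair.Fubini') simp
  also have "\<dots> = (\<integral>\<^sup>+y. \<integral>\<^sup>+x. g (f x - y) * h (f x) \<partial>lborel \<partial>lborel)"
  proof (rule nn_integral_cong)
    fix y :: 'a
    show "(\<integral>\<^sup>+x. g (f x) * h (y + f x) \<partial>lborel) = (\<integral>\<^sup>+x. g (f x - y) * h (f x) \<partial>lborel)"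
      using nn_integral_lborel_translate[of "\<lambda>x. g (f x) * h (y + f x)" "- f' y"]
      by (simp add: linear_diff[OF f] inv)
  qed
  also have "\<dots> = (\<integral>\<^sup>+x. \<integral>\<^sup>+y. g (f x - y) * h (f x) \<partial>lborel \<partial>lborel)"
    by (rule lborel_pair.Fubini') simp
  also have "\<dots> = (\<integral>\<^sup>+x. (\<integral>\<^sup>+y. g y \<partial>lborel) * h (f x) \<partial>lborel)"
    by (simp add: nn_integral_multc nn_integral_lborel_reflect)
  also have "\<dots> = (\<integral>\<^sup>+x. h (f x) \<partial>lborel) * (\<integral>\<^sup>+y. g y \<partial>lborel)"
    by (simp add: nn_integral_cmult mult.commute)
  finally show ?thesis .
qed

definition sample_mean :: "(real ^ 'd) ^ 'n \<Rightarrow> real ^ 'd" where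
  "sample_mean x = (1 / real CARD('n)) *\<^sub>R (\<Sum>i\<in>UNIV. x $ i)"

definition rss :: "(real ^ 'd) ^ 'n \<Rightarrow> real" where
  "rss x = (\<Sum>i\<in>UNIV. (norm (x $ i - sample_mean x))\<^sup>2)"

definition dilate_mean :: "real \<Rightarrow> (real ^ 'd) ^ 'n \<Rightarrow> (real ^ 'd) ^ 'n" where
  "dilate_mean t x = (\<chi> i. x $ i + (t - 1) *\<^sub>R sample_mean x)"

definition dilate_residuals :: "real \<Rightarrow> (real ^ 'd) ^ 'n \<Rightarrow> (real ^ 'd) ^ 'n" where
  "dilate_residuals t x = (\<chi> i. sample_mean x + t *\<^sub>R (x $ i - sample_mean x))"

lemma sample_mean_scaleR: "sample_mean (t *\<^sub>R x) = t *\<^sub>R sample_mean x"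
  by (simp add: sample_mean_def scaleR_sum_right[symmetric])

lemma sample_mean_add: "sample_mean (x + y) = sample_mean x + sample_mean y"
  by (simp add: sample_mean_def sum.distrib scaleR_right_distrib)

lemma sample_mean_measurable [measurable]:
  "(sample_mean :: (real ^ 'd) ^ 'n \<Rightarrow> _) \<in> borel_measurable borel"
  unfolding sample_mean_def
  by (intro borel_measurable_continuous_onI continuous_intros)

lemma rss_measurable [measurable]: "(rss :: (real ^ 'd) ^ 'n \<Rightarrow> _) \<in> borel_measurable borel"
  unfolding rss_def sample_mean_def
  by (intro borel_measurable_continuous_onI continuous_intros)

lemma dilate_mean_measurable [measurable]:
  "(dilate_mean t :: (real ^ 'd) ^ 'n \<Rightarrow> _) \<in> borel_measurable borel"
  unfolding dilate_mean_def sample_mean_def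
  by (intro borel_measurable_continuous_onI continuous_intros)

lemma dilate_residuals_measurable [measurable]:
  "(dilate_residuals t :: (real ^ 'd) ^ 'n \<Rightarrow> _) \<in> borel_measurable borel"
  unfolding dilate_residuals_def sample_mean_def
  by (intro borel_measurable_continuous_onI continuous_intros)

lemma nn_integral_dilate_coordinate:
  fixes g :: "(real ^ 'd) ^ 'n \<Rightarrow> ennreal"
  assumes [measurable]: "g \<in> borel_measurable borel" and "t \<noteq> 0"
  shows "ennreal (\<bar>t\<bar> ^ CARD('d)) * (\<integral>\<^sup>+x. g (\<chi> i. if i = i0 then t *\<^sub>R x $ i else x $ i) \<partial>lborel)
         = (\<integral>\<^sup>+x. g x \<partial>lborel)"
proof -
  define c :: "(real ^ 'd) ^ 'n \<Rightarrow> real" where "c j = (if j $ i0 = 0 then 1 else t)" for j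
  define T where "T x = 0 + (\<Sum>j\<in>Basis. (c j * (x \<bullet> j)) *\<^sub>R j)" for x :: "(real ^ 'd) ^ 'n"
  have T: "T x = (\<chi> i. if i = i0 then t *\<^sub>R x $ i else x $ i)" for x
  proof (rule euclidean_eqI)
    fix b :: "(real ^ 'd) ^ 'n" assume b: "b \<in> Basis"
    then obtain k e where be: "b = axis k e" "e \<in> Basis" by (auto simp: Basis_vec_def)
    have "T x \<bullet> b = c b * (x \<bullet> b)"
      unfolding T_def using b by (simp add: inner_sum_left inner_Basis if_distrib sum.If_cases cong: if_cong)
    also have "c b = (if k = i0 then t else 1)"
      using be nonzero_Basis[of e] by (auto simp: c_def axis_def)
    also have "(if k = i0 then t else 1) * (x \<bullet> b) = (\<chi> i. if i = i0 then t *\<^sub>R x $ i else x $ i) \<bullet> b"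
      unfolding be(1) inner_axis by simp
    finally show "T x \<bullet> b = (\<chi> i. if i = i0 then t *\<^sub>R x $ i else x $ i) \<bullet> b" .
  qed
  have c0: "c j \<noteq> 0" for j using assms(2) by (simp add: c_def)
  have [measurable]: "T \<in> borel_measurable borel"
    unfolding T_def by measurable
  have "(\<Prod>j\<in>Basis. \<bar>c j\<bar>) = (\<Prod>j\<in>(axis i0 ` Basis :: ((real ^ 'd) ^ 'n) set). \<bar>t\<bar>)"
  proof (rule prod.mono_neutral_cong_right)
    show "(axis i0 ` Basis :: ((real ^ 'd) ^ 'n) set) \<subseteq> Basis"
      by (auto simp: Basis_vec_def[where 'b = 'n])
    show "\<forall>j\<in>Basis - axis i0 ` Basis. \<bar>c j\<bar> = 1"
    proof
      fix j :: "(real ^ 'd) ^ 'n" assume j: "j \<in> Basis - axis i0 ` Basis"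
      then obtain k e where "j = axis k e" "e \<in> Basis" by (auto simp: Basis_vec_def[where 'b = 'n])
      with j show "\<bar>c j\<bar> = 1" by (auto simp: c_def axis_def)
    qed
    show "\<And>j. j \<in> (axis i0 ` Basis :: ((real ^ 'd) ^ 'n) set) \<Longrightarrow> \<bar>c j\<bar> = \<bar>t\<bar>"
      using nonzero_Basis by (auto simp: c_def axis_def)
  qed simp
  also have "\<dots> = \<bar>t\<bar> ^ CARD('d)"
    by (subst prod.reindex) (auto simp: inj_on_def axis_eq_axis)
  finally have prod: "(\<Prod>j\<in>Basis. \<bar>c j\<bar>) = \<bar>t\<bar> ^ CARD('d)" .
  have "(\<integral>\<^sup>+x. g x \<partial>lborel) = (\<integral>\<^sup>+x. g x \<partial>density (distr lborel borel T) (\<lambda>_. (\<Prod>j\<in>Basis. \<bar>c j\<bar>)))"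
    unfolding T_def using lborel_affine_euclidean[of c 0] c0 by simp
  also have "\<dots> = (\<integral>\<^sup>+x. ennreal (\<bar>t\<bar> ^ CARD('d)) * g (T x) \<partial>lborel)"
    unfolding prod by (simp add: nn_integral_density nn_integral_distr)
  also have "\<dots> = ennreal (\<bar>t\<bar> ^ CARD('d)) * (\<integral>\<^sup>+x. g (T x) \<partial>lborel)"
    by (rule nn_integral_cmult) simp
  finally show ?thesis by (simp add: T)
qed

text \<open>
  The dilation is conjugate, by the linear bijection that exchanges one observation for the sample
  mean and the others for their residuals, to a dilation of a single coordinate block.
\<close>
lemma nn_integral_dilate_mean:
  fixes g :: "(real ^ 'd) ^ 'n \<Rightarrow> ennreal"
  assumes [measurable]: "g \<in> borel_measurable borel" and t: "t \<noteq> 0"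
  shows "ennreal (\<bar>t\<bar> ^ CARD('d)) * (\<integral>\<^sup>+x. g (dilate_mean t x) \<partial>lborel) = (\<integral>\<^sup>+x. g x \<partial>lborel)"
proof -
  obtain i0 :: 'n where True by blast
  define n where "n = real CARD('n)"
  have n: "n > 0" by (simp add: n_def)
  define A :: "(real ^ 'd) ^ 'n \<Rightarrow> (real ^ 'd) ^ 'n" where
    "A y = (\<chi> i. if i = i0 then y $ i0 - (\<Sum>j\<in>UNIV - {i0}. y $ j) else y $ i + y $ i0)" for y
  define B :: "(real ^ 'd) ^ 'n \<Rightarrow> (real ^ 'd) ^ 'n" where
    "B x = (\<chi> i. if i = i0 then sample_mean x else x $ i - sample_mean x)" for x
  define D :: "(real ^ 'd) ^ 'n \<Rightarrow> (real ^ 'd) ^ 'n" where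
    "D x = (\<chi> i. if i = i0 then t *\<^sub>R x $ i else x $ i)" for x
  have split: "(\<Sum>j\<in>UNIV. h j) = h i0 + (\<Sum>j\<in>UNIV - {i0}. h j)" for h :: "'n \<Rightarrow> real ^ 'd"
    by (rule sum.remove) auto
  have cardm: "real (card (UNIV - {i0})) = n - 1"
    by (simp add: n_def card_Diff_singleton of_nat_diff)
  have sc: "(\<Sum>j\<in>UNIV - {i0}. v) = (n - 1) *\<^sub>R v" for v :: "real ^ 'd"
    using cardm by (simp only: sum_constant_scaleR)
  have mean_A: "sample_mean (A y) = y $ i0" for y
  proof -
    have "(\<Sum>j\<in>UNIV. A y $ j) = n *\<^sub>R (y $ i0)"
      unfolding split A_def by (simp add: sum.distrib sc scaleR_left_diff_distrib del: sum_constant)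
    then show ?thesis using n by (simp add: sample_mean_def n_def)
  qed
  have BA: "B (A y) = y" for y
    unfolding B_def by (auto simp: mean_A vec_eq_iff) (auto simp: A_def)
  have AB: "A (D (B x)) = dilate_mean t x" for x
  proof -
    have s: "(\<Sum>j\<in>UNIV. x $ j) = n *\<^sub>R sample_mean x"
      using n by (simp add: sample_mean_def n_def)
    have "(\<Sum>j\<in>UNIV - {i0}. x $ j) = n *\<^sub>R sample_mean x - x $ i0"
      using split[of "\<lambda>j. x $ j"] s by (simp add: eq_diff_eq add.commute)
    then have "(\<Sum>j\<in>UNIV - {i0}. D (B x) $ j) = sample_mean x - x $ i0"
      by (simp add: D_def B_def sum_subtractf sc algebra_simps del: sum_constant)
    then show ?thesis
      by (auto simp: A_def D_def B_def dilate_mean_def vec_eq_iff scaleR_left_diff_distrib)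
  qed
  have AB': "A (B x) = x" for x
  proof -
    have "(\<Sum>j\<in>UNIV. x $ j) = n *\<^sub>R sample_mean x"
      using n by (simp add: sample_mean_def n_def)
    then have "(\<Sum>j\<in>UNIV - {i0}. x $ j) = n *\<^sub>R sample_mean x - x $ i0"
      using split[of "\<lambda>j. x $ j"] by (simp add: eq_diff_eq add.commute)
    then have "(\<Sum>j\<in>UNIV - {i0}. B x $ j) = sample_mean x - x $ i0"
      by (simp add: B_def sum_subtractf sc algebra_simps del: sum_constant)
    then show ?thesis by (auto simp: A_def B_def vec_eq_iff)
  qed
  have linB: "linear B"
    unfolding B_def
    by (auto intro!: linearI simp: vec_eq_iff sample_mean_add sample_mean_scaleR algebra_simps)
  have [measurable]: "A \<in> borel_measurable borel" "D \<in> borel_measurable borel"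
  proof -
    have "linear A" unfolding A_def
      by (auto intro!: linearI simp: vec_eq_iff sum.distrib algebra_simps sum_distrib_left)
    moreover have "linear D" unfolding D_def
      by (auto intro!: linearI simp: vec_eq_iff algebra_simps)
    ultimately show "A \<in> borel_measurable borel" "D \<in> borel_measurable borel"
      by (auto intro!: borel_measurable_continuous_onI linear_continuous_on simp: linear_conv_bounded_linear)
  qed
  let ?h = "indicator (cbox 0 One) :: (real ^ 'd) ^ 'n \<Rightarrow> ennreal"
  define c where "c = (\<integral>\<^sup>+x. ?h (B x) \<partial>lborel)"
  have B_int: "(\<integral>\<^sup>+x. F (B x) \<partial>lborel) = c * (\<integral>\<^sup>+x. F x \<partial>lborel)"
    if F [measurable]: "F \<in> borel_measurable borel" for F
    using nn_integral_linear_proportional[OF linB BA, of F ?h] by (simp add: c_def)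
  have 1: "(\<integral>\<^sup>+x. g (dilate_mean t x) \<partial>lborel) = c * (\<integral>\<^sup>+x. g (A (D x)) \<partial>lborel)"
    using B_int[of "\<lambda>x. g (A (D x))"] by (simp add: AB)
  have 2: "ennreal (\<bar>t\<bar> ^ CARD('d)) * (\<integral>\<^sup>+x. g (A (D x)) \<partial>lborel) = (\<integral>\<^sup>+x. g (A x) \<partial>lborel)"
    using nn_integral_dilate_coordinate[of "\<lambda>x. g (A x)" t i0] t by (simp add: D_def)
  have 3: "(\<integral>\<^sup>+x. g x \<partial>lborel) = c * (\<integral>\<^sup>+x. g (A x) \<partial>lborel)"
    using B_int[of "\<lambda>x. g (A x)"] by (simp add: AB')
  show ?thesis unfolding 1 3 2[symmetric] by (rule mult.left_commute)
qed

lemma dilate_residuals_eq: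
  "t \<noteq> 0 \<Longrightarrow> dilate_residuals t x = dilate_mean (1 / t) (t *\<^sub>R x)"
  by (simp add: dilate_residuals_def dilate_mean_def sample_mean_scaleR vec_eq_iff algebra_simps)

text \<open>
  A dilation of the residuals is a dilation of everything, undone on the sample mean; hence the
  exponent \<open>n d - d\<close>.
\<close>
lemma nn_integral_dilate_residuals:
  fixes g :: "(real ^ 'd) ^ 'n \<Rightarrow> ennreal"
  assumes [measurable]: "g \<in> borel_measurable borel" and t: "t > 0"
  shows "ennreal (t ^ (CARD('d) * (CARD('n) - 1))) * (\<integral>\<^sup>+x. g (dilate_residuals t x) \<partial>lborel)
         = (\<integral>\<^sup>+x. g x \<partial>lborel)"
proof -
  let ?d = "CARD('d)" and ?n = "CARD('n)"
  have n: "?n \<ge> 1" by (simp add: Suc_leI)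
  have e: "?d * (?n - 1) + ?d = ?n * ?d" using n by (cases ?n) auto
  have pw: "t ^ (?d * (?n - 1)) = (1 / t) ^ ?d * t ^ (?n * ?d)"
    unfolding e[symmetric] using t by (simp add: power_add power_one_over)
  have "ennreal (t ^ (?d * (?n - 1))) * (\<integral>\<^sup>+x. g (dilate_residuals t x) \<partial>lborel)
     = ennreal ((1 / t) ^ ?d) * (ennreal (t ^ (?n * ?d)) * (\<integral>\<^sup>+x. g (dilate_mean (1 / t) (t *\<^sub>R x)) \<partial>lborel))"
    unfolding pw using t by (simp add: ennreal_mult dilate_residuals_eq mult.assoc)
  also have "\<dots> = ennreal ((1 / t) ^ ?d) * (\<integral>\<^sup>+x. g (dilate_mean (1 / t) x) \<partial>lborel)"
    using nn_integral_lborel_scale[of "\<lambda>x. g (dilate_mean (1 / t) x)" t] t by simp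
  also have "\<dots> = (\<integral>\<^sup>+x. g x \<partial>lborel)"
    using nn_integral_dilate_mean[of g "1 / t"] t by (simp add: abs_of_pos)
  finally show ?thesis .
qed

lemma nn_integral_lborel_affine:
  fixes g :: "'a::euclidean_space \<Rightarrow> ennreal"
  assumes [measurable]: "g \<in> borel_measurable borel" and "c > 0"
  shows "(\<integral>\<^sup>+x. ennreal (c ^ DIM('a)) * g (a + c *\<^sub>R (x - b)) \<partial>lborel) = (\<integral>\<^sup>+x. g x \<partial>lborel)"
proof -
  have "(\<integral>\<^sup>+x. ennreal (c ^ DIM('a)) * g (a + c *\<^sub>R (x - b)) \<partial>lborel) =
    ennreal (c ^ DIM('a)) * (\<integral>\<^sup>+x. g (a + c *\<^sub>R (x - b)) \<partial>lborel)"
    by (rule nn_integral_cmult) simp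
  also have "(\<integral>\<^sup>+x. g (a + c *\<^sub>R (x - b)) \<partial>lborel) = (\<integral>\<^sup>+x. g (a + c *\<^sub>R x) \<partial>lborel)"
    using nn_integral_lborel_translate[of "\<lambda>x. g (a + c *\<^sub>R x)" "- b"] by simp
  also have "ennreal (c ^ DIM('a)) * \<dots> = (\<integral>\<^sup>+x. g (a + x) \<partial>lborel)"
    using nn_integral_lborel_scale[of "\<lambda>x. g (a + x)" c] assms(2) by simp
  also have "\<dots> = (\<integral>\<^sup>+x. g x \<partial>lborel)"
    using nn_integral_lborel_translate[of g a] by (simp add: add.commute)
  finally show ?thesis .
qed

section \<open>Gaussian moments and the Wasserstein distance of isotropic Gaussians\<close>

text \<open>
  One density for all Euclidean spaces: it serves both for a single observation and, with a constant
  mean vector, for the whole sample.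
\<close>
definition gaussian :: "'a::euclidean_space \<Rightarrow> real \<Rightarrow> 'a \<Rightarrow> real" where
  "gaussian m s x = (1 / sqrt (2 * pi * s\<^sup>2)) ^ DIM('a) * exp (- (norm (x - m))\<^sup>2 / (2 * s\<^sup>2))"

lemma mvn_density_gaussian: "mvn_density m s = gaussian m s"
  by (simp add: fun_eq_iff mvn_density_def gaussian_def)

lemma gaussian_nonneg [simp]: "0 \<le> gaussian m s x"
  by (simp add: gaussian_def)

lemma gaussian_measurable [measurable]: "gaussian m s \<in> borel_measurable borel"
  unfolding gaussian_def by measurable

lemma norm_square_Basis: "(norm (x :: 'a::euclidean_space))\<^sup>2 = (\<Sum>b\<in>Basis. (x \<bullet> b)\<^sup>2)"
  using euclidean_inner[of x x] by (simp only: power2_norm_eq_inner power2_eq_square[of "_ \<bullet> _"])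

lemma gaussian_prod:
  "gaussian m s (x :: 'a::euclidean_space) = (\<Prod>b\<in>Basis. normal_density (m \<bullet> b) s (x \<bullet> b))"
  unfolding gaussian_def normal_density_def norm_square_Basis
  by (simp add: prod_dividef exp_sum sum_divide_distrib sum_negf[symmetric] inner_diff_left power_one_over)

lemma nn_integral_gaussian:
  assumes "s > 0"
  shows "(\<integral>\<^sup>+x. ennreal (gaussian m s (x :: 'a::euclidean_space)) \<partial>lborel) = 1"
proof -
  have 1: "(\<integral>\<^sup>+x. ennreal (normal_density \<mu> s x) \<partial>lborel) = 1" for \<mu>
    using assms by (subst nn_integral_eq_integral) auto
  have "(\<integral>\<^sup>+x. ennreal (gaussian m s x) \<partial>lborel) =
    (\<integral>\<^sup>+x. (\<Prod>b\<in>Basis. ennreal (normal_density (m \<bullet> b) s (x \<bullet> b))) \<partial>(lborel :: 'a measure))"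
    by (simp add: gaussian_prod prod_ennreal)
  also have "\<dots> = 1"
    by (subst nn_integral_lborel_prod) (simp_all add: 1)
  finally show ?thesis .
qed

lemma nn_integral_gaussian_second_moment:
  assumes s: "s > 0"
  shows "(\<integral>\<^sup>+x. ennreal ((norm (x - m))\<^sup>2 * gaussian m s (x :: 'a::euclidean_space)) \<partial>lborel) = ennreal (real DIM('a) * s\<^sup>2)"
proof -
  have 1: "(\<integral>\<^sup>+x. ennreal (normal_density \<mu> s x) \<partial>lborel) = 1" for \<mu>
    using assms by (subst nn_integral_eq_integral) auto
  have 2: "(\<integral>\<^sup>+x. ennreal (normal_density \<mu> s x * (x - \<mu>)\<^sup>2) \<partial>lborel) = ennreal (s\<^sup>2)" for \<mu>
    using integral_normal_moment_even[OF s, of \<mu> 1] integrable_normal_moment[OF s, of \<mu> 2]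
    by (subst nn_integral_eq_integral) (auto simp: fact_numeral)
  define g where "g b b' z = ennreal (normal_density (m \<bullet> b') s z * (if b' = b then (z - m \<bullet> b')\<^sup>2 else 1))"
    for b b' z
  have "(\<integral>\<^sup>+x. ennreal ((norm (x - m))\<^sup>2 * gaussian m s x) \<partial>lborel) =
    (\<integral>\<^sup>+x. (\<Sum>b\<in>Basis. (\<Prod>b'\<in>Basis. g b b' (x \<bullet> b'))) \<partial>(lborel :: 'a measure))"
  proof (rule nn_integral_cong)
    fix x :: 'a
    have "(\<Sum>b\<in>Basis. (\<Prod>b'\<in>Basis. g b b' (x \<bullet> b'))) = (\<Sum>b\<in>Basis. ennreal (gaussian m s x * (x \<bullet> b - m \<bullet> b)\<^sup>2))"
      by (intro sum.cong) (simp_all add: g_def prod_ennreal gaussian_prod prod.distrib)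
    also have "\<dots> = ennreal ((norm (x - m))\<^sup>2 * gaussian m s x)"
      by (simp add: sum_ennreal norm_square_Basis sum_distrib_left inner_diff_left mult.commute)
    finally show "ennreal ((norm (x - m))\<^sup>2 * gaussian m s x) = (\<Sum>b\<in>Basis. (\<Prod>b'\<in>Basis. g b b' (x \<bullet> b')))" by simp
  qed
  also have "\<dots> = (\<Sum>b\<in>Basis. (\<integral>\<^sup>+x. (\<Prod>b'\<in>Basis. g b b' (x \<bullet> b')) \<partial>(lborel :: 'a measure)))"
    unfolding g_def by (rule nn_integral_sum) simp
  also have "\<dots> = (\<Sum>b\<in>(Basis::'a set). ennreal (s\<^sup>2))"
  proof (rule sum.cong[OF refl])
    fix b :: 'a assume b: "b \<in> Basis"
    have "(\<integral>\<^sup>+x. (\<Prod>b'\<in>Basis. g b b' (x \<bullet> b')) \<partial>(lborel :: 'a measure)) = (\<Prod>b'\<in>Basis. (\<integral>\<^sup>+x. g b b' x \<partial>lborel))"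
      by (rule nn_integral_lborel_prod) (simp_all add: g_def)
    also have "\<dots> = (\<Prod>b'\<in>Basis. if b' = b then ennreal (s\<^sup>2) else 1)"
      by (intro prod.cong) (simp_all add: g_def 1 2)
    finally show "(\<integral>\<^sup>+x. (\<Prod>b'\<in>Basis. g b b' (x \<bullet> b')) \<partial>(lborel :: 'a measure)) = ennreal (s\<^sup>2)"
      using b by simp
  qed
  also have "\<dots> = ennreal (real DIM('a) * s\<^sup>2)"
    by (simp add: ennreal_mult ennreal_of_nat_eq_real_of_nat)
  finally show ?thesis .
qed

lemma integrable_gaussian [simp]: "s > 0 \<Longrightarrow> integrable lborel (gaussian m s)"
  by (intro integrableI_nonneg) (auto simp: nn_integral_gaussian)

lemma integral_gaussian: "s > 0 \<Longrightarrow> (\<integral>x. gaussian m s x \<partial>lborel) = 1"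
  by (subst integral_eq_nn_integral) (auto simp: nn_integral_gaussian)

lemma integrable_gaussian_second_moment:
  "s > 0 \<Longrightarrow> integrable lborel (\<lambda>x. (norm (x - m))\<^sup>2 * gaussian m s x)"
  by (intro integrableI_nonneg) (auto simp: nn_integral_gaussian_second_moment)

lemma integral_gaussian_second_moment:
  "s > 0 \<Longrightarrow> (\<integral>x. (norm (x - m))\<^sup>2 * gaussian m s (x :: 'a::euclidean_space) \<partial>lborel) = real DIM('a) * s\<^sup>2"
  by (subst integral_eq_nn_integral) (auto simp: nn_integral_gaussian_second_moment)

lemma integrable_gaussian_first_moment:
  assumes "s > 0"
  shows "integrable lborel (\<lambda>x. gaussian m s x *\<^sub>R (x - m :: 'a::euclidean_space))"
proof (rule Bochner_Integration.integrable_bound)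
  show "integrable lborel (\<lambda>x. gaussian m s x + (norm (x - m))\<^sup>2 * gaussian m s x)"
    using assms by (intro Bochner_Integration.integrable_add integrable_gaussian integrable_gaussian_second_moment)
  have "norm z \<le> 1 + (norm z)\<^sup>2" for z :: 'a
    using zero_le_power2[of "norm z - 1/2"] by (simp add: power2_eq_square algebra_simps)
  then have "gaussian m s x * norm (x - m) \<le> gaussian m s x * (1 + (norm (x - m))\<^sup>2)" for x
    by (intro mult_left_mono) auto
  then show "AE x in lborel. norm (gaussian m s x *\<^sub>R (x - m)) \<le>
     norm (gaussian m s x + (norm (x - m))\<^sup>2 * gaussian m s x)"
    by (simp add: distrib_left mult.commute)
qed measurable

lemma integral_lborel_reflect:
  fixes f :: "'a::euclidean_space \<Rightarrow> 'b::{banach, second_countable_topology}"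
  assumes [measurable]: "f \<in> borel_measurable borel"
  shows "(\<integral>x. f (a - x) \<partial>lborel) = (\<integral>x. f x \<partial>lborel)"
proof -
  have "distr lborel borel (\<lambda>x. a - x) = (lborel :: 'a measure)"
  proof (rule measure_eqI)
    fix A :: "'a set" assume "A \<in> sets (distr lborel borel (\<lambda>x. a - x))"
    then have [measurable]: "A \<in> sets borel" by simp
    have "emeasure (distr lborel borel (\<lambda>x. a - x)) A = (\<integral>\<^sup>+x. indicator A x \<partial>distr lborel borel (\<lambda>x. a - x))"
      by (subst nn_integral_indicator) auto
    also have "\<dots> = (\<integral>\<^sup>+x. indicator A (a - x) \<partial>(lborel :: 'a measure))"
      by (rule nn_integral_distr) auto
    also have "\<dots> = emeasure lborel A"
      by (subst nn_integral_lborel_reflect) auto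
    finally show "emeasure (distr lborel borel (\<lambda>x. a - x)) A = emeasure lborel A" .
  qed simp
  then have "(\<integral>x. f x \<partial>lborel) = (\<integral>x. f x \<partial>distr lborel borel (\<lambda>x. a - x))" by simp
  also have "\<dots> = (\<integral>x. f (a - x) \<partial>lborel)" by (rule integral_distr) auto
  finally show ?thesis by simp
qed

lemma integral_gaussian_first_moment:
  "(\<integral>x. gaussian m s x *\<^sub>R (x - m :: 'a::euclidean_space) \<partial>lborel) = 0"
proof -
  have "(\<integral>x. gaussian m s x *\<^sub>R (x - m) \<partial>lborel) =
      (\<integral>x. gaussian m s (2 *\<^sub>R m - x) *\<^sub>R ((2 *\<^sub>R m - x) - m) \<partial>lborel)"
    by (rule integral_lborel_reflect[symmetric]) simp
  also have "\<dots> = (\<integral>x. - (gaussian m s x *\<^sub>R (x - m)) \<partial>lborel)"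
  proof (rule Bochner_Integration.integral_cong[OF refl])
    fix x :: 'a
    have "2 *\<^sub>R m - x - m = - (x - m)" by (simp add: scaleR_2)
    moreover from this have "gaussian m s (2 *\<^sub>R m - x) = gaussian m s x"
      by (simp only: gaussian_def norm_minus_cancel)
    ultimately show "gaussian m s (2 *\<^sub>R m - x) *\<^sub>R (2 *\<^sub>R m - x - m) = - (gaussian m s x *\<^sub>R (x - m))"
      by (metis scaleR_minus_right)
  qed
  also have "\<dots> = - (\<integral>x. gaussian m s x *\<^sub>R (x - m) \<partial>lborel)" by simp
  finally have "2 *\<^sub>R (\<integral>x. gaussian m s x *\<^sub>R (x - m) \<partial>lborel) = 0"
    by (metis add.right_inverse scaleR_2)
  then show ?thesis by simp
qed

lemma distr_gaussian_affine:
  assumes s: "s > 0" and \<sigma>: "\<sigma> > 0"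
  shows "distr (density lborel (\<lambda>y. ennreal (gaussian \<mu> \<sigma> y))) borel (\<lambda>x. m + (s / \<sigma>) *\<^sub>R (x - \<mu>)) =
         density lborel (\<lambda>y. ennreal (gaussian m s (y :: 'a::euclidean_space)))" (is "?L = ?R")
proof (rule measure_eqI)
  fix A :: "'a set" assume "A \<in> sets ?L"
  then have [measurable]: "A \<in> sets borel" by simp
  have d: "gaussian \<mu> \<sigma> x = (s / \<sigma>) ^ DIM('a) * gaussian m s (m + (s / \<sigma>) *\<^sub>R (x - \<mu>))" for x
  proof -
    have "(s / \<sigma>) * (1 / sqrt (2 * pi * s\<^sup>2)) = 1 / sqrt (2 * pi * \<sigma>\<^sup>2)"
      using s \<sigma> by (simp add: real_sqrt_mult field_simps)
    then have "(s / \<sigma>) ^ DIM('a) * (1 / sqrt (2 * pi * s\<^sup>2)) ^ DIM('a) = (1 / sqrt (2 * pi * \<sigma>\<^sup>2)) ^ DIM('a)"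
      by (simp only: power_mult_distrib[symmetric])
    moreover have "(norm ((s / \<sigma>) *\<^sub>R (x - \<mu>)))\<^sup>2 / (2 * s\<^sup>2) = (norm (x - \<mu>))\<^sup>2 / (2 * \<sigma>\<^sup>2)"
      unfolding norm_scaleR power_mult_distrib using s \<sigma> by (simp add: power_divide field_simps)
    ultimately show ?thesis
      unfolding gaussian_def by (simp only: add_diff_cancel_left' mult.assoc[symmetric] minus_divide_left[symmetric])
  qed
  have "emeasure ?L A = (\<integral>\<^sup>+x. indicator A x \<partial>?L)"
    by (subst nn_integral_indicator) auto
  also have "\<dots> = (\<integral>\<^sup>+x. ennreal ((s / \<sigma>) ^ DIM('a)) * (ennreal (gaussian m s (m + (s / \<sigma>) *\<^sub>R (x - \<mu>))) *
      indicator A (m + (s / \<sigma>) *\<^sub>R (x - \<mu>))) \<partial>lborel)"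
    by (subst nn_integral_distr, simp, simp, subst nn_integral_density)
       (use s \<sigma> in \<open>auto simp: d ennreal_mult mult.assoc\<close>)
  also have "\<dots> = (\<integral>\<^sup>+x. ennreal (gaussian m s x) * indicator A x \<partial>lborel)"
    using s \<sigma> by (intro nn_integral_lborel_affine) auto
  also have "\<dots> = emeasure ?R A" by (subst emeasure_density) auto
  finally show "emeasure ?L A = emeasure ?R A" .
qed simp

lemma esqrt_mono: "t \<le> u \<Longrightarrow> esqrt t \<le> esqrt u"
  by (cases t; cases u) (auto simp: esqrt_def top_unique)

lemma esqrt_ennreal: "0 \<le> v \<Longrightarrow> esqrt (ennreal v) = ennreal (sqrt v)"
  by (simp add: esqrt_def)

lemma integral_le_nn_integral:
  fixes f :: "'a \<Rightarrow> real"
  assumes "integrable M f"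
  shows "ennreal (\<integral>x. f x \<partial>M) \<le> (\<integral>\<^sup>+x. ennreal (f x) \<partial>M)"
proof -
  have "(\<integral>x. f x \<partial>M) \<le> enn2real (\<integral>\<^sup>+x. ennreal (f x) \<partial>M)"
    unfolding real_lebesgue_integral_def[OF assms] by simp
  then have "ennreal (\<integral>x. f x \<partial>M) \<le> ennreal (enn2real (\<integral>\<^sup>+x. ennreal (f x) \<partial>M))"
    by (rule ennreal_leI)
  also have "\<dots> \<le> (\<integral>\<^sup>+x. ennreal (f x) \<partial>M)"
    by (cases "(\<integral>\<^sup>+x. ennreal (f x) \<partial>M)") auto
  finally show ?thesis .
qed


text \<open>
  Duality: with \<open>p = x - \<mu>\<close> and \<open>q = y - m\<close> the inequality \<open>2 p \<bullet> q \<le> (r/\<sigma>) |p|\<^sup>2 + (\<sigma>/r) |q|\<^sup>2\<close> bounds \<open>|x - y|\<^sup>2\<close> below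
  by a function of \<open>x\<close> plus a function of \<open>y\<close>, whose expectation is the same for every coupling.
  For \<open>s = 0\<close> the second density vanishes, so there is no coupling and the loss is infinite.
\<close>
lemma W2_loss_ge:
  fixes \<mu> m :: "real ^ 'd"
  assumes \<sigma>: "\<sigma> > 0"
  shows "ennreal ((norm (m - \<mu>))\<^sup>2 + real CARD('d) * (\<bar>s\<bar> - \<sigma>)\<^sup>2) \<le> W2_loss \<mu> \<sigma> (mvn_density m s)"
proof -
  let ?P = "density lborel (\<lambda>y. ennreal (mvn_density \<mu> \<sigma> y))"
  let ?Q = "density lborel (\<lambda>y. ennreal (mvn_density m s y))"
  define r where "r = \<bar>s\<bar>"
  define V where "V = (norm (m - \<mu>))\<^sup>2 + real CARD('d) * (r - \<sigma>)\<^sup>2"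
  have V: "V \<ge> 0" by (simp add: V_def)
  have mr: "mvn_density m s = gaussian m r"
    by (simp add: mvn_density_gaussian gaussian_def fun_eq_iff r_def)
  have "esqrt (ennreal V) \<le> esqrt (\<integral>\<^sup>+ (X, Y). ennreal ((norm (X - Y))\<^sup>2) \<partial>M)"
    if M: "M \<in> couplings ?P ?Q" for M
  proof (rule esqrt_mono)
    from M interpret prob_space M by (simp add: couplings_def)
    have sM: "sets M = sets (borel \<Otimes>\<^sub>M borel)"
      unfolding borel_prod using M by (simp add: couplings_def)
    have fst: "distr M borel fst = ?P" and snd: "distr M borel snd = ?Q"
      using M by (simp_all add: couplings_def)
    have [measurable_cong]: "sets M = sets (borel \<Otimes>\<^sub>M borel)" by (fact sM)
    have "r \<noteq> 0"
    proof
      assume "r = 0"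
      then have "?Q = density lborel (\<lambda>_. 0)"
        by (simp add: mr gaussian_def[abs_def] power_0_left)
      then have "emeasure (distr M borel snd) UNIV = 0" by (simp add: snd emeasure_density)
      moreover have "emeasure (distr M borel snd) UNIV = 1"
        by (subst emeasure_distr) (auto simp: emeasure_space_1)
      ultimately show False by simp
    qed
    then have r: "r > 0" by (simp add: r_def)
    define A where "A x = 2 * ((\<mu> - m) \<bullet> (x - \<mu>)) + (1 - r / \<sigma>) * (norm (x - \<mu>))\<^sup>2" for x
    define B where "B y = - 2 * ((\<mu> - m) \<bullet> (y - m)) + (1 - \<sigma> / r) * (norm (y - m))\<^sup>2" for y
    have [measurable]: "A \<in> borel_measurable borel" "B \<in> borel_measurable borel"
      unfolding A_def B_def by measurable
    have gen: "integrable (density lborel (\<lambda>y. ennreal (gaussian c v y))) (\<lambda>y. a * (u \<bullet> (y - c)) + e * (norm (y - c))\<^sup>2)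
        \<and> (\<integral>y. a * (u \<bullet> (y - c)) + e * (norm (y - c))\<^sup>2 \<partial>density lborel (\<lambda>y. ennreal (gaussian c v y))) = e * (real CARD('d) * v\<^sup>2)"
      if v: "v > 0" for a e v and u c :: "real ^ 'd"
    proof -
      have eq: "gaussian c v y *\<^sub>R (a * (u \<bullet> (y - c)) + e * (norm (y - c))\<^sup>2) =
         a * (u \<bullet> (gaussian c v y *\<^sub>R (y - c))) + e * ((norm (y - c))\<^sup>2 * gaussian c v y)" for y
        by (simp add: algebra_simps)
      have "has_bochner_integral lborel (\<lambda>y. gaussian c v y *\<^sub>R (a * (u \<bullet> (y - c)) + e * (norm (y - c))\<^sup>2))
         (a * (u \<bullet> 0) + e * (real DIM(real ^ 'd) * v\<^sup>2))"
        unfolding eq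
        by (intro has_bochner_integral_add has_bochner_integral_mult_right has_bochner_integral_inner_right)
           (use v in \<open>auto simp: has_bochner_integral_iff integrable_gaussian_first_moment integral_gaussian_first_moment
             integrable_gaussian_second_moment integral_gaussian_second_moment\<close>)
      then show ?thesis
        by (subst integrable_density integral_density; simp add: has_bochner_integral_iff)+
    qed
    have IA: "integrable ?P A" "(\<integral>x. A x \<partial>?P) = (1 - r / \<sigma>) * (real CARD('d) * \<sigma>\<^sup>2)"
      using gen[OF \<sigma>] unfolding A_def mvn_density_gaussian by blast+
    have IB: "integrable ?Q B" "(\<integral>x. B x \<partial>?Q) = (1 - \<sigma> / r) * (real CARD('d) * r\<^sup>2)"
      using gen[OF r] unfolding B_def mr by blast+
    have IA': "integrable M (\<lambda>z. A (fst z))" "(\<integral>z. A (fst z) \<partial>M) = (1 - r / \<sigma>) * (real CARD('d) * \<sigma>\<^sup>2)"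
      using IA unfolding fst[symmetric] by (auto simp: integrable_distr_eq integral_distr)
    have IB': "integrable M (\<lambda>z. B (snd z))" "(\<integral>z. B (snd z) \<partial>M) = (1 - \<sigma> / r) * (real CARD('d) * r\<^sup>2)"
      using IB unfolding snd[symmetric] by (auto simp: integrable_distr_eq integral_distr)
    have "V = (norm (m - \<mu>))\<^sup>2 + ((1 - r / \<sigma>) * (real CARD('d) * \<sigma>\<^sup>2) + (1 - \<sigma> / r) * (real CARD('d) * r\<^sup>2))"
      unfolding V_def using r \<sigma> by (simp add: field_simps power2_eq_square)
    also have "\<dots> = (\<integral>z. (norm (m - \<mu>))\<^sup>2 + (A (fst z) + B (snd z)) \<partial>M)"
      using IA' IB' by (simp add: prob_space)
    also have "ennreal \<dots> \<le> (\<integral>\<^sup>+z. ennreal ((norm (m - \<mu>))\<^sup>2 + (A (fst z) + B (snd z))) \<partial>M)"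
      using IA' IB' by (intro integral_le_nn_integral) simp
    also have "\<dots> \<le> (\<integral>\<^sup>+ (X, Y). ennreal ((norm (X - Y))\<^sup>2) \<partial>M)"
    proof -
      have "(norm (m - \<mu>))\<^sup>2 + (A x + B y) \<le> (norm (x - y))\<^sup>2" for x y
      proof -
      define p q where "p = x - \<mu>" and "q = y - m"
      have "0 \<le> (norm (sqrt (r / \<sigma>) *\<^sub>R p - sqrt (\<sigma> / r) *\<^sub>R q))\<^sup>2" by simp
      also have "\<dots> = (r / \<sigma>) * (norm p)\<^sup>2 + (\<sigma> / r) * (norm q)\<^sup>2 - 2 * (sqrt (r / \<sigma>) * sqrt (\<sigma> / r)) * (p \<bullet> q)"
        using r \<sigma> unfolding power2_norm_eq_inner
        by (simp add: inner_diff_left inner_diff_right inner_commute algebra_simps)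
      also have "sqrt (r / \<sigma>) * sqrt (\<sigma> / r) = 1"
        using r \<sigma> by (simp add: real_sqrt_mult[symmetric])
      finally have 1: "2 * (p \<bullet> q) \<le> (r / \<sigma>) * (norm p)\<^sup>2 + (\<sigma> / r) * (norm q)\<^sup>2" by simp
      have expand: "(norm (u + p - q))\<^sup>2 = (norm u)\<^sup>2 + 2 * (u \<bullet> p) - 2 * (u \<bullet> q) + (norm p)\<^sup>2 + (norm q)\<^sup>2 - 2 * (p \<bullet> q)"
        for u p q :: "real ^ 'd"
        unfolding power2_norm_eq_inner
        by (simp add: inner_diff_left inner_diff_right inner_add_left inner_add_right inner_commute algebra_simps)
      have "x - y = (\<mu> - m) + p - q" by (simp add: p_def q_def)
      then have "(norm (x - y))\<^sup>2 = (norm (m - \<mu>))\<^sup>2 + 2 * ((\<mu> - m) \<bullet> p) - 2 * ((\<mu> - m) \<bullet> q) + (norm p)\<^sup>2 + (norm q)\<^sup>2 - 2 * (p \<bullet> q)"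
        by (simp only: expand norm_minus_commute[of m])
      then show ?thesis
        using 1 unfolding A_def B_def p_def[symmetric] q_def[symmetric] by (simp add: algebra_simps)
      qed
      then show ?thesis
        by (intro nn_integral_mono) (auto simp: split_beta intro!: ennreal_leI)
    qed
    finally show "ennreal V \<le> (\<integral>\<^sup>+ (X, Y). ennreal ((norm (X - Y))\<^sup>2) \<partial>M)" .
  qed
  then have "esqrt (ennreal V) \<le> W2 ?P ?Q"
    unfolding W2_def by (intro INF_greatest) auto
  then have "(esqrt (ennreal V))\<^sup>2 \<le> W2_loss \<mu> \<sigma> (mvn_density m s)"
    unfolding W2_loss_def by (rule power_mono) simp
  also have "(esqrt (ennreal V))\<^sup>2 = ennreal V"
    using V by (simp add: esqrt_ennreal ennreal_power)
  finally show ?thesis by (simp only: V_def r_def)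
qed

text \<open>The affine map from one Gaussian to the other is an optimal coupling.\<close>
lemma W2_loss_le:
  fixes \<mu> m :: "real ^ 'd"
  assumes \<sigma>: "\<sigma> > 0" and s: "s > 0"
  shows "W2_loss \<mu> \<sigma> (mvn_density m s) \<le> ennreal ((norm (m - \<mu>))\<^sup>2 + real CARD('d) * (s - \<sigma>)\<^sup>2)"
proof -
  let ?P = "density lborel (\<lambda>y. ennreal (gaussian \<mu> \<sigma> y))"
  let ?Q = "density lborel (\<lambda>y. ennreal (gaussian m s y))"
  define V where "V = (norm (m - \<mu>))\<^sup>2 + real CARD('d) * (s - \<sigma>)\<^sup>2"
  have V: "V \<ge> 0" by (simp add: V_def)
  define T where "T x = m + (s / \<sigma>) *\<^sub>R (x - \<mu>)" for x
  have [measurable]: "T \<in> borel_measurable borel" unfolding T_def by measurable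
  define M where "M = distr ?P (borel \<Otimes>\<^sub>M borel) (\<lambda>x. (x, T x))"
  have P: "prob_space ?P"
    by (rule prob_spaceI) (simp add: emeasure_density nn_integral_gaussian \<sigma>)
  have T: "distr ?P borel T = ?Q"
    unfolding T_def by (rule distr_gaussian_affine[OF s \<sigma>])
  have "M \<in> couplings ?P ?Q"
    unfolding couplings_def mem_Collect_eq
  proof (intro conjI)
    show "prob_space M" unfolding M_def by (rule prob_space.prob_space_distr[OF P]) simp
    show "sets M = sets borel" by (simp add: M_def borel_prod)
    show "distr M borel fst = ?P"
      unfolding M_def by (subst distr_distr) (auto simp: comp_def intro!: distr_id2)
    show "distr M borel snd = ?Q"
      unfolding M_def by (subst distr_distr) (auto simp: comp_def T)
  qed
  moreover have "(\<integral>\<^sup>+ (X, Y). ennreal ((norm (X - Y))\<^sup>2) \<partial>M) = ennreal V"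
  proof -
    define c where "c = 1 - s / \<sigma>"
    have "(\<integral>\<^sup>+ (X, Y). ennreal ((norm (X - Y))\<^sup>2) \<partial>M) = (\<integral>\<^sup>+ x. ennreal ((norm (x - T x))\<^sup>2) \<partial>?P)"
      unfolding M_def by (subst nn_integral_distr) auto
    also have "\<dots> = (\<integral>\<^sup>+ x. ennreal (gaussian \<mu> \<sigma> x * (norm (x - T x))\<^sup>2) \<partial>lborel)"
      by (subst nn_integral_density) (auto simp: ennreal_mult)
    also have "\<dots> = ennreal V"
    proof -
      have eq: "gaussian \<mu> \<sigma> x * (norm (x - T x))\<^sup>2 = (norm (m - \<mu>))\<^sup>2 * gaussian \<mu> \<sigma> x +
          (2 * c * ((\<mu> - m) \<bullet> (gaussian \<mu> \<sigma> x *\<^sub>R (x - \<mu>))) + c\<^sup>2 * ((norm (x - \<mu>))\<^sup>2 * gaussian \<mu> \<sigma> x))" for x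
      proof -
        have expand: "(norm (u + c *\<^sub>R p))\<^sup>2 = (norm u)\<^sup>2 + 2 * c * (u \<bullet> p) + c\<^sup>2 * (norm p)\<^sup>2" for u p :: "real ^ 'd"
          unfolding power2_norm_eq_inner
          by (simp add: inner_add_left inner_add_right inner_commute algebra_simps power2_eq_square)
        have "x - T x = (\<mu> - m) + c *\<^sub>R (x - \<mu>)"
          by (simp add: T_def c_def algebra_simps)
        then have nrm: "(norm (x - T x))\<^sup>2 = (norm (m - \<mu>))\<^sup>2 + 2 * c * ((\<mu> - m) \<bullet> (x - \<mu>)) + c\<^sup>2 * (norm (x - \<mu>))\<^sup>2"
          by (simp only: expand norm_minus_commute[of m])
        show ?thesis unfolding nrm by (simp add: algebra_simps)
      qed
      have "has_bochner_integral lborel (\<lambda>x. gaussian \<mu> \<sigma> x * (norm (x - T x))\<^sup>2)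
         ((norm (m - \<mu>))\<^sup>2 * 1 + (2 * c * ((\<mu> - m) \<bullet> 0) + c\<^sup>2 * (real DIM(real ^ 'd) * \<sigma>\<^sup>2)))"
        unfolding eq
        by (intro has_bochner_integral_add has_bochner_integral_mult_right has_bochner_integral_inner_right)
           (use \<sigma> in \<open>auto simp: has_bochner_integral_iff integral_gaussian integrable_gaussian_first_moment integral_gaussian_first_moment
             integrable_gaussian_second_moment integral_gaussian_second_moment\<close>)
      then have "(\<integral>\<^sup>+ x. ennreal (gaussian \<mu> \<sigma> x * (norm (x - T x))\<^sup>2) \<partial>lborel) =
          ennreal ((norm (m - \<mu>))\<^sup>2 + c\<^sup>2 * (real CARD('d) * \<sigma>\<^sup>2))"
        by (subst nn_integral_eq_integral) (auto simp: has_bochner_integral_iff)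
      also have "c\<^sup>2 * (real CARD('d) * \<sigma>\<^sup>2) = real CARD('d) * (s - \<sigma>)\<^sup>2"
        using \<sigma> by (simp add: c_def field_simps power2_eq_square)
      finally show ?thesis by (simp add: V_def)
    qed
    finally show ?thesis .
  qed
  ultimately have "W2 ?P ?Q \<le> esqrt (ennreal V)"
    unfolding W2_def by (metis (no_types, lifting) INF_lower)
  then have "W2_loss \<mu> \<sigma> (mvn_density m s) \<le> (esqrt (ennreal V))\<^sup>2"
    unfolding W2_loss_def mvn_density_gaussian by (rule power_mono) simp
  also have "(esqrt (ennreal V))\<^sup>2 = ennreal V"
    using V by (simp add: esqrt_ennreal ennreal_power)
  finally show ?thesis by (simp only: V_def)
qed

section \<open>The sample density and one-sided identities for monotone functions\<close>

lemma sum_sample: "(\<Sum>i\<in>UNIV. (x :: (real ^ 'd) ^ 'n) $ i) = real CARD('n) *\<^sub>R sample_mean x"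
  by (simp add: sample_mean_def)

lemma sum_square_deviation:
  fixes x :: "(real ^ 'd) ^ 'n"
  shows "(\<Sum>i\<in>UNIV. (norm (x $ i - \<mu>))\<^sup>2) = real CARD('n) * (norm (sample_mean x - \<mu>))\<^sup>2 + rss x"
proof -
  let ?m = "sample_mean x"
  have "(norm (x $ i - \<mu>))\<^sup>2 = (norm (x $ i - ?m))\<^sup>2 + 2 * ((x $ i - ?m) \<bullet> (?m - \<mu>)) + (norm (?m - \<mu>))\<^sup>2" for i
  proof -
    have "(norm (u + v))\<^sup>2 = (norm u)\<^sup>2 + 2 * (u \<bullet> v) + (norm v)\<^sup>2" for u v :: "real ^ 'd"
      unfolding power2_norm_eq_inner by (simp add: inner_add_left inner_add_right inner_commute)
    from this[of "x $ i - ?m" "?m - \<mu>"] show ?thesis by simp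
  qed
  moreover have "(\<Sum>i\<in>UNIV. (x $ i - ?m) \<bullet> (?m - \<mu>)) = 0"
  proof -
    have "(\<Sum>i\<in>UNIV. (x $ i - ?m) \<bullet> (?m - \<mu>)) = (\<Sum>i\<in>UNIV. x $ i - ?m) \<bullet> (?m - \<mu>)"
      by (rule inner_sum_left[symmetric])
    also have "(\<Sum>i\<in>UNIV. x $ i - ?m) = 0"
      by (simp only: sum_subtractf sum_sample sum_constant_scaleR) simp
    finally show ?thesis by simp
  qed
  ultimately show ?thesis
    by (simp add: sum.distrib rss_def sum_distrib_left[symmetric])
qed

lemma sample_density_gaussian:
  fixes x :: "(real ^ 'd) ^ 'n"
  shows "sample_density \<mu> \<sigma> x = gaussian (\<chi> i. \<mu>) \<sigma> x"
proof -
  have "(norm (x - (\<chi> i. \<mu>)))\<^sup>2 = (\<Sum>i\<in>UNIV. (norm (x $ i - \<mu>))\<^sup>2)"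
    by (simp add: power2_norm_eq_inner inner_vec_def)
  then show ?thesis
    unfolding sample_density_def mvn_density_def gaussian_def
    by (simp add: prod.distrib exp_sum[symmetric] sum_divide_distrib sum_negf power_mult[symmetric] mult.commute)
qed

lemma sample_density_mean_rss:
  fixes x :: "(real ^ 'd) ^ 'n"
  shows "sample_density \<mu> \<sigma> x = (1 / sqrt (2 * pi * \<sigma>\<^sup>2)) ^ (CARD('n) * CARD('d)) *
    exp (- (real CARD('n) * (norm (sample_mean x - \<mu>))\<^sup>2 + rss x) / (2 * \<sigma>\<^sup>2))"
proof -
  have "(norm (x - (\<chi> i. \<mu>)))\<^sup>2 = real CARD('n) * (norm (sample_mean x - \<mu>))\<^sup>2 + rss x"
    unfolding sum_square_deviation[symmetric] by (simp add: power2_norm_eq_inner inner_vec_def)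
  then show ?thesis
    by (simp add: sample_density_gaussian gaussian_def)
qed

lemma sample_density_nonneg [simp]: "0 \<le> sample_density \<mu> \<sigma> x"
  by (simp add: sample_density_gaussian)

lemma sample_density_pos: "\<sigma> > 0 \<Longrightarrow> 0 < sample_density \<mu> \<sigma> x"
  by (simp add: sample_density_gaussian gaussian_def)

lemma sample_density_measurable [measurable]:
  "(sample_density \<mu> \<sigma> :: (real ^ 'd) ^ 'n \<Rightarrow> real) \<in> borel_measurable borel"
  unfolding sample_density_gaussian[abs_def] by measurable

lemma rss_nonneg [simp]: "0 \<le> rss x"
  by (simp add: rss_def sum_nonneg)

lemma sample_mean_shift: "sample_mean ((\<chi> i. x $ i + b) :: (real ^ 'd) ^ 'n) = sample_mean x + b"
  by (simp add: sample_mean_def sum.distrib scaleR_right_distrib sum_constant_scaleR del: sum_constant)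

lemma sample_mean_loc_scale: "sample_mean (loc_scale a b x) = a *\<^sub>R sample_mean x + b"
proof -
  have "loc_scale a b x = (\<chi> i. (a *\<^sub>R x) $ i + b)" by (simp add: loc_scale_def vec_eq_iff)
  then show ?thesis by (simp only: sample_mean_shift sample_mean_scaleR)
qed

lemma rss_loc_scale: "rss (loc_scale a b x) = a\<^sup>2 * rss x"
proof -
  have "loc_scale a b x $ i - sample_mean (loc_scale a b x) = a *\<^sub>R (x $ i - sample_mean x)" for i
    unfolding sample_mean_loc_scale by (simp add: loc_scale_def algebra_simps)
  then show ?thesis by (simp add: rss_def power_mult_distrib sum_distrib_left)
qed

lemma dilate_mean_loc_scale: "dilate_mean t x = loc_scale 1 ((t - 1) *\<^sub>R sample_mean x) x"
  by (simp add: dilate_mean_def loc_scale_def)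

lemma dilate_residuals_loc_scale: "dilate_residuals t x = loc_scale t ((1 - t) *\<^sub>R sample_mean x) x"
  by (simp add: dilate_residuals_def loc_scale_def vec_eq_iff algebra_simps)

lemma sample_mean_dilate_mean [simp]: "sample_mean (dilate_mean t x) = t *\<^sub>R sample_mean x"
  unfolding dilate_mean_loc_scale sample_mean_loc_scale by (simp add: algebra_simps)

lemma rss_dilate_mean [simp]: "rss (dilate_mean t x) = rss x"
  unfolding dilate_mean_loc_scale rss_loc_scale by simp

lemma sample_mean_dilate_residuals [simp]: "sample_mean (dilate_residuals t x) = sample_mean x"
  unfolding dilate_residuals_loc_scale sample_mean_loc_scale by (simp add: algebra_simps)

lemma rss_dilate_residuals [simp]: "rss (dilate_residuals t x) = t\<^sup>2 * rss x"
  unfolding dilate_residuals_loc_scale rss_loc_scale by simp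

lemma AE_rss_pos:
  assumes "CARD('n) \<ge> 2"
  shows "AE x in lborel. rss (x :: (real ^ 'd) ^ 'n) > 0"
proof -
  obtain i j :: 'n where ij: "i \<noteq> j"
    using assms by (metis card_le_Suc0_iff_eq finite_class.finite_UNIV UNIV_I not_less_eq_eq numeral_2_eq_2)
  obtain e :: "real ^ 'd" where e: "e \<in> Basis" using nonempty_Basis by blast
  define a :: "(real ^ 'd) ^ 'n" where "a = axis i e - axis j e"
  have "a $ i = e" using ij by (simp add: a_def axis_def)
  then have "a \<noteq> 0" using e nonzero_Basis by fastforce
  then have "negligible {x. a \<bullet> x = 0}" by (intro negligible_hyperplane) auto
  moreover have "{x. a \<bullet> x = 0} \<in> sets borel" by measurable
  ultimately have null: "{x. a \<bullet> x = 0} \<in> null_sets lborel"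
    by (simp add: negligible_iff_null_sets null_sets_completion_iff)
  show ?thesis
  proof (rule AE_I'[OF null], clarsimp)
    fix x :: "(real ^ 'd) ^ 'n" assume "\<not> 0 < rss x"
    then have "rss x = 0" using rss_nonneg[of x] by simp
    then have "x $ k = sample_mean x" for k
      unfolding rss_def by (subst (asm) sum_nonneg_eq_0_iff) auto
    then have "x $ i = x $ j" by metis
    then show "a \<bullet> x = 0" by (simp add: a_def inner_diff_left inner_axis')
  qed
qed

lemma AE_sample_mean_nonzero: "AE x in lborel. sample_mean (x :: (real ^ 'd) ^ 'n) \<noteq> 0"
proof -
  obtain e :: "real ^ 'd" where e: "e \<in> Basis" using nonempty_Basis by blast
  define a :: "(real ^ 'd) ^ 'n" where "a = (\<chi> i. e)"
  have "a $ undefined = e" by (simp add: a_def)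
  then have "a \<noteq> 0" using e nonzero_Basis by fastforce
  then have "negligible {x. a \<bullet> x = 0}" by (intro negligible_hyperplane) auto
  moreover have "{x. a \<bullet> x = 0} \<in> sets borel" by measurable
  ultimately have null: "{x. a \<bullet> x = 0} \<in> null_sets lborel"
    by (simp add: negligible_iff_null_sets null_sets_completion_iff)
  show ?thesis
  proof (rule AE_I'[OF null], clarsimp)
    fix x :: "(real ^ 'd) ^ 'n" assume "sample_mean x = 0"
    then have "(\<Sum>i\<in>UNIV. x $ i) = 0" by (simp add: sample_mean_def)
    moreover have "a \<bullet> x = e \<bullet> (\<Sum>i\<in>UNIV. x $ i)"
      by (simp add: a_def inner_vec_def[where 'b = 'n] inner_sum_right)
    ultimately show "a \<bullet> x = 0" by simp
  qed
qed

text \<open>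
  One-parameter dilations \<open>D t\<close> of a block of \<open>p\<close> coordinates and a Gaussian density \<open>f\<close>. Along the dilation
  \<open>ln f\<close> is quadratic in \<open>t\<close>; \<open>A\<close> is the radial part of the score at \<open>t = 1\<close>, up to sign.
\<close>
locale dilation_family =
  fixes D :: "real \<Rightarrow> 'a::euclidean_space \<Rightarrow> 'a" and p :: nat and f A B :: "'a \<Rightarrow> real"
  assumes jacobian: "\<And>t g. t > 0 \<Longrightarrow> g \<in> borel_measurable borel \<Longrightarrow>
      ennreal (t ^ p) * (\<integral>\<^sup>+x. g (D t x) \<partial>lborel) = (\<integral>\<^sup>+x. g x \<partial>lborel)"
    and D_measurable [measurable]: "\<And>t. D t \<in> borel_measurable borel"
    and f_measurable [measurable]: "f \<in> borel_measurable borel"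
    and f_dilate: "\<And>t x. f (D t x) = f x * exp (- ((t - 1) * A x + (t - 1)\<^sup>2 * B x))"
    and f_nonneg: "\<And>x. 0 \<le> f x"
begin

text \<open>
  Substitute \<open>x \<mapsto> D t x\<close> in \<open>\<integral> f G\<close>. The Jacobian and the growth of \<open>G\<close> contribute \<open>t\<^bsup>p + q\<^esup>\<close>, the
  density contributes an exponential, and the bounds \<open>exp y \<ge> 1 + y\<close> and \<open>ln t \<ge> 1 - 1 / t\<close> make the result
  rational in \<open>t\<close>. The common factor \<open>t - 1\<close> of both sides is kept because its sign matters.
\<close>
lemma dilation_inequality:
  assumes [measurable]: "G \<in> borel_measurable borel"
    and G: "\<And>x. 0 \<le> G x" "\<And>x. t powr q * G x \<le> G (D t x)"
    and int: "integrable lborel (\<lambda>x. f x * G x)" "integrable lborel (\<lambda>x. f x * G x * A x)"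
      "integrable lborel (\<lambda>x. f x * G x * B x)"
    and t: "t > 0" and pq: "real p + q \<ge> 0"
  shows "(t - 1) * ((real p + q) * (\<integral>x. f x * G x \<partial>lborel) / t) \<le>
    (t - 1) * ((\<integral>x. f x * G x * A x \<partial>lborel) + (t - 1) * (\<integral>x. f x * G x * B x \<partial>lborel))"
proof -
  define I0 IA IB where "I0 = (\<integral>x. f x * G x \<partial>lborel)" and "IA = (\<integral>x. f x * G x * A x \<partial>lborel)"
    and "IB = (\<integral>x. f x * G x * B x \<partial>lborel)"
  define r where "r = (real p + q) * ln t"
  have fG: "0 \<le> f x * G x" for x using f_nonneg G(1) by simp
  have I0: "ennreal I0 = (\<integral>\<^sup>+x. ennreal (f x * G x) \<partial>lborel)" "I0 \<ge> 0"
    unfolding I0_def using int(1) fG by (auto intro: nn_integral_eq_integral[symmetric])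
  define J where "J = I0 + r * I0 - (t - 1) * IA - (t - 1)\<^sup>2 * IB"
  define j where "j x = f x * G x + r * (f x * G x) - (t - 1) * (f x * G x * A x) - (t - 1)\<^sup>2 * (f x * G x * B x)" for x
  have "has_bochner_integral lborel j J"
    unfolding j_def J_def I0_def IA_def IB_def
    by (intro has_bochner_integral_add has_bochner_integral_diff has_bochner_integral_mult_right
        has_bochner_integral_integrable int)
  then have "ennreal J \<le> (\<integral>\<^sup>+x. ennreal (j x) \<partial>lborel)"
    using integral_le_nn_integral[of lborel j] by (simp only: has_bochner_integral_iff)
  also have "\<dots> \<le> (\<integral>\<^sup>+x. ennreal (t ^ p) * ennreal (f (D t x) * G (D t x)) \<partial>lborel)"
  proof (rule nn_integral_mono)
    fix x
    define y where "y = r - (t - 1) * A x - (t - 1)\<^sup>2 * B x"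
    have "j x = f x * G x * (1 + y)"
      unfolding j_def y_def by (simp add: algebra_simps)
    also have "\<dots> \<le> f x * G x * exp y"
      using fG by (intro mult_left_mono exp_ge_add_one_self) auto
    also have "exp y = t ^ p * (t powr q * exp (- ((t - 1) * A x + (t - 1)\<^sup>2 * B x)))"
    proof -
      have "t ^ p = exp (real p * ln t)" using t by (simp add: exp_of_nat_mult)
      moreover have "t powr q = exp (q * ln t)" using t by (simp add: powr_def)
      ultimately show ?thesis
        by (simp add: exp_add[symmetric] y_def r_def algebra_simps)
    qed
    also have "f x * G x * \<dots> = t ^ p * (f (D t x) * (t powr q * G x))"
      by (simp add: f_dilate)
    also have "\<dots> \<le> t ^ p * (f (D t x) * G (D t x))"
      using t f_nonneg G by (intro mult_left_mono) auto
    finally show "ennreal (j x) \<le> ennreal (t ^ p) * ennreal (f (D t x) * G (D t x))"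
      using t fG by (simp add: ennreal_mult[symmetric] ennreal_leI)
  qed
  also have "\<dots> = ennreal I0"
    unfolding I0 using jacobian[OF t, of "\<lambda>x. ennreal (f x * G x)"] by (simp add: nn_integral_cmult)
  finally have "J \<le> I0" using I0(2) by (subst (asm) ennreal_le_iff) auto
  then have "r * I0 \<le> (t - 1) * IA + (t - 1)\<^sup>2 * IB" by (simp add: J_def)
  moreover have "(t - 1) * ((real p + q) * I0 / t) \<le> r * I0"
  proof -
    have "- ln t = ln (1 / t)" using t by (simp add: ln_div)
    also have "\<dots> \<le> 1 / t - 1" using t by (intro ln_le_minus_one) auto
    finally have "(t - 1) / t \<le> ln t" using t by (simp add: field_simps)
    then have "((real p + q) * I0) * ((t - 1) / t) \<le> ((real p + q) * I0) * ln t"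
      using pq I0(2) by (intro mult_left_mono) auto
    then show ?thesis by (simp add: r_def mult_ac)
  qed
  ultimately show ?thesis
    unfolding I0_def[symmetric] IA_def[symmetric] IB_def[symmetric]
    by (simp add: algebra_simps power2_eq_square)
qed

text \<open>
  Divide by \<open>t - 1\<close> and let \<open>t\<close> decrease to 1. This is integration by parts along the dilation, with
  the derivative of \<open>G\<close> replaced by a growth condition.
\<close>
lemma dilation_inequality_up:
  assumes G_meas: "G \<in> borel_measurable borel"
    and G: "\<And>x. 0 \<le> G x" "\<And>t x. t > 1 \<Longrightarrow> t powr q * G x \<le> G (D t x)"
    and int: "integrable lborel (\<lambda>x. f x * G x)" "integrable lborel (\<lambda>x. f x * G x * A x)"
      "integrable lborel (\<lambda>x. f x * G x * B x)"
    and pq: "real p + q \<ge> 0"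
  shows "(real p + q) * (\<integral>x. f x * G x \<partial>lborel) \<le> (\<integral>x. f x * G x * A x \<partial>lborel)"
proof -
  define I0 IA IB where "I0 = (real p + q) * (\<integral>x. f x * G x \<partial>lborel)" and "IA = (\<integral>x. f x * G x * A x \<partial>lborel)"
    and "IB = (\<integral>x. f x * G x * B x \<partial>lborel)"
  have le: "I0 / t \<le> IA + (t - 1) * IB" if t: "t > 1" for t
  proof -
    have t0: "t > 0" using t by simp
    have "(t - 1) * (I0 / t) \<le> (t - 1) * (IA + (t - 1) * IB)"
      unfolding I0_def IA_def IB_def by (rule dilation_inequality[OF G_meas G(1) G(2)[OF t] int t0 pq])
    then show ?thesis using t by (simp only: mult_le_cancel_left_pos diff_gt_0_iff_gt)
  qed
  have "I0 / 1 \<le> IA + (1 - 1) * IB"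
  proof (rule tendsto_le)
    show "((\<lambda>t. I0 / t) \<longlongrightarrow> I0 / 1) (at_right 1)" "((\<lambda>t. IA + (t - 1) * IB) \<longlongrightarrow> IA + (1 - 1) * IB) (at_right 1)"
      by (auto intro!: tendsto_eq_intros)
    show "\<forall>\<^sub>F t in at_right 1. I0 / t \<le> IA + (t - 1) * IB"
      by (rule eventually_mono[OF eventually_at_right_less]) (rule le)
  qed simp
  then show ?thesis by (simp add: I0_def IA_def)
qed

text \<open>The same from below: dividing by \<open>t - 1 < 0\<close> reverses the inequality.\<close>
lemma dilation_inequality_down:
  assumes G_meas: "G \<in> borel_measurable borel"
    and G: "\<And>x. 0 \<le> G x" "\<And>t x. 0 < t \<Longrightarrow> t < 1 \<Longrightarrow> t powr q * G x \<le> G (D t x)"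
    and int: "integrable lborel (\<lambda>x. f x * G x)" "integrable lborel (\<lambda>x. f x * G x * A x)"
      "integrable lborel (\<lambda>x. f x * G x * B x)"
    and pq: "real p + q \<ge> 0"
  shows "(\<integral>x. f x * G x * A x \<partial>lborel) \<le> (real p + q) * (\<integral>x. f x * G x \<partial>lborel)"
proof -
  define I0 IA IB where "I0 = (real p + q) * (\<integral>x. f x * G x \<partial>lborel)" and "IA = (\<integral>x. f x * G x * A x \<partial>lborel)"
    and "IB = (\<integral>x. f x * G x * B x \<partial>lborel)"
  have le: "IA + (t - 1) * IB \<le> I0 / t" if t: "0 < t" "t < 1" for t
  proof -
    have "(t - 1) * (I0 / t) \<le> (t - 1) * (IA + (t - 1) * IB)"
      unfolding I0_def IA_def IB_def by (rule dilation_inequality[OF G_meas G(1) G(2)[OF t] int t(1) pq])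
    then show ?thesis using t by (simp only: mult_le_cancel_left_neg diff_less_0_iff_less)
  qed
  have "IA + (1 - 1) * IB \<le> I0 / 1"
  proof (rule tendsto_le)
    show "((\<lambda>t. I0 / t) \<longlongrightarrow> I0 / 1) (at_left 1)" "((\<lambda>t. IA + (t - 1) * IB) \<longlongrightarrow> IA + (1 - 1) * IB) (at_left 1)"
      by (auto intro!: tendsto_eq_intros)
    have "\<forall>\<^sub>F t :: real in at_left 1. t \<in> {0<..<1}"
      by (rule eventually_at_left_real) simp
    then show "\<forall>\<^sub>F t in at_left 1. IA + (t - 1) * IB \<le> I0 / t"
      by eventually_elim (use le in auto)
  qed simp
  then show ?thesis by (simp add: I0_def IA_def)
qed

end

section \<open>Best equivariant estimators\<close>

definition gamma_kernel :: "real \<Rightarrow> real \<Rightarrow> real \<Rightarrow> real" where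
  "gamma_kernel p A t = indicator {0<..} t * (t powr (p - 1) * exp (- (A * t)))"

lemma gamma_kernel_measurable [measurable]: "gamma_kernel p A \<in> borel_measurable borel"
  unfolding gamma_kernel_def by measurable

lemma gamma_kernel_nonneg [simp]: "0 \<le> gamma_kernel p A t"
  by (simp add: gamma_kernel_def)

lemma nn_integral_gamma_kernel:
  assumes p: "p > 0" and A: "A > 0"
  shows "(\<integral>\<^sup>+t. ennreal (gamma_kernel p A t) \<partial>lborel) = ennreal (Gamma p / A powr p)"
proof -
  have "ennreal (Gamma p) = (\<integral>\<^sup>+t. ennreal (indicator {0..} t * t powr (p - 1) / exp t) \<partial>lborel)"
    by (rule Gamma_conv_nn_integral_real[OF p])
  also have "\<dots> = ennreal \<bar>A\<bar> * (\<integral>\<^sup>+t. ennreal (indicator {0..} (0 + A * t) * (0 + A * t) powr (p - 1) / exp (0 + A * t)) \<partial>lborel)"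
    by (rule nn_integral_real_affine) (use A in auto)
  also have "\<dots> = (\<integral>\<^sup>+t. ennreal (A powr p) * ennreal (gamma_kernel p A t) \<partial>lborel)"
  proof (subst nn_integral_cmult[symmetric], simp, rule nn_integral_cong)
    fix t :: real
    have "A * (indicator {0..} (A * t) * (A * t) powr (p - 1) / exp (A * t)) = A powr p * gamma_kernel p A t"
    proof (cases "t > 0")
      case True
      have "A * A powr (p - 1) = A powr p" using A by (simp add: powr_mult_base)
      then show ?thesis using True A
        by (simp add: gamma_kernel_def powr_mult exp_minus field_simps)
    next
      case False
      then have "A * t \<le> 0" using A by (simp add: mult_le_0_iff)
      then show ?thesis using False A
        by (cases "t = 0") (auto simp: gamma_kernel_def indicator_def zero_le_mult_iff)
    qed
    then show "ennreal \<bar>A\<bar> * ennreal (indicator {0..} (0 + A * t) * (0 + A * t) powr (p - 1) / exp (0 + A * t))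
       = ennreal (A powr p) * ennreal (gamma_kernel p A t)"
      using A by (simp add: ennreal_mult''[symmetric])
  qed
  also have "\<dots> = ennreal (A powr p) * (\<integral>\<^sup>+t. ennreal (gamma_kernel p A t) \<partial>lborel)"
    by (rule nn_integral_cmult) simp
  finally have *: "ennreal (A powr p) * (\<integral>\<^sup>+t. ennreal (gamma_kernel p A t) \<partial>lborel) = ennreal (Gamma p)" by simp
  have "(\<integral>\<^sup>+t. ennreal (gamma_kernel p A t) \<partial>lborel) = ennreal (1 / A powr p) * (ennreal (A powr p) * (\<integral>\<^sup>+t. ennreal (gamma_kernel p A t) \<partial>lborel))"
    using A by (simp add: mult.assoc[symmetric] ennreal_mult''[symmetric])
  also have "\<dots> = ennreal (Gamma p / A powr p)"
    unfolding * using A by (simp add: ennreal_mult'[symmetric])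
  finally show ?thesis .
qed

lemma has_bochner_integral_gamma_kernel:
  assumes "p > 0" "A > 0"
  shows "has_bochner_integral lborel (gamma_kernel p A) (Gamma p / A powr p)"
  by (rule has_bochner_integral_nn_integral)
     (use assms in \<open>auto simp: nn_integral_gamma_kernel intro!: divide_nonneg_nonneg less_imp_le[OF Gamma_real_pos]\<close>)

text \<open>
  Polar coordinates for the residuals without a sphere: insert \<open>\<integral> \<tau>\<^bsup>-1\<^esup> w(S / \<tau>) d\<tau> = 1\<close>, where
  \<open>w(s) = 1 / s\<close> for \<open>s \<ge> 1\<close> and 0 otherwise, exchange the integrals, and dilate the residuals by \<open>sqrt \<tau>\<close>.
\<close>
lemma nn_integral_residual_polar:
  fixes F :: "(real ^ 'd) ^ 'n \<Rightarrow> ennreal"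
  assumes [measurable]: "F \<in> borel_measurable borel" and n: "CARD('n) \<ge> 2"
  defines "p \<equiv> real (CARD('d) * (CARD('n) - 1)) / 2"
  shows "(\<integral>\<^sup>+x. F x \<partial>lborel) =
    (\<integral>\<^sup>+x. ennreal (indicator {1..} (rss x) / rss x) *
       (\<integral>\<^sup>+\<tau>. ennreal (indicator {0<..} \<tau> * \<tau> powr (p - 1)) * F (dilate_residuals (sqrt \<tau>) x) \<partial>lborel) \<partial>lborel)"
proof -
  define k where "k = CARD('d) * (CARD('n) - 1)"
  have pk: "p = real k / 2" by (simp add: p_def k_def)
  define w :: "real \<Rightarrow> ennreal" where "w s = ennreal (indicator {1..} s / s)" for s
  have [measurable]: "w \<in> borel_measurable borel" unfolding w_def by measurable
  have [measurable]: "(\<lambda>(x, \<tau>). dilate_residuals (sqrt \<tau>) (x :: (real ^ 'd) ^ 'n)) \<in> borel_measurable (borel \<Otimes>\<^sub>M borel)"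
    unfolding dilate_residuals_def sample_mean_def case_prod_beta' borel_prod
    by (intro borel_measurable_continuous_onI continuous_intros)
  have "(\<integral>\<^sup>+x. w (rss x) * (\<integral>\<^sup>+\<tau>. ennreal (indicator {0<..} \<tau> * \<tau> powr (p - 1)) * F (dilate_residuals (sqrt \<tau>) x) \<partial>lborel) \<partial>lborel)
    = (\<integral>\<^sup>+x. \<integral>\<^sup>+\<tau>. w (rss x) * (ennreal (indicator {0<..} \<tau> * \<tau> powr (p - 1)) * F (dilate_residuals (sqrt \<tau>) x)) \<partial>lborel \<partial>lborel)"
    by (intro nn_integral_cong nn_integral_cmult[symmetric]) measurable
  also have "\<dots> = (\<integral>\<^sup>+\<tau>. \<integral>\<^sup>+x. w (rss x) * (ennreal (indicator {0<..} \<tau> * \<tau> powr (p - 1)) * F (dilate_residuals (sqrt \<tau>) x)) \<partial>lborel \<partial>lborel)"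
    by (rule lborel_pair.Fubini') measurable
  also have "\<dots> = (\<integral>\<^sup>+\<tau>. \<integral>\<^sup>+x. ennreal (indicator {0<..} \<tau> / \<tau>) * (w (rss x / \<tau>) * F x) \<partial>lborel \<partial>lborel)"
  proof (rule nn_integral_cong)
    fix \<tau> :: real
    show "(\<integral>\<^sup>+x. w (rss x) * (ennreal (indicator {0<..} \<tau> * \<tau> powr (p - 1)) * F (dilate_residuals (sqrt \<tau>) x)) \<partial>lborel) =
      (\<integral>\<^sup>+x. ennreal (indicator {0<..} \<tau> / \<tau>) * (w (rss x / \<tau>) * F x) \<partial>lborel)"
    proof (cases "\<tau> > 0")
      case True
      let ?g = "\<lambda>x. w (rss x / \<tau>) * F x"
      have pw: "\<tau> powr (p - 1) = (1 / \<tau>) * sqrt \<tau> ^ k"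
      proof -
        have "sqrt \<tau> ^ k = (\<tau> powr (1 / 2)) powr (real k)"
          using True by (simp add: powr_half_sqrt powr_realpow)
        also have "\<dots> = \<tau> powr p" using True by (simp add: powr_powr pk)
        finally show ?thesis using True by (simp add: powr_diff)
      qed
      have "(\<integral>\<^sup>+x. w (rss x) * (ennreal (indicator {0<..} \<tau> * \<tau> powr (p - 1)) * F (dilate_residuals (sqrt \<tau>) x)) \<partial>lborel)
        = (\<integral>\<^sup>+x. ennreal (\<tau> powr (p - 1)) * ?g (dilate_residuals (sqrt \<tau>) x) \<partial>lborel)"
        using True by (intro nn_integral_cong) (simp add: mult_ac)
      also have "\<dots> = ennreal (\<tau> powr (p - 1)) * (\<integral>\<^sup>+x. ?g (dilate_residuals (sqrt \<tau>) x) \<partial>lborel)"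
        by (rule nn_integral_cmult) measurable
      also have "\<dots> = ennreal (1 / \<tau>) * (ennreal (sqrt \<tau> ^ k) * (\<integral>\<^sup>+x. ?g (dilate_residuals (sqrt \<tau>) x) \<partial>lborel))"
        unfolding pw using True by (subst ennreal_mult) (auto simp: mult.assoc)
      also have "\<dots> = ennreal (1 / \<tau>) * (\<integral>\<^sup>+x. ?g x \<partial>lborel)"
        unfolding k_def using True by (subst nn_integral_dilate_residuals) auto
      also have "\<dots> = (\<integral>\<^sup>+x. ennreal (1 / \<tau>) * ?g x \<partial>lborel)"
        by (rule nn_integral_cmult[symmetric]) measurable
      finally show ?thesis using True by simp
    qed simp
  qed
  also have "\<dots> = (\<integral>\<^sup>+x. \<integral>\<^sup>+\<tau>. ennreal (indicator {0<..} \<tau> / \<tau>) * (w (rss x / \<tau>) * F x) \<partial>lborel \<partial>lborel)"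
    by (rule lborel_pair.Fubini') measurable
  also have "\<dots> = (\<integral>\<^sup>+x. F x \<partial>lborel)"
  proof (rule nn_integral_cong_AE, rule AE_mp[OF AE_rss_pos[OF n]], rule AE_I2, rule impI)
    fix x :: "(real ^ 'd) ^ 'n" assume S: "rss x > 0"
    have "(\<integral>\<^sup>+\<tau>. ennreal (indicator {0<..} \<tau> / \<tau>) * (w (rss x / \<tau>) * F x) \<partial>lborel) =
      (\<integral>\<^sup>+\<tau>. ennreal (1 / rss x) * F x * indicator {0<..rss x} \<tau> \<partial>lborel)"
    proof (rule nn_integral_cong)
      fix \<tau> :: real
      show "ennreal (indicator {0<..} \<tau> / \<tau>) * (w (rss x / \<tau>) * F x) = ennreal (1 / rss x) * F x * indicator {0<..rss x} \<tau>"
        using S by (cases "\<tau> > 0"; cases "\<tau> \<le> rss x")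
          (auto simp: w_def indicator_def mult.assoc[symmetric] ennreal_mult''[symmetric])
    qed
    also have "\<dots> = ennreal (1 / rss x) * F x * ennreal (rss x)"
      using S by (simp add: nn_integral_cmult_indicator)
    also have "\<dots> = F x"
      using S by (simp add: mult.assoc mult.commute[of "F x"]) (simp add: mult.assoc[symmetric] ennreal_mult''[symmetric])
    finally show "(\<integral>\<^sup>+\<tau>. ennreal (indicator {0<..} \<tau> / \<tau>) * (w (rss x / \<tau>) * F x) \<partial>lborel) = F x" .
  qed
  finally show ?thesis by (simp add: w_def)
qed

lemma nn_integral_gamma_quadratic:
  assumes p: "p > 0" and A: "A > 0"
  shows "(\<integral>\<^sup>+\<tau>. ennreal (gamma_kernel p A \<tau> * (sqrt \<tau> * r - \<sigma>)\<^sup>2) \<partial>lborel) =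
    ennreal (Gamma (p + 1) / A powr (p + 1) * r\<^sup>2 - 2 * (\<sigma> * Gamma (p + 1 / 2) / A powr (p + 1 / 2)) * r + \<sigma>\<^sup>2 * (Gamma p / A powr p))"
proof -
  have eq: "gamma_kernel p A \<tau> * (sqrt \<tau> * r - \<sigma>)\<^sup>2 =
     gamma_kernel (p + 1) A \<tau> * r\<^sup>2 - gamma_kernel (p + 1 / 2) A \<tau> * (2 * \<sigma> * r) + gamma_kernel p A \<tau> * \<sigma>\<^sup>2" for \<tau>
  proof (cases "\<tau> > 0")
    case True
    have 1: "\<tau> powr p = \<tau> powr (p - 1) * \<tau>"
      using True by (simp add: powr_diff)
    have 2: "\<tau> powr (p - 1 / 2) = \<tau> powr (p - 1) * sqrt \<tau>"
    proof -
      have "\<tau> powr (p - 1) * sqrt \<tau> = \<tau> powr (p - 1 + 1 / 2)"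
        using True by (simp add: powr_half_sqrt powr_add[symmetric] del: powr_half_sqrt flip: powr_half_sqrt)
      then show ?thesis by simp
    qed
    have "(sqrt \<tau> * r - \<sigma>)\<^sup>2 = \<tau> * r\<^sup>2 - sqrt \<tau> * (2 * \<sigma> * r) + \<sigma>\<^sup>2"
      using True by (simp add: power2_diff power_mult_distrib mult_ac)
    then have sq: "gamma_kernel p A \<tau> * (sqrt \<tau> * r - \<sigma>)\<^sup>2 = gamma_kernel p A \<tau> * (\<tau> * r\<^sup>2 - sqrt \<tau> * (2 * \<sigma> * r) + \<sigma>\<^sup>2)"
      by (rule arg_cong)
    have "gamma_kernel (p + 1) A \<tau> = gamma_kernel p A \<tau> * \<tau>"
      "gamma_kernel (p + 1 / 2) A \<tau> = gamma_kernel p A \<tau> * sqrt \<tau>"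
      using True 1 2 by (simp_all add: gamma_kernel_def)
    then show ?thesis unfolding sq by (simp add: algebra_simps)
  qed (simp add: gamma_kernel_def)
  have "has_bochner_integral lborel (\<lambda>\<tau>. gamma_kernel p A \<tau> * (sqrt \<tau> * r - \<sigma>)\<^sup>2)
     (Gamma (p + 1) / A powr (p + 1) * r\<^sup>2 - Gamma (p + 1 / 2) / A powr (p + 1 / 2) * (2 * \<sigma> * r) + Gamma p / A powr p * \<sigma>\<^sup>2)"
    unfolding eq
    by (intro has_bochner_integral_add has_bochner_integral_diff has_bochner_integral_mult_left has_bochner_integral_gamma_kernel)
       (use p A in auto)
  then have "(\<integral>\<^sup>+\<tau>. ennreal (gamma_kernel p A \<tau> * (sqrt \<tau> * r - \<sigma>)\<^sup>2) \<partial>lborel) =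
     ennreal (Gamma (p + 1) / A powr (p + 1) * r\<^sup>2 - Gamma (p + 1 / 2) / A powr (p + 1 / 2) * (2 * \<sigma> * r) + Gamma p / A powr p * \<sigma>\<^sup>2)"
    by (subst nn_integral_eq_integral) (auto simp: has_bochner_integral_iff)
  then show ?thesis by (simp add: mult_ac)
qed

text \<open>The constant \<open>c\<close> of the best equivariant scale estimator, for \<open>p = k / 2\<close>.\<close>
definition scale_factor :: "real \<Rightarrow> real" where
  "scale_factor p = Gamma (p + 1 / 2) / (sqrt 2 * Gamma (p + 1))"

lemma gamma_quadratic_min:
  assumes p: "p > 0" and S: "S > 0" and \<sigma>: "\<sigma> > 0"
  shows "(\<integral>\<^sup>+\<tau>. ennreal (gamma_kernel p (S / (2 * \<sigma>\<^sup>2)) \<tau> * (sqrt \<tau> * (scale_factor p * sqrt S) - \<sigma>)\<^sup>2) \<partial>lborel)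
     \<le> (\<integral>\<^sup>+\<tau>. ennreal (gamma_kernel p (S / (2 * \<sigma>\<^sup>2)) \<tau> * (sqrt \<tau> * r - \<sigma>)\<^sup>2) \<partial>lborel)"
proof -
  define A where "A = S / (2 * \<sigma>\<^sup>2)"
  have A: "A > 0" using S \<sigma> by (simp add: A_def)
  define a where "a = Gamma (p + 1) / A powr (p + 1)"
  define b where "b = \<sigma> * Gamma (p + 1 / 2) / A powr (p + 1 / 2)"
  have a: "a > 0" using p A by (simp add: a_def Gamma_real_pos)
  have "A powr (p + 1) = A powr (p + 1 / 2) * sqrt A"
  proof -
    have "A powr (p + 1 / 2) * A powr (1 / 2) = A powr (p + 1 / 2 + 1 / 2)" by (rule powr_add[symmetric])
    then show ?thesis using A by (simp add: powr_half_sqrt add.commute)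
  qed
  moreover have "Gamma (p + 1) > 0" using p by (intro Gamma_real_pos) simp
  ultimately have "b / a = \<sigma> * Gamma (p + 1 / 2) * sqrt A / Gamma (p + 1)"
    using A by (simp add: a_def b_def field_simps)
  also have "sqrt A = sqrt S / (sqrt 2 * \<sigma>)"
    using \<sigma> by (simp add: A_def real_sqrt_divide real_sqrt_mult)
  finally have ba: "scale_factor p * sqrt S = b / a"
    using \<sigma> by (simp add: scale_factor_def)
  have "a * (b / a)\<^sup>2 - 2 * b * (b / a) \<le> a * r\<^sup>2 - 2 * b * r"
  proof -
    have "0 \<le> a * (r - b / a)\<^sup>2" using a by simp
    also have "\<dots> = (a * r\<^sup>2 - 2 * b * r) - (a * (b / a)\<^sup>2 - 2 * b * (b / a))"
      using a by (simp add: power2_eq_square field_simps)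
    finally show ?thesis by simp
  qed
  then show ?thesis
    unfolding A_def[symmetric] nn_integral_gamma_quadratic[OF p A] a_def[symmetric] b_def[symmetric] ba
    by (intro ennreal_leI) simp
qed

lemma equivariant_sample_mean: "equivariant_mean (sample_mean :: (real ^ 'd) ^ 'n \<Rightarrow> _)"
  by (simp add: equivariant_mean_def sample_mean_loc_scale)

lemma equivariant_scale_rss: "equivariant_scale (\<lambda>x :: (real ^ 'd) ^ 'n. c * sqrt (rss x))"
  by (auto simp: equivariant_scale_def rss_loc_scale real_sqrt_mult)

text \<open>
  Along each orbit of residual dilations an equivariant estimator is determined by its value at
  one point, so after passing to polar coordinates it is enough to minimise a quadratic in that value.
\<close>
lemma scale_risk_minimal:
  fixes s :: "(real ^ 'd) ^ 'n \<Rightarrow> real"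
  assumes n: "CARD('n) \<ge> 2" and s: "equivariant_scale s" and \<sigma>: "\<sigma> > 0"
  defines "p \<equiv> real (CARD('d) * (CARD('n) - 1)) / 2"
  shows "scale_risk \<mu> \<sigma> (\<lambda>x :: (real ^ 'd) ^ 'n. scale_factor p * sqrt (rss x)) \<le> scale_risk \<mu> \<sigma> s"
proof -
  have p: "p > 0" using n by (simp add: p_def)
  define K where "K x = (1 / sqrt (2 * pi * \<sigma>\<^sup>2)) ^ (CARD('n) * CARD('d)) *
    exp (- (real CARD('n) * (norm (sample_mean x - \<mu>))\<^sup>2) / (2 * \<sigma>\<^sup>2))" for x :: "(real ^ 'd) ^ 'n"
  have K: "K x \<ge> 0" for x by (simp add: K_def)
  have polar: "scale_risk \<mu> \<sigma> u = (\<integral>\<^sup>+x. ennreal (indicator {1..} (rss x) / rss x) * (ennreal (K x) *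
       (\<integral>\<^sup>+\<tau>. ennreal (gamma_kernel p (rss x / (2 * \<sigma>\<^sup>2)) \<tau> * (sqrt \<tau> * u x - \<sigma>)\<^sup>2) \<partial>lborel)) \<partial>lborel)"
    if u: "equivariant_scale u" for u :: "(real ^ 'd) ^ 'n \<Rightarrow> real"
  proof -
    have [measurable]: "u \<in> borel_measurable borel" using u by (simp add: equivariant_scale_def)
    have ut: "u (dilate_residuals (sqrt \<tau>) x) = sqrt \<tau> * u x" if "\<tau> > 0" for \<tau> x
      unfolding dilate_residuals_loc_scale using u that by (simp add: equivariant_scale_def)
    have "scale_risk \<mu> \<sigma> u = (\<integral>\<^sup>+x. ennreal (indicator {1..} (rss x) / rss x) *
       (\<integral>\<^sup>+\<tau>. ennreal (indicator {0<..} \<tau> * \<tau> powr (p - 1)) * (ennreal ((u (dilate_residuals (sqrt \<tau>) x) - \<sigma>)\<^sup>2) *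
          ennreal (sample_density \<mu> \<sigma> (dilate_residuals (sqrt \<tau>) x))) \<partial>lborel) \<partial>lborel)"
      unfolding scale_risk_def p_def by (rule nn_integral_residual_polar) (use n in auto)
    also have "\<dots> = (\<integral>\<^sup>+x. ennreal (indicator {1..} (rss x) / rss x) * 
       (\<integral>\<^sup>+\<tau>. ennreal (K x) * ennreal (gamma_kernel p (rss x / (2 * \<sigma>\<^sup>2)) \<tau> * (sqrt \<tau> * u x - \<sigma>)\<^sup>2) \<partial>lborel) \<partial>lborel)"
    proof (rule nn_integral_cong, rule arg_cong2[where f = "(*)"], rule refl, rule nn_integral_cong)
      fix x :: "(real ^ 'd) ^ 'n" and \<tau> :: real
      show "ennreal (indicator {0<..} \<tau> * \<tau> powr (p - 1)) * (ennreal ((u (dilate_residuals (sqrt \<tau>) x) - \<sigma>)\<^sup>2) *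
          ennreal (sample_density \<mu> \<sigma> (dilate_residuals (sqrt \<tau>) x))) =
         ennreal (K x) * ennreal (gamma_kernel p (rss x / (2 * \<sigma>\<^sup>2)) \<tau> * (sqrt \<tau> * u x - \<sigma>)\<^sup>2)"
      proof (cases "\<tau> > 0")
        case True
        have "sample_density \<mu> \<sigma> (dilate_residuals (sqrt \<tau>) x) = K x * exp (- (rss x / (2 * \<sigma>\<^sup>2) * \<tau>))"
          using True by (simp add: sample_density_mean_rss K_def exp_add[symmetric] mult.assoc add_divide_distrib diff_divide_distrib)
        then show ?thesis
          using True K[of x] by (simp add: ut gamma_kernel_def ennreal_mult[symmetric] mult_ac)
      qed (simp add: gamma_kernel_def)
    qed
    also have "\<dots> = (\<integral>\<^sup>+x. ennreal (indicator {1..} (rss x) / rss x) * (ennreal (K x) *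
       (\<integral>\<^sup>+\<tau>. ennreal (gamma_kernel p (rss x / (2 * \<sigma>\<^sup>2)) \<tau> * (sqrt \<tau> * u x - \<sigma>)\<^sup>2) \<partial>lborel)) \<partial>lborel)"
      by (intro nn_integral_cong arg_cong2[where f = "(*)"] refl nn_integral_cmult) measurable
    finally show ?thesis .
  qed
  show ?thesis
    unfolding polar[OF s] polar[OF equivariant_scale_rss]
  proof (rule nn_integral_mono)
    fix x :: "(real ^ 'd) ^ 'n"
    show "ennreal (indicator {1..} (rss x) / rss x) * (ennreal (K x) *
       (\<integral>\<^sup>+\<tau>. ennreal (gamma_kernel p (rss x / (2 * \<sigma>\<^sup>2)) \<tau> * (sqrt \<tau> * (scale_factor p * sqrt (rss x)) - \<sigma>)\<^sup>2) \<partial>lborel))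
      \<le> ennreal (indicator {1..} (rss x) / rss x) * (ennreal (K x) *
       (\<integral>\<^sup>+\<tau>. ennreal (gamma_kernel p (rss x / (2 * \<sigma>\<^sup>2)) \<tau> * (sqrt \<tau> * s x - \<sigma>)\<^sup>2) \<partial>lborel))"
    proof (cases "rss x > 0")
      case True
      then show ?thesis using p \<sigma> by (intro mult_left_mono gamma_quadratic_min) auto
    qed simp
  qed
qed

lemma nn_integral_reflect_mean:
  fixes g :: "(real ^ 'd) ^ 'n \<Rightarrow> ennreal"
  assumes [measurable]: "g \<in> borel_measurable borel"
  shows "(\<integral>\<^sup>+x. g (loc_scale 1 (- 2 *\<^sub>R (sample_mean x - \<mu>)) x) \<partial>lborel) = (\<integral>\<^sup>+x. g x \<partial>lborel)"
proof -
  let ?m = "(\<chi> i. \<mu>) :: (real ^ 'd) ^ 'n"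
  have "loc_scale 1 (- 2 *\<^sub>R (sample_mean x - \<mu>)) x = dilate_mean (- 1) (x + - ?m) + ?m" for x
  proof -
    have "sample_mean (x + - ?m) = sample_mean x - \<mu>"
    proof -
      have "x + - ?m = (\<chi> i. x $ i + - \<mu>)" by (simp add: vec_eq_iff)
      then show ?thesis by (simp only: sample_mean_shift) simp
    qed
    then show ?thesis by (simp add: loc_scale_def dilate_mean_def vec_eq_iff)
  qed
  then have "(\<integral>\<^sup>+x. g (loc_scale 1 (- 2 *\<^sub>R (sample_mean x - \<mu>)) x) \<partial>lborel) =
      (\<integral>\<^sup>+x. g (dilate_mean (- 1) (x + - ?m) + ?m) \<partial>lborel)" by simp
  also have "\<dots> = (\<integral>\<^sup>+x. g (dilate_mean (- 1) x + ?m) \<partial>lborel)"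
    by (rule nn_integral_lborel_translate) measurable
  also have "\<dots> = (\<integral>\<^sup>+x. g (x + ?m) \<partial>lborel)"
    using nn_integral_dilate_mean[of "\<lambda>x. g (x + ?m)" "- 1"] by simp
  also have "\<dots> = (\<integral>\<^sup>+x. g x \<partial>lborel)"
    by (rule nn_integral_lborel_translate) measurable
  finally show ?thesis .
qed

text \<open>
  Write \<open>m x - \<mu> = v + u\<close> with \<open>u = sample_mean x - \<mu>\<close>. Reflecting the sample mean about \<open>\<mu>\<close> keeps the density
  and \<open>v\<close> and changes the sign of \<open>u\<close>. By the parallelogram law the average of the two losses is
  \<open>|u|\<^sup>2 + |v|\<^sup>2\<close>.
\<close>
lemma mean_risk_minimal:
  fixes m :: "(real ^ 'd) ^ 'n \<Rightarrow> real ^ 'd"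
  assumes m: "equivariant_mean m"
  shows "mean_risk \<mu> \<sigma> (sample_mean :: (real ^ 'd) ^ 'n \<Rightarrow> _) \<le> mean_risk \<mu> \<sigma> m"
proof -
  have [measurable]: "m \<in> borel_measurable borel" using m by (simp add: equivariant_mean_def)
  define F where "F x = ennreal ((norm (m x - \<mu>))\<^sup>2) * ennreal (sample_density \<mu> \<sigma> x)" for x
  have [measurable]: "F \<in> borel_measurable borel" unfolding F_def by measurable
  define R where "R x = loc_scale 1 (- 2 *\<^sub>R (sample_mean x - \<mu>)) x" for x :: "(real ^ 'd) ^ 'n"
  have [measurable]: "R \<in> borel_measurable borel"
    unfolding R_def loc_scale_def sample_mean_def
    by (intro borel_measurable_continuous_onI continuous_intros)
  have "2 * mean_risk \<mu> \<sigma> (sample_mean :: (real ^ 'd) ^ 'n \<Rightarrow> _) =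
     (\<integral>\<^sup>+x. 2 * (ennreal ((norm (sample_mean x - \<mu>))\<^sup>2) * ennreal (sample_density \<mu> \<sigma> (x :: (real ^ 'd) ^ 'n))) \<partial>lborel)"
    unfolding mean_risk_def by (rule nn_integral_cmult[symmetric]) measurable
  also have "\<dots> \<le> (\<integral>\<^sup>+x. F x + F (R x) \<partial>lborel)"
  proof (rule nn_integral_mono)
    fix x :: "(real ^ 'd) ^ 'n"
    define u where "u = sample_mean x - \<mu>"
    define v where "v = m x - sample_mean x"
    have mR: "m (R x) = m x - 2 *\<^sub>R u"
      using m unfolding R_def u_def equivariant_mean_def by simp
    have "sample_mean (R x) - \<mu> = - u"
      unfolding R_def sample_mean_loc_scale u_def by (simp add: algebra_simps scaleR_2)
    then have "norm (sample_mean (R x) - \<mu>) = norm (sample_mean x - \<mu>)"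
      by (simp only: norm_minus_cancel u_def)
    moreover have "rss (R x) = rss x" by (simp add: R_def rss_loc_scale)
    ultimately have dR: "sample_density \<mu> \<sigma> (R x) = sample_density \<mu> \<sigma> x"
      by (simp only: sample_density_mean_rss)
    have "(norm (v + u))\<^sup>2 + (norm (v - u))\<^sup>2 = 2 * (norm v)\<^sup>2 + 2 * (norm u)\<^sup>2"
      unfolding power2_norm_eq_inner by (simp add: inner_add_left inner_add_right inner_diff_left inner_diff_right inner_commute)
    moreover have "m x - \<mu> = v + u" "m (R x) - \<mu> = v - u"
      unfolding mR by (simp_all add: u_def v_def scaleR_2)
    ultimately have "2 * (norm u)\<^sup>2 \<le> (norm (m x - \<mu>))\<^sup>2 + (norm (m (R x) - \<mu>))\<^sup>2" by simp
    then have "2 * (norm u)\<^sup>2 * sample_density \<mu> \<sigma> x \<le> ((norm (m x - \<mu>))\<^sup>2 + (norm (m (R x) - \<mu>))\<^sup>2) * sample_density \<mu> \<sigma> x"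
      by (rule mult_right_mono) simp
    then have "ennreal (2 * ((norm u)\<^sup>2 * sample_density \<mu> \<sigma> x)) \<le>
        ennreal ((norm (m x - \<mu>))\<^sup>2 * sample_density \<mu> \<sigma> x + (norm (m (R x) - \<mu>))\<^sup>2 * sample_density \<mu> \<sigma> x)"
      by (intro ennreal_leI) (simp add: algebra_simps)
    then show "2 * (ennreal ((norm (sample_mean x - \<mu>))\<^sup>2) * ennreal (sample_density \<mu> \<sigma> x)) \<le> F x + F (R x)"
      unfolding F_def dR u_def by (simp add: ennreal_mult)
  qed
  also have "\<dots> = (\<integral>\<^sup>+x. F x \<partial>lborel) + (\<integral>\<^sup>+x. F (R x) \<partial>lborel)"
    by (rule nn_integral_add) measurable
  also have "(\<integral>\<^sup>+x. F (R x) \<partial>lborel) = (\<integral>\<^sup>+x. F x \<partial>lborel)"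
    unfolding R_def by (rule nn_integral_reflect_mean) measurable
  also have "(\<integral>\<^sup>+x. F x \<partial>lborel) + (\<integral>\<^sup>+x. F x \<partial>lborel) = 2 * mean_risk \<mu> \<sigma> m"
    unfolding F_def mean_risk_def by (simp add: mult_2)
  finally show ?thesis
    by (subst (asm) ennreal_mult_le_mult_iff) auto
qed

section \<open>The posterior law of the shrinkage variable\<close>

text \<open>
  Expectations of increasing functions increase in likelihood ratio order: integrate
  \<open>(f u - f v) (\<omega>2 u \<omega>1 v - \<omega>2 v \<omega>1 u) \<ge> 0\<close> over \<open>u\<close> and \<open>v\<close>.
\<close>
lemma chebyshev_likelihood_ratio:
  fixes f \<omega>1 \<omega>2 :: "real \<Rightarrow> real"
  assumes int: "integrable M \<omega>1" "integrable M \<omega>2" "integrable M (\<lambda>u. f u * \<omega>1 u)" "integrable M (\<lambda>u. f u * \<omega>2 u)"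
    and mlr: "\<And>u v. v \<le> u \<Longrightarrow> \<omega>2 v * \<omega>1 u \<le> \<omega>2 u * \<omega>1 v"
    and f: "\<And>u v. v \<le> u \<Longrightarrow> \<omega>2 u * \<omega>1 v \<noteq> 0 \<or> \<omega>2 v * \<omega>1 u \<noteq> 0 \<Longrightarrow> f v \<le> f u"
  shows "(\<integral>u. f u * \<omega>1 u \<partial>M) * (\<integral>u. \<omega>2 u \<partial>M) \<le> (\<integral>u. f u * \<omega>2 u \<partial>M) * (\<integral>u. \<omega>1 u \<partial>M)"
proof -
  define A1 where "A1 = (\<integral>u. \<omega>1 u \<partial>M)"
  define A2 where "A2 = (\<integral>u. \<omega>2 u \<partial>M)"
  define B1 where "B1 = (\<integral>u. f u * \<omega>1 u \<partial>M)"
  define B2 where "B2 = (\<integral>u. f u * \<omega>2 u \<partial>M)"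
  note hb = int[THEN has_bochner_integral_integrable, folded A1_def A2_def B1_def B2_def]
  have nonneg: "0 \<le> (f u - f v) * (\<omega>2 u * \<omega>1 v - \<omega>2 v * \<omega>1 u)" for u v
  proof (cases "\<omega>2 u * \<omega>1 v \<noteq> 0 \<or> \<omega>2 v * \<omega>1 u \<noteq> 0")
    case True
    show ?thesis
    proof (cases "v \<le> u")
      case le: True
      then show ?thesis using f[OF le] mlr[OF le] True by (intro mult_nonneg_nonneg) auto
    next
      case False
      then have le: "u \<le> v" by simp
      then show ?thesis using f[OF le] mlr[OF le] True by (intro mult_nonpos_nonpos) auto
    qed
  qed auto
  have inner: "0 \<le> (f u * \<omega>2 u) * A1 - (f u * \<omega>1 u) * A2 - \<omega>2 u * B1 + \<omega>1 u * B2" for u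
  proof -
    have "has_bochner_integral M (\<lambda>v. (f u * \<omega>2 u) * \<omega>1 v - (f u * \<omega>1 u) * \<omega>2 v - \<omega>2 u * (f v * \<omega>1 v) + \<omega>1 u * (f v * \<omega>2 v))
      ((f u * \<omega>2 u) * A1 - (f u * \<omega>1 u) * A2 - \<omega>2 u * B1 + \<omega>1 u * B2)"
      by (intro has_bochner_integral_add has_bochner_integral_diff has_bochner_integral_mult_right hb)
    moreover have "(\<lambda>v. (f u * \<omega>2 u) * \<omega>1 v - (f u * \<omega>1 u) * \<omega>2 v - \<omega>2 u * (f v * \<omega>1 v) + \<omega>1 u * (f v * \<omega>2 v)) =
      (\<lambda>v. (f u - f v) * (\<omega>2 u * \<omega>1 v - \<omega>2 v * \<omega>1 u))"
      by (simp add: fun_eq_iff algebra_simps)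
    ultimately have "(f u * \<omega>2 u) * A1 - (f u * \<omega>1 u) * A2 - \<omega>2 u * B1 + \<omega>1 u * B2 =
      (\<integral>v. (f u - f v) * (\<omega>2 u * \<omega>1 v - \<omega>2 v * \<omega>1 u) \<partial>M)"
      by (simp add: has_bochner_integral_integral_eq)
    then show ?thesis using nonneg by simp
  qed
  have "has_bochner_integral M (\<lambda>u. (f u * \<omega>2 u) * A1 - (f u * \<omega>1 u) * A2 - \<omega>2 u * B1 + \<omega>1 u * B2)
     (B2 * A1 - B1 * A2 - A2 * B1 + A1 * B2)"
    by (intro has_bochner_integral_add has_bochner_integral_diff has_bochner_integral_mult_left hb)
  then have "B2 * A1 - B1 * A2 - A2 * B1 + A1 * B2 = (\<integral>u. (f u * \<omega>2 u) * A1 - (f u * \<omega>1 u) * A2 - \<omega>2 u * B1 + \<omega>1 u * B2 \<partial>M)"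
    by (simp add: has_bochner_integral_integral_eq)
  also have "\<dots> \<ge> 0" using inner by simp
  finally show ?thesis by (simp add: A1_def A2_def B1_def B2_def mult.commute)
qed

definition beta_prime_kernel :: "real \<Rightarrow> real \<Rightarrow> real \<Rightarrow> real" where
  "beta_prime_kernel a q u = indicator {0<..} u * (u powr (a - 1) * (1 + u) powr (- q))"

lemma beta_prime_kernel_nonneg [simp]: "0 \<le> beta_prime_kernel a q u"
  by (simp add: beta_prime_kernel_def)

lemma beta_prime_kernel_measurable [measurable]: "beta_prime_kernel a q \<in> borel_measurable borel"
  unfolding beta_prime_kernel_def by measurable

text \<open>Write \<open>(1 + u)\<^bsup>- q\<^esup>\<close> as a gamma integral and exchange the order of integration.\<close>
lemma has_bochner_integral_beta_prime_kernel:
  assumes a: "a > 0" and q: "q > a"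
  shows "has_bochner_integral lborel (beta_prime_kernel a q) (Gamma a * Gamma (q - a) / Gamma q)"
proof (rule has_bochner_integral_nn_integral)
  have q0: "q > 0" using a q by simp
  have G: "Gamma q > 0" "Gamma a > 0" "Gamma (q - a) > 0" using a q by (auto intro!: Gamma_real_pos)
  let ?I = "\<integral>\<^sup>+u. ennreal (beta_prime_kernel a q u) \<partial>lborel"
  have "ennreal (Gamma q) * ?I = (\<integral>\<^sup>+u. ennreal (Gamma q) * ennreal (beta_prime_kernel a q u) \<partial>lborel)"
    by (rule nn_integral_cmult[symmetric]) measurable
  also have "\<dots> = (\<integral>\<^sup>+u. \<integral>\<^sup>+t. ennreal (indicator {0<..} u * u powr (a - 1)) * ennreal (gamma_kernel q (1 + u) t) \<partial>lborel \<partial>lborel)"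
  proof (rule nn_integral_cong)
    fix u :: real
    show "ennreal (Gamma q) * ennreal (beta_prime_kernel a q u) =
       (\<integral>\<^sup>+t. ennreal (indicator {0<..} u * u powr (a - 1)) * ennreal (gamma_kernel q (1 + u) t) \<partial>lborel)"
    proof (cases "u > 0")
      case True
      have "(\<integral>\<^sup>+t. ennreal (indicator {0<..} u * u powr (a - 1)) * ennreal (gamma_kernel q (1 + u) t) \<partial>lborel) =
         ennreal (indicator {0<..} u * u powr (a - 1)) * ennreal (Gamma q / (1 + u) powr q)"
        using True q0 by (subst nn_integral_cmult) (simp_all add: nn_integral_gamma_kernel)
      then show ?thesis
        using True G by (simp add: beta_prime_kernel_def ennreal_mult[symmetric] powr_minus field_simps)
    qed (simp add: beta_prime_kernel_def)
  qed
  also have "\<dots> = (\<integral>\<^sup>+t. \<integral>\<^sup>+u. ennreal (indicator {0<..} u * u powr (a - 1)) * ennreal (gamma_kernel q (1 + u) t) \<partial>lborel \<partial>lborel)"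
    unfolding gamma_kernel_def by (rule lborel_pair.Fubini') measurable
  also have "\<dots> = (\<integral>\<^sup>+t. \<integral>\<^sup>+u. ennreal (indicator {0<..} t * (t powr (q - 1) * exp (- t))) * ennreal (gamma_kernel a t u) \<partial>lborel \<partial>lborel)"
    by (intro nn_integral_cong)
      (auto simp: gamma_kernel_def indicator_def ennreal_mult[symmetric] exp_add[symmetric] algebra_simps)
  also have "\<dots> = (\<integral>\<^sup>+t. ennreal (Gamma a) * ennreal (gamma_kernel (q - a) 1 t) \<partial>lborel)"
  proof (rule nn_integral_cong)
    fix t :: real
    show "(\<integral>\<^sup>+u. ennreal (indicator {0<..} t * (t powr (q - 1) * exp (- t))) * ennreal (gamma_kernel a t u) \<partial>lborel) =
      ennreal (Gamma a) * ennreal (gamma_kernel (q - a) 1 t)"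
    proof (cases "t > 0")
      case True
      have "(\<integral>\<^sup>+u. ennreal (indicator {0<..} t * (t powr (q - 1) * exp (- t))) * ennreal (gamma_kernel a t u) \<partial>lborel) =
        ennreal (indicator {0<..} t * (t powr (q - 1) * exp (- t))) * ennreal (Gamma a / t powr a)"
        using True a by (subst nn_integral_cmult) (simp_all add: nn_integral_gamma_kernel)
      moreover have "t powr (q - 1) / t powr a = t powr (q - a - 1)"
        using True by (simp add: powr_diff[symmetric] algebra_simps)
      ultimately show ?thesis
        using True G by (simp add: gamma_kernel_def ennreal_mult[symmetric] field_simps)
    qed (simp add: gamma_kernel_def)
  qed
  also have "\<dots> = ennreal (Gamma a * Gamma (q - a))"
    using q G by (subst nn_integral_cmult) (simp_all add: nn_integral_gamma_kernel ennreal_mult)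
  finally have *: "ennreal (Gamma q) * ?I = ennreal (Gamma a * Gamma (q - a))" .
  have "?I = ennreal (1 / Gamma q) * (ennreal (Gamma q) * ?I)"
    using G by (simp add: mult.assoc[symmetric] ennreal_mult[symmetric])
  also have "\<dots> = ennreal (Gamma a * Gamma (q - a) / Gamma q)"
    unfolding * using G by (simp add: ennreal_mult[symmetric])
  finally show "?I = ennreal (Gamma a * Gamma (q - a) / Gamma q)" .
  show "0 \<le> Gamma a * Gamma (q - a) / Gamma q" using G by simp
qed auto

text \<open>
  The application has \<open>a = d / 2\<close> and \<open>m = n - 1\<close>, so that \<open>b = n d / 2\<close> and \<open>a m = k / 2\<close>.
\<close>
locale shrinkage_posterior =
  fixes a m :: real
  assumes a: "a > 0" and m: "m > 0"
begin

abbreviation "b \<equiv> a * (m + 1)"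

text \<open>
  In terms of \<open>\<kappa> = u / W\<close> this is the factor \<open>1 / (1 + m \<kappa>)\<close> on \<open>0 < \<kappa> < 1\<close> that the prior \<open>1 / lam\<close> acquires
  when it is expressed through \<open>\<kappa>\<close>.
\<close>
definition tilt :: "real \<Rightarrow> real \<Rightarrow> real" where
  "tilt W u = indicator {0<..<W} u / (1 + m * u / W)"

definition weight :: "real \<Rightarrow> real \<Rightarrow> real" where
  "weight W u = beta_prime_kernel a (b + 1) u * tilt W u"

definition post :: "real \<Rightarrow> (real \<Rightarrow> real) \<Rightarrow> real" where
  "post W f = (\<integral>u. f u * weight W u \<partial>lborel) / (\<integral>u. weight W u \<partial>lborel)"

lemma weight_measurable2 [measurable]: "(\<lambda>(W, u). weight W u) \<in> borel_measurable (borel \<Otimes>\<^sub>M borel)"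
proof -
  have "(\<lambda>(W, u). weight W u) = (\<lambda>z. beta_prime_kernel a (b + 1) (snd z) * ((if 0 < snd z \<and> snd z < fst z then 1 else 0) / (1 + m * snd z / fst z)))"
    by (auto simp: weight_def tilt_def fun_eq_iff indicator_def)
  then show ?thesis by simp
qed

lemma weight_measurable [measurable]: "weight W \<in> borel_measurable borel"
  unfolding weight_def tilt_def by measurable

lemma post_measurable [measurable]:
  assumes [measurable]: "f \<in> borel_measurable borel"
  shows "(\<lambda>W. post W f) \<in> borel_measurable borel"
  unfolding post_def by measurable

lemma tilt_nonneg [simp]: "0 \<le> tilt W u"
  using m by (auto simp: tilt_def indicator_def)

lemma weight_nonneg [simp]: "0 \<le> weight W u"
  by (simp add: weight_def)

lemma weight_eq_0: "u \<le> 0 \<or> W \<le> u \<Longrightarrow> weight W u = 0"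
  by (auto simp: weight_def tilt_def)

lemma weight_le: "weight W u \<le> beta_prime_kernel a (b + 1) u"
proof -
  have "tilt W u \<le> 1" using m by (auto simp: tilt_def indicator_def divide_simps)
  then show ?thesis unfolding weight_def by (simp add: mult_left_le)
qed

lemma b_gt_a: "a < b"
  using a m by (simp add: algebra_simps)

lemma kernel_times: "(1 + u) * beta_prime_kernel a (b + 1) u = beta_prime_kernel a b u"
proof (cases "u > 0")
  case True
  have "(1 + u) * (1 + u) powr (- (b + 1)) = (1 + u) powr (1 + - (b + 1))"
    using True by (intro powr_mult_base) simp
  also have "1 + - (b + 1) = - b" by simp
  finally have 1: "(1 + u) * (1 + u) powr (- (b + 1)) = (1 + u) powr (- b)" .
  have "(1 + u) * beta_prime_kernel a (b + 1) u = u powr (a - 1) * ((1 + u) * (1 + u) powr (- (b + 1)))"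
    using True unfolding beta_prime_kernel_def by simp
  then show ?thesis unfolding 1 using True by (simp add: beta_prime_kernel_def)
qed (simp add: beta_prime_kernel_def)

lemma integrable_kernel: 
  assumes [measurable]: "f \<in> borel_measurable borel" and f: "\<And>u. u > 0 \<Longrightarrow> \<bar>f u\<bar> \<le> C * (1 + u)"
  shows "integrable lborel (\<lambda>u. f u * beta_prime_kernel a (b + 1) u)"
proof (rule Bochner_Integration.integrable_bound)
  show "integrable lborel (\<lambda>u. C * beta_prime_kernel a b u)"
    using has_bochner_integral_beta_prime_kernel[OF a b_gt_a] by (simp add: has_bochner_integral_iff)
  show "AE u in lborel. norm (f u * beta_prime_kernel a (b + 1) u) \<le> norm (C * beta_prime_kernel a b u)"
  proof (rule AE_I2)
    fix u :: real
    show "norm (f u * beta_prime_kernel a (b + 1) u) \<le> norm (C * beta_prime_kernel a b u)"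
    proof (cases "u > 0")
      case True
      have "norm (f u * beta_prime_kernel a (b + 1) u) \<le> (C * (1 + u)) * beta_prime_kernel a (b + 1) u"
        using f[OF True] by (simp add: abs_mult mult_right_mono)
      also have "\<dots> = C * beta_prime_kernel a b u" by (simp only: kernel_times mult.assoc)
      finally show ?thesis by simp
    qed (simp add: beta_prime_kernel_def)
  qed
qed measurable

lemma integrable_weight: 
  assumes [measurable]: "f \<in> borel_measurable borel" and f: "\<And>u. u > 0 \<Longrightarrow> \<bar>f u\<bar> \<le> C * (1 + u)"
  shows "integrable lborel (\<lambda>u. f u * weight W u)"
proof (rule Bochner_Integration.integrable_bound)
  show "integrable lborel (\<lambda>u. f u * beta_prime_kernel a (b + 1) u)"
    by (rule integrable_kernel) (use f in auto)
  show "AE u in lborel. norm (f u * weight W u) \<le> norm (f u * beta_prime_kernel a (b + 1) u)"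
    by (auto simp: abs_mult intro!: mult_left_mono weight_le)
qed measurable

lemma integrable_weight' [simp]: "integrable lborel (weight W)"
  using integrable_weight[of "\<lambda>_. 1" 1 W] by simp

lemma weight_pos: "0 < u \<Longrightarrow> u < W \<Longrightarrow> 0 < weight W u"
  using m by (auto simp: weight_def tilt_def beta_prime_kernel_def intro!: divide_pos_pos add_pos_pos)

lemma integral_weight_pos:
  assumes W: "W > 0" and int: "integrable lborel (\<lambda>u. f u * weight W u)"
    and f: "\<And>u. 0 < u \<Longrightarrow> 0 < f u"
  shows "0 < (\<integral>u. f u * weight W u \<partial>lborel)"
proof -
  have nn: "0 \<le> f u * weight W u" for u
    using f[of u] by (cases "u > 0") (simp_all add: weight_eq_0)
  have "(\<integral>u. f u * weight W u \<partial>lborel) \<noteq> 0"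
  proof
    assume "(\<integral>u. f u * weight W u \<partial>lborel) = 0"
    then have "AE u in lborel. f u * weight W u = 0"
      using integral_nonneg_eq_0_iff_AE[OF int] nn by simp
    then have "AE u in lborel. u \<notin> {0<..<W}"
    proof (rule AE_mp, intro AE_I2 impI notI)
      fix u assume *: "f u * weight W u = 0" "u \<in> {0<..<W}"
      then show False using f[of u] weight_pos[of u W] by simp
    qed
    then have "{0<..<W} \<in> null_sets lborel" by (subst AE_iff_null_sets) auto
    then show False using W by (simp add: null_sets_def)
  qed
  moreover have "0 \<le> (\<integral>u. f u * weight W u \<partial>lborel)" using nn by simp
  ultimately show ?thesis by simp
qed

lemma integral_weight_pos': "W > 0 \<Longrightarrow> 0 < (\<integral>u. weight W u \<partial>lborel)"
  using integral_weight_pos[of W "\<lambda>_. 1"] by simp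

lemma sqrt_le_linear: "u > 0 \<Longrightarrow> \<bar>sqrt (1 + u)\<bar> \<le> 1 * (1 + u)"
  by (auto intro!: real_le_lsqrt simp: power2_eq_square algebra_simps)

text \<open>
  The kernel does not depend on \<open>W\<close>, and the ratio of two tilts increases in \<open>u\<close>.
\<close>
lemma post_mono:
  assumes W: "0 < V1" "V1 \<le> V2" and [measurable]: "f \<in> borel_measurable borel"
    and C: "\<And>u. u > 0 \<Longrightarrow> \<bar>f u\<bar> \<le> C * (1 + u)" and f: "\<And>u v. 0 < v \<Longrightarrow> v \<le> u \<Longrightarrow> f v \<le> f u"
  shows "post V1 f \<le> post V2 f"
proof -
  have "(\<integral>u. f u * weight V1 u \<partial>lborel) * (\<integral>u. weight V2 u \<partial>lborel) \<le>
        (\<integral>u. f u * weight V2 u \<partial>lborel) * (\<integral>u. weight V1 u \<partial>lborel)"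
  proof (rule chebyshev_likelihood_ratio)
    show "integrable lborel (\<lambda>u. f u * weight V1 u)" "integrable lborel (\<lambda>u. f u * weight V2 u)"
      by (rule integrable_weight; use C in auto)+
  next
    fix u v :: real assume uv: "v \<le> u"
    have "tilt V2 v * tilt V1 u \<le> tilt V2 u * tilt V1 v"
    proof (cases "0 < v \<and> u < V1")
      case True
      then have *: "0 < v" "v < V1" "0 < u" "u < V1" "u < V2" "v < V2" using uv W by auto
      have "m * (u - v) / V2 \<le> m * (u - v) / V1"
        using W m uv by (intro divide_left_mono) auto
      moreover have "(1 + m * u / V2) * (1 + m * v / V1) - (1 + m * v / V2) * (1 + m * u / V1) =
          m * (u - v) / V2 - m * (u - v) / V1"
        using W by (simp add: field_simps)
      ultimately have "(1 + m * u / V2) * (1 + m * v / V1) \<le> (1 + m * v / V2) * (1 + m * u / V1)"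
        by linarith
      moreover have "0 < 1 + m * u / V2" "0 < 1 + m * v / V1" "0 < 1 + m * v / V2" "0 < 1 + m * u / V1"
        using * W m by (auto intro!: add_pos_pos)
      ultimately have "1 / ((1 + m * v / V2) * (1 + m * u / V1)) \<le> 1 / ((1 + m * u / V2) * (1 + m * v / V1))"
        by (intro divide_left_mono mult_pos_pos) auto
      then show ?thesis
        using * by (simp add: tilt_def)
    next
      case False
      then have 0: "tilt V2 v * tilt V1 u = 0" by (auto simp: tilt_def)
      show ?thesis unfolding 0 by simp
    qed
    then have "beta_prime_kernel a (b + 1) v * beta_prime_kernel a (b + 1) u * (tilt V2 v * tilt V1 u) \<le>
      beta_prime_kernel a (b + 1) v * beta_prime_kernel a (b + 1) u * (tilt V2 u * tilt V1 v)"
      by (rule mult_left_mono) simp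
    then show "weight V2 v * weight V1 u \<le> weight V2 u * weight V1 v"
      by (simp add: weight_def mult_ac)
    assume "weight V2 u * weight V1 v \<noteq> 0 \<or> weight V2 v * weight V1 u \<noteq> 0"
    then have "0 < v" using uv by (auto simp: weight_def tilt_def indicator_def split: if_splits)
    then show "f v \<le> f u" using f uv by simp
  qed auto
  then show ?thesis
    using W integral_weight_pos'[of V1] integral_weight_pos'[of V2]
    by (simp add: post_def divide_simps)
qed

text \<open>The untilted law, which is the limit of the posterior laws for large \<open>W\<close>.\<close>
definition limit_post :: "(real \<Rightarrow> real) \<Rightarrow> real" where
  "limit_post f = (\<integral>u. f u * beta_prime_kernel a (b + 1) u \<partial>lborel) / (\<integral>u. beta_prime_kernel a (b + 1) u \<partial>lborel)"

lemma has_bochner_integral_kernel: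
  "has_bochner_integral lborel (beta_prime_kernel a (b + 1)) (Gamma a * Gamma (a * m + 1) / Gamma (b + 1))"
proof -
  have "b + 1 - a = a * m + 1" by (simp add: algebra_simps)
  then show ?thesis
    using has_bochner_integral_beta_prime_kernel[OF a, of "b + 1"] b_gt_a by (simp only: less_add_one less_trans)
qed

lemma integral_kernel: "(\<integral>u. beta_prime_kernel a (b + 1) u \<partial>lborel) = Gamma a * Gamma (a * m + 1) / Gamma (b + 1)"
  by (rule has_bochner_integral_integral_eq[OF has_bochner_integral_kernel])

lemma integral_kernel_pos: "(\<integral>u. beta_prime_kernel a (b + 1) u \<partial>lborel) > 0"
  unfolding integral_kernel using a m by (intro divide_pos_pos mult_pos_pos Gamma_real_pos) (auto intro!: add_pos_pos)

lemma post_le_limit: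
  assumes W: "0 < W" and [measurable]: "f \<in> borel_measurable borel"
    and C: "\<And>u. u > 0 \<Longrightarrow> \<bar>f u\<bar> \<le> C * (1 + u)" and f: "\<And>u v. 0 < v \<Longrightarrow> v \<le> u \<Longrightarrow> f v \<le> f u"
  shows "post W f \<le> limit_post f"
proof -
  let ?k = "beta_prime_kernel a (b + 1)"
  have "(\<integral>u. f u * weight W u \<partial>lborel) * (\<integral>u. ?k u \<partial>lborel) \<le>
        (\<integral>u. f u * ?k u \<partial>lborel) * (\<integral>u. weight W u \<partial>lborel)"
  proof (rule chebyshev_likelihood_ratio)
    show "integrable lborel (\<lambda>u. f u * weight W u)"
      by (rule integrable_weight; use C in auto)
    show "integrable lborel (\<lambda>u. f u * ?k u)"
      by (rule integrable_kernel; use C in auto)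
    show "integrable lborel ?k"
      using integrable_kernel[of "\<lambda>_. 1" 1] by simp
  next
    fix u v :: real assume uv: "v \<le> u"
    show "?k v * weight W u \<le> ?k u * weight W v"
    proof (cases "0 < v \<and> u < W")
      case True
      have "1 / (1 + m * u / W) \<le> 1 / (1 + m * v / W)"
        using True uv W m by (intro divide_left_mono add_left_mono divide_right_mono mult_left_mono mult_pos_pos add_pos_pos) auto
      then have "tilt W u \<le> tilt W v" using True uv by (simp add: tilt_def)
      then have "?k v * ?k u * tilt W u \<le> ?k v * ?k u * tilt W v" by (rule mult_left_mono) simp
      then show ?thesis by (simp add: weight_def mult_ac)
    next
      case False
      then have 0: "?k v * weight W u = 0"
        by (auto simp: weight_def tilt_def beta_prime_kernel_def)
      show ?thesis unfolding 0 by simp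
    qed
    assume "?k u * weight W v \<noteq> 0 \<or> ?k v * weight W u \<noteq> 0"
    then have "0 < v" using uv by (auto simp: weight_def tilt_def beta_prime_kernel_def indicator_def split: if_splits)
    then show "f v \<le> f u" using f uv by simp
  qed auto
  then show ?thesis
    using W integral_weight_pos'[of W] integral_kernel_pos
    by (simp add: post_def limit_post_def divide_simps)
qed

lemma limit_post_id: "limit_post (\<lambda>u. u) = 1 / m"
proof -
  let ?k = "beta_prime_kernel a (b + 1)"
  have "has_bochner_integral lborel (beta_prime_kernel a b) (Gamma a * Gamma (a * m) / Gamma b)"
    using has_bochner_integral_beta_prime_kernel[OF a b_gt_a] by (simp add: algebra_simps)
  from has_bochner_integral_diff[OF this has_bochner_integral_kernel]
  moreover have "beta_prime_kernel a b u - ?k u = u * ?k u" for u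
    by (simp only: kernel_times[symmetric] distrib_right)
  ultimately have "has_bochner_integral lborel (\<lambda>u. u * ?k u) (Gamma a * Gamma (a * m) / Gamma b - Gamma a * Gamma (a * m + 1) / Gamma (b + 1))"
    by simp
  then have I: "(\<integral>u. u * ?k u \<partial>lborel) = Gamma a * Gamma (a * m) / Gamma b - Gamma a * Gamma (a * m + 1) / Gamma (b + 1)"
    by (rule has_bochner_integral_integral_eq)
  have am: "a * m > 0" "b > 0" using a m by auto
  have G: "Gamma a > 0" "Gamma (a * m) > 0" "Gamma b > 0" using a am by (auto intro!: Gamma_real_pos)
  have G1: "Gamma (a * m + 1) = a * m * Gamma (a * m)" "Gamma (b + 1) = b * Gamma b"
    using am by (auto intro!: Gamma_plus1)
  show ?thesis
  proof -
    have "(G * X / Y - G * (e * X) / (B * Y)) / (G * (e * X) / (B * Y)) = B / e - 1"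
      if "G > 0" "X > 0" "Y > 0" "B > 0" "e > 0" for G X Y B e :: real
      using that by (simp add: field_simps)
    from this[OF G am(2,1)] have "limit_post (\<lambda>u. u) = b / (a * m) - 1"
      unfolding limit_post_def I integral_kernel G1 .
    then show ?thesis using a m by (simp add: field_simps)
  qed
qed

lemma limit_post_sqrt: "limit_post (\<lambda>u. sqrt (1 + u)) = scale_factor (a * m) / scale_factor b"
proof -
  let ?k = "beta_prime_kernel a (b + 1)"
  have "(\<lambda>u. sqrt (1 + u) * ?k u) = beta_prime_kernel a (b + 1 / 2)"
  proof
    fix u :: real
    show "sqrt (1 + u) * ?k u = beta_prime_kernel a (b + 1 / 2) u"
    proof (cases "u > 0")
      case True
      have "sqrt (1 + u) * (1 + u) powr (- (b + 1)) = (1 + u) powr (1 / 2 + - (b + 1))"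
        unfolding powr_add using True by (simp add: powr_half_sqrt)
      also have "1 / 2 + - (b + 1) = - (b + 1 / 2)" by simp
      finally show ?thesis using True by (simp only: beta_prime_kernel_def mult.left_commute[of "sqrt _"])
    qed (simp add: beta_prime_kernel_def)
  qed
  note I = this
  have I: "(\<integral>u. sqrt (1 + u) * ?k u \<partial>lborel) = Gamma a * Gamma (a * m + 1 / 2) / Gamma (b + 1 / 2)"
  proof -
    have "b + 1 / 2 - a = a * m + 1 / 2" by (simp add: algebra_simps)
    moreover have "a < b + 1 / 2" using b_gt_a by simp
    ultimately show ?thesis
      using has_bochner_integral_beta_prime_kernel[OF a, of "b + 1 / 2"] I
      by (simp only: has_bochner_integral_iff)
  qed
  have am: "a * m > 0" "b > 0" using a m by auto
  have "Gamma a > 0" "Gamma (a * m + 1) > 0" "Gamma (b + 1) > 0" "Gamma (a * m + 1 / 2) > 0" "Gamma (b + 1 / 2) > 0"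
    using a am by (auto intro!: Gamma_real_pos add_pos_pos)
  then show ?thesis
    unfolding limit_post_def I integral_kernel scale_factor_def by (simp add: field_simps)
qed

lemma post_id_pos: "W > 0 \<Longrightarrow> 0 < post W (\<lambda>u. u)"
  unfolding post_def
  by (intro divide_pos_pos integral_weight_pos' integral_weight_pos integrable_weight[where C = 1]) auto

lemma post_id_le: "W > 0 \<Longrightarrow> post W (\<lambda>u. u) \<le> W"
proof -
  assume W: "W > 0"
  have "(\<integral>u. u * weight W u \<partial>lborel) \<le> (\<integral>u. W * weight W u \<partial>lborel)"
  proof (rule integral_mono)
    show "integrable lborel (\<lambda>u. u * weight W u)" by (rule integrable_weight[where C = 1]) auto
    show "u * weight W u \<le> W * weight W u" for u
      by (cases "u < W") (auto intro: mult_right_mono simp: weight_eq_0)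
  qed simp
  then show ?thesis using integral_weight_pos'[OF W] by (simp add: post_def divide_simps mult.commute)
qed

lemma post_id_le_limit: "W > 0 \<Longrightarrow> post W (\<lambda>u. u) \<le> 1 / m"
  unfolding limit_post_id[symmetric] by (rule post_le_limit[where C = 1]) auto

lemma post_sqrt_ge_1: "W > 0 \<Longrightarrow> 1 \<le> post W (\<lambda>u. sqrt (1 + u))"
proof -
  assume W: "W > 0"
  have "(\<integral>u. weight W u \<partial>lborel) \<le> (\<integral>u. sqrt (1 + u) * weight W u \<partial>lborel)"
  proof (rule integral_mono)
    show "integrable lborel (\<lambda>u. sqrt (1 + u) * weight W u)"
      by (rule integrable_weight[where C = 1]) (use sqrt_le_linear in auto)
    show "weight W u \<le> sqrt (1 + u) * weight W u" for u
      using mult_right_mono[of 1 "sqrt (1 + u)" "weight W u"] by (cases "u > 0") (auto simp: weight_eq_0)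
  qed simp
  then show ?thesis using integral_weight_pos'[OF W] by (simp add: post_def divide_simps)
qed

lemma post_sqrt_le_limit: "W > 0 \<Longrightarrow> post W (\<lambda>u. sqrt (1 + u)) \<le> scale_factor (a * m) / scale_factor b"
  unfolding limit_post_sqrt[symmetric] by (rule post_le_limit[where C = 1]) (use sqrt_le_linear in auto)

text \<open>
  The function \<open>u / 2 - sqrt (1 + u)\<close> is increasing, so its mean is largest in the limit.
\<close>
lemma post_sqrt_deficit:
  assumes W: "W > 0"
  shows "scale_factor (a * m) / scale_factor b - post W (\<lambda>u. sqrt (1 + u)) \<le> (1 / m - post W (\<lambda>u. u)) / 2"
proof -
  have int: "integrable lborel (\<lambda>u. u * weight W u)" "integrable lborel (\<lambda>u. sqrt (1 + u) * weight W u)"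
    "integrable lborel (\<lambda>u. u * beta_prime_kernel a (b + 1) u)"
    "integrable lborel (\<lambda>u. sqrt (1 + u) * beta_prime_kernel a (b + 1) u)"
    by (rule integrable_weight[where C = 1] integrable_kernel[where C = 1]; use sqrt_le_linear in auto)+
  have lin: "(u / 2 - sqrt (1 + u)) * w = (u * w) / 2 - sqrt (1 + u) * w" for u w :: real
    by (simp add: algebra_simps)
  have "post W (\<lambda>u. u / 2 - sqrt (1 + u)) \<le> limit_post (\<lambda>u. u / 2 - sqrt (1 + u))"
  proof (rule post_le_limit[where C = 2])
    show "\<bar>u / 2 - sqrt (1 + u)\<bar> \<le> 2 * (1 + u)" if "u > 0" for u
    proof -
      define r where "r = sqrt (1 + u)"
      have "0 \<le> r" "r \<le> 1 + u" using sqrt_le_linear[OF that] that by (simp_all add: r_def)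
      then have "u / 2 - r \<le> 2 * (1 + u)" "- (u / 2 - r) \<le> 2 * (1 + u)"
        using that by (simp_all add: field_simps)
      then show ?thesis by (simp only: abs_le_iff r_def)
    qed
    fix u v :: real assume uv: "0 < v" "v \<le> u"
    have "(sqrt (1 + u) - sqrt (1 + v)) * 2 \<le> (sqrt (1 + u) - sqrt (1 + v)) * (sqrt (1 + u) + sqrt (1 + v))"
    proof (intro mult_left_mono)
      have "1 \<le> sqrt (1 + u)" "1 \<le> sqrt (1 + v)" using uv by simp_all
      from add_mono[OF this] show "2 \<le> sqrt (1 + u) + sqrt (1 + v)" by (simp only: one_add_one)
      show "0 \<le> sqrt (1 + u) - sqrt (1 + v)" using uv by simp
    qed
    also have "\<dots> = u - v" using uv by (simp add: algebra_simps)
    finally show "v / 2 - sqrt (1 + v) \<le> u / 2 - sqrt (1 + u)" by simp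
  qed (use W in auto)
  moreover have "post W (\<lambda>u. u / 2 - sqrt (1 + u)) = post W (\<lambda>u. u) / 2 - post W (\<lambda>u. sqrt (1 + u))"
    unfolding post_def lin using int by (simp add: diff_divide_distrib)
  moreover have "limit_post (\<lambda>u. u / 2 - sqrt (1 + u)) = limit_post (\<lambda>u. u) / 2 - limit_post (\<lambda>u. sqrt (1 + u))"
    unfolding limit_post_def lin using int by (simp add: diff_divide_distrib)
  ultimately show ?thesis by (simp add: limit_post_id limit_post_sqrt)
qed

text \<open>
  Integrate the derivative of \<open>u\<^bsup>a\<^esup> (1 + u)\<^bsup>- b\<^esup> (1 - \<kappa>) / (1 + m \<kappa>)\<close>, \<open>\<kappa> = u / W\<close>, over \<open>0 \<le> u \<le> W\<close>. The factor \<open>1 - \<kappa>\<close>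
  makes the boundary term at \<open>W\<close> vanish, so with \<open>p = a m\<close> the posterior mean of
  \<open>(a - p u) (1 - \<kappa>) - \<kappa> (1 + u) (m + 1) / (1 + m \<kappa>)\<close> is zero. By the assumption on \<open>a\<close> and \<open>m\<close> this function
  is at least \<open>a - p u - p \<kappa>\<close>, whose mean is therefore nonpositive.
\<close>
lemma post_id_deficit:
  assumes W: "W > 0" and am: "a + m + 1 \<le> a * m"
  shows "1 / m - post W (\<lambda>u. u) \<le> post W (\<lambda>u. u) / W"
proof -
  define p where "p = a * m"
  define f where "f u = u powr a * (1 + u) powr (- b) * ((1 - u / W) / (1 + m * u / W))" for u
  define g where "g u = ((a - p * u) * (1 - u / W) - (u / W) * (1 + u) * ((m + 1) / (1 + m * u / W))) * weight W u" for u
  have pos: "1 + m * u / W > 0" if "u \<ge> 0" for u using that W m by (intro add_pos_nonneg) auto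
  have frac: "(m + 1) / (1 + m * u / W) \<le> m + 1" if "u \<ge> 0" for u
  proof -
    have "(m + 1) * 1 \<le> (m + 1) * (1 + m * u / W)"
      using that m W by (intro mult_left_mono) auto
    then show ?thesis using pos[OF that] by (simp add: pos_divide_le_eq)
  qed
  have deriv: "(f has_vector_derivative g u) (at u)" if u: "u \<in> {0<..<W}" for u
  proof -
    have u0: "u > 0" "u < W" using u by auto
    let ?c = "1 + m * u / W"
    have c: "?c > 0" using pos u0 by simp
    have "(f has_real_derivative
        (a * u powr (a - 1) * (1 + u) powr (- b) + u powr a * (- b * (1 + u) powr (- b - 1))) * ((1 - u / W) / ?c)
        + u powr a * (1 + u) powr (- b) * ((- 1 / W * ?c - (1 - u / W) * (m / W)) / (?c * ?c))) (at u)"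
      unfolding f_def
      by (rule derivative_eq_intros refl | use u0 c W in \<open>simp; fail\<close>)+ (use u0 c W in \<open>simp add: field_simps\<close>)
    also have "(a * u powr (a - 1) * (1 + u) powr (- b) + u powr a * (- b * (1 + u) powr (- b - 1))) * ((1 - u / W) / ?c)
        + u powr a * (1 + u) powr (- b) * ((- 1 / W * ?c - (1 - u / W) * (m / W)) / (?c * ?c)) = g u"
    proof -
      have 1: "u powr a = u * u powr (a - 1)" using u0 by (simp add: powr_diff)
      have 2: "(1 + u) powr (- b) = (1 + u) * (1 + u) powr (- b - 1)" using u0 by (simp add: powr_diff)
      have 3: "- 1 / W * ?c - (1 - u / W) * (m / W) = - (m + 1) / W" using W by (simp add: field_simps)
      have w: "weight W u = u powr (a - 1) * (1 + u) powr (- b - 1) * (1 / ?c)"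
        using u0 by (simp add: weight_def tilt_def beta_prime_kernel_def)
      have "(a * X * ((1 + u) * Y) + u * X * (- b * Y)) * (k1 * i) + u * X * ((1 + u) * Y) * (- (m + 1) / W * (i * i))
         = ((a - p * u) * k1 - (u / W) * (1 + u) * ((m + 1) * i)) * (X * Y * i)" for X Y k1 i
        unfolding p_def by (simp add: algebra_simps add_divide_distrib diff_divide_distrib)
      from this[of "u powr (a - 1)" "(1 + u) powr (- b - 1)" "1 - u / W" "1 / ?c"]
      show ?thesis unfolding g_def w 3 by (subst 1, subst 1, subst 2, subst 2) simp
    qed
    finally show ?thesis by (simp add: has_real_derivative_iff_has_vector_derivative)
  qed
  have cont: "continuous_on {0..W} f"
    unfolding f_def using pos a W
    by (intro continuous_intros continuous_on_powr' ballI conjI impI) (auto simp: less_imp_neq[symmetric])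
  have fi: "(g has_integral (f W - f 0)) {0..W}"
    using W cont deriv by (intro fundamental_theorem_of_calculus_interior) auto
  define L where "L u = (a - p * u) * (1 - u / W) - (u / W) * (1 + u) * ((m + 1) / (1 + m * u / W))" for u
  have low: "a - p * u - p * (u / W) \<le> L u" if u: "0 < u" "u < W" for u
  proof -
    have "(m + 1) / (1 + m * u / W) \<le> m + 1" using u by (intro frac) simp
    then have "(u / W) * (1 + u) * ((m + 1) / (1 + m * u / W)) \<le> (u / W) * (1 + u) * (m + 1)"
      using u W by (intro mult_left_mono) auto
    moreover have "(a - p * u) * (1 - u / W) - (u / W) * (1 + u) * (m + 1) =
       a - p * u - (u / W) * (a + m + 1) + (u / W) * u * (p - (m + 1))"
      using W by (simp add: field_simps)
    moreover have "(u / W) * (a + m + 1) \<le> (u / W) * p"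
      using u W am by (intro mult_left_mono) (auto simp: p_def)
    moreover have "0 \<le> (u / W) * u * (p - (m + 1))"
      using u W am a by (intro mult_nonneg_nonneg) (auto simp: p_def)
    ultimately show ?thesis unfolding L_def mult.commute[of p "u / W"] by linarith
  qed
  have intg: "integrable lborel g"
  proof (rule Bochner_Integration.integrable_bound)
    let ?C = "a + p + m + 1"
    show "integrable lborel (\<lambda>u. (?C * (1 + u)) * weight W u)"
      by (rule integrable_weight[where C = ?C]) (use a m in \<open>auto simp: p_def intro!: mult_nonneg_nonneg\<close>)
    show "g \<in> borel_measurable lborel" unfolding g_def by measurable
    show "AE u in lborel. norm (g u) \<le> norm ((?C * (1 + u)) * weight W u)"
    proof (rule AE_I2)
      fix u :: real
      show "norm (g u) \<le> norm ((?C * (1 + u)) * weight W u)"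
      proof (cases "u \<in> {0<..<W}")
        case True
        then have u: "0 < u" "u < W" by auto
        have p: "p \<ge> 0" using a m by (simp add: p_def)
        have "\<bar>(a - p * u) * (1 - u / W)\<bar> \<le> (a + p * u) * 1"
          unfolding abs_mult using u a p W by (intro mult_mono) (auto simp: abs_le_iff)
        moreover have "\<bar>(u / W) * (1 + u) * ((m + 1) / (1 + m * u / W))\<bar> \<le> 1 * (1 + u) * (m + 1)"
          unfolding abs_mult
        proof (intro mult_mono)
          have "(m + 1) / (1 + m * u / W) \<le> m + 1" using u by (intro frac) simp
          then show "\<bar>(m + 1) / (1 + m * u / W)\<bar> \<le> m + 1" using pos[of u] u m by simp
        qed (use u W m in auto)
        ultimately have "\<bar>L u\<bar> \<le> (a + p * u) * 1 + 1 * (1 + u) * (m + 1)"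
          unfolding L_def by (intro order_trans[OF abs_triangle_ineq4] add_mono)
        also have "\<dots> \<le> ?C * (1 + u)" using u a p m by (simp add: algebra_simps)
        finally have "\<bar>L u\<bar> * weight W u \<le> ?C * (1 + u) * weight W u"
          by (rule mult_right_mono) simp
        moreover have "norm (g u) = \<bar>L u\<bar> * weight W u" by (simp add: g_def L_def abs_mult)
        moreover have "?C * (1 + u) * weight W u \<le> norm ((?C * (1 + u)) * weight W u)" by simp
        ultimately show ?thesis by linarith
      qed (simp add: g_def weight_def tilt_def)
    qed
  qed
  have "(\<integral>u. g u \<partial>lborel) = (LINT u:{0..W}|lborel. g u)"
    unfolding set_lebesgue_integral_def
    by (intro Bochner_Integration.integral_cong) (auto simp: g_def weight_def tilt_def indicator_def)
  also have "\<dots> = integral {0..W} g"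
    by (intro set_borel_integral_eq_integral) (unfold set_integrable_def, intro integrable_mult_indicator intg, simp)
  also have "\<dots> = f W - f 0" using fi by (rule integral_unique)
  also have "\<dots> = 0" using W a by (simp add: f_def)
  finally have g0: "(\<integral>u. g u \<partial>lborel) = 0" .
  define D0 where "D0 = (\<integral>u. weight W u \<partial>lborel)"
  define U1 where "U1 = (\<integral>u. u * weight W u \<partial>lborel)"
  have D0: "D0 > 0" unfolding D0_def by (rule integral_weight_pos'[OF W])
  have hb: "has_bochner_integral lborel (\<lambda>u. a * weight W u - p * (u * weight W u) - (p / W) * (u * weight W u)) (a * D0 - p * U1 - (p / W) * U1)"
    unfolding D0_def U1_def
    by (intro has_bochner_integral_diff has_bochner_integral_mult_right has_bochner_integral_integrable integrable_weight[where C = 1]) auto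
  have "a * D0 - p * U1 - (p / W) * U1 = (\<integral>u. a * weight W u - p * (u * weight W u) - (p / W) * (u * weight W u) \<partial>lborel)"
    using hb by (simp add: has_bochner_integral_integral_eq)
  also have "\<dots> \<le> (\<integral>u. g u \<partial>lborel)"
  proof (rule integral_mono)
    show "integrable lborel (\<lambda>u. a * weight W u - p * (u * weight W u) - (p / W) * (u * weight W u))"
      using hb by (simp add: has_bochner_integral_iff)
    fix u :: real
    show "a * weight W u - p * (u * weight W u) - (p / W) * (u * weight W u) \<le> g u"
    proof (cases "u \<in> {0<..<W}")
      case True
      then have "(a - p * u - p * (u / W)) * weight W u \<le> L u * weight W u"
        by (intro mult_right_mono low) auto
      then show ?thesis by (simp add: g_def L_def algebra_simps)
    qed (simp add: g_def weight_def tilt_def)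
  qed (rule intg)
  finally have "a * D0 - p * U1 - (p / W) * U1 \<le> 0" using g0 by simp
  then have "a - p * (U1 / D0) - p * (U1 / D0 / W) \<le> 0"
    using D0 by (simp add: field_simps)
  then have "a \<le> p * (U1 / D0 + U1 / D0 / W)"
    by (simp only: distrib_left)
  then have "a \<le> (U1 / D0 + U1 / D0 / W) * p"
    by (simp only: mult.commute)
  moreover have "p > 0" using a m by (simp add: p_def)
  ultimately have "a / p \<le> U1 / D0 + U1 / D0 / W"
    by (simp only: pos_divide_le_eq)
  moreover have "a / p = 1 / m" using a by (simp add: p_def)
  ultimately show ?thesis by (simp add: post_def U1_def D0_def)
qed

end

section \<open>The Bayes estimators\<close>

context shrinkage_posterior
begin

definition shrink :: "real \<Rightarrow> real" where
  "shrink lam = lam / (m + 1 - m * lam)"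

text \<open>
  The joint density of the data and of the hyperparameters \<open>(lam, \<tau>)\<close>, with \<open>\<theta>\<close> integrated out;
  it depends on the sample through \<open>S\<close> and \<open>W\<close>.
\<close>
definition hyper_kernel :: "real \<Rightarrow> real \<Rightarrow> real \<Rightarrow> real \<Rightarrow> real" where
  "hyper_kernel S W lam \<tau> = indicator {0<..<1} lam * indicator {0<..} \<tau> * (shrink lam powr a / lam) *
     ((\<tau> / (2 * pi)) powr b * exp (- (S * (1 + shrink lam * W) / 2 * \<tau>)))"

lemma shrink_measurable [measurable]: "shrink \<in> borel_measurable borel"
  unfolding shrink_def by measurable

lemma hyper_kernel_measurable [measurable]:
  "(\<lambda>(lam, \<tau>). hyper_kernel S W lam \<tau>) \<in> borel_measurable (borel \<Otimes>\<^sub>M borel)"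
  unfolding hyper_kernel_def by measurable

lemma hyper_kernel_nonneg [simp]: "0 \<le> hyper_kernel S W lam \<tau>"
  by (auto simp: hyper_kernel_def indicator_def)

lemma shrink_bounds: "0 < lam \<Longrightarrow> lam < 1 \<Longrightarrow> 0 < shrink lam \<and> shrink lam < 1"
proof -
  assume lam: "0 < lam" "lam < 1"
  have "m * lam < m" using lam m by simp
  then have "0 < m + 1 - m * lam" "lam < m + 1 - m * lam" using lam by linarith+
  then show ?thesis using lam by (simp add: shrink_def)
qed

text \<open>
  Substitute \<open>lam = (m + 1) u / (W + m u)\<close>, that is, \<open>shrink lam = u / W\<close>.
\<close>
lemma nn_integral_shrink_substitution:
  assumes W: "W > 0" and [measurable]: "F \<in> borel_measurable borel"
    and F: "\<And>u. u > 0 \<Longrightarrow> 0 \<le> F u"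
  shows "(\<integral>\<^sup>+lam. ennreal (indicator {0<..<1} lam * (shrink lam powr a / lam) * F (shrink lam * W)) \<partial>lborel) =
    (\<integral>\<^sup>+u. ennreal (W powr (- a) * (u powr (a - 1) * F u * tilt W u)) \<partial>lborel)"
proof -
  define g where "g u = (m + 1) * u / (W + m * u)" for u
  define g' where "g' u = (m + 1) * W / (W + m * u)\<^sup>2" for u
  let ?f = "\<lambda>lam. ennreal (indicator {0<..<1} lam * (shrink lam powr a / lam) * F (shrink lam * W))"
  have pos: "W + m * u > 0" if "u \<ge> 0" for u using that W m by (intro add_pos_nonneg) auto
  have "W + m * W = (m + 1) * W" by (simp add: algebra_simps)
  then have g0: "g 0 = 0" "g W = 1" using W m by (simp_all add: g_def)
  have "(\<integral>\<^sup>+lam. ?f lam \<partial>lborel) = (\<integral>\<^sup>+lam. ?f lam * indicator {g 0..g W} lam \<partial>lborel)"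
    unfolding g0 by (intro nn_integral_cong) (auto simp: indicator_def)
  also have "\<dots> = (\<integral>\<^sup>+u. ?f (g u) * ennreal (g' u) * indicator {0..W} u \<partial>lborel)"
  proof (rule nn_integral_substitution_aux)
    fix u assume "u \<in> {0..W}"
    then have u: "W + m * u > 0" using pos by simp
    then show "(g has_real_derivative g' u) (at u)" unfolding g_def g'_def
      by (auto intro!: derivative_eq_intros simp: power2_eq_square field_simps)
    show "0 \<le> g' u" unfolding g'_def using W m by simp
  next
    show "continuous_on {0..W} g'" unfolding g'_def
      using pos by (intro continuous_intros) (auto simp: less_imp_neq[symmetric])
  qed (use W in auto)
  also have "\<dots> = (\<integral>\<^sup>+u. ennreal (W powr (- a) * (u powr (a - 1) * F u * tilt W u)) \<partial>lborel)"
  proof (rule nn_integral_cong_AE, rule AE_mp[OF AE_lborel_singleton[of 0]], rule AE_mp[OF AE_lborel_singleton[of W]], rule AE_I2, intro impI)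
    fix u :: real assume u0: "u \<noteq> 0" "u \<noteq> W"
    show "?f (g u) * ennreal (g' u) * indicator {0..W} u = ennreal (W powr (- a) * (u powr (a - 1) * F u * tilt W u))"
    proof (cases "0 < u \<and> u < W")
      case True
      then have u: "0 < u" "u < W" by auto
      have c: "W + m * u > 0" using pos u by simp
      have g1: "g u < 1" using u c by (simp add: g_def field_simps)
      have g_pos: "g u > 0" using u c m by (simp add: g_def)
      have "m + 1 - m * g u = (m + 1) * W / (W + m * u)"
        using c by (simp add: g_def field_simps)
      then have s: "shrink (g u) = u / W"
        using c W m u by (simp add: shrink_def) (simp add: g_def)
      have gg: "g' u / g u = 1 / (u * (1 + m * u / W))"
        using c W m u by (simp add: g'_def g_def power2_eq_square divide_simps)
      have "(u / W) powr a = W powr (- a) * (u powr (a - 1) * u)"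
        using u W by (simp add: powr_divide powr_minus powr_diff divide_simps)
      then have "(u / W) powr a / g u * F u * g' u = W powr (- a) * (u powr (a - 1) * u) * F u * (g' u / g u)"
        by simp
      also have "\<dots> = W powr (- a) * (u powr (a - 1) * F u * (1 / (1 + m * u / W)))"
        unfolding gg using u by simp
      finally have "(u / W) powr a / g u * F u * g' u = W powr (- a) * (u powr (a - 1) * F u * tilt W u)"
        using u by (simp add: tilt_def)
      moreover have "0 \<le> (u / W) powr a / g u * F u" "0 \<le> g' u"
        using F u g_pos m W by (simp_all add: g'_def)
      ultimately show ?thesis
        using u W g_pos g1 by (simp add: s ennreal_mult[symmetric])
    next
      case False
      then show ?thesis using u0 by (auto simp: tilt_def)
    qed
  qed
  finally show ?thesis .
qed

definition norming :: "real \<Rightarrow> real \<Rightarrow> real \<Rightarrow> real" where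
  "norming S W e = (1 / (2 * pi)) powr b * W powr (- a) * (Gamma (b + 1 - e) * (2 / S) powr (b + 1 - e))"

lemma norming_pos: "S > 0 \<Longrightarrow> W > 0 \<Longrightarrow> e \<le> 1 \<Longrightarrow> 0 < norming S W e"
proof -
  assume *: "S > 0" "W > 0" "e \<le> 1"
  have "b > 0" using a m by simp
  then show ?thesis unfolding norming_def using * by (intro mult_pos_pos Gamma_real_pos) auto
qed

text \<open>
  All posterior integrals that are needed are instances: \<open>e = 1 / 2\<close> is a factor \<open>\<sigma> = \<tau>\<^bsup>-1/2\<^esup>\<close>, \<open>e = 1\<close> gives a
  moment bound for \<open>\<theta>\<close>, and \<open>q u = 1 - u / W\<close> is the factor \<open>1 - \<kappa>\<close> of the posterior mean of \<open>\<theta>\<close>.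
\<close>
lemma has_bochner_integral_hyper_kernel:
  assumes S: "S > 0" and W: "W > 0" and e: "0 \<le> e" "e \<le> 1"
    and [measurable]: "q \<in> borel_measurable borel" and q: "\<And>u. 0 < u \<Longrightarrow> u < W \<Longrightarrow> 0 \<le> q u \<and> q u \<le> 1"
  shows "has_bochner_integral lborel (\<lambda>(lam, \<tau>). hyper_kernel S W lam \<tau> * (\<tau> powr (- e) * q (shrink lam * W)))
    (norming S W e * (\<integral>u. q u * (1 + u) powr e * weight W u \<partial>lborel))"
proof -
  define k where "k lam \<tau> = hyper_kernel S W lam \<tau> * (\<tau> powr (- e) * q (shrink lam * W))" for lam \<tau>
  have [measurable]: "case_prod k \<in> borel_measurable (borel \<Otimes>\<^sub>M borel)"
    unfolding k_def by measurable
  have b: "b > 0" using a m by simp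
  define p where "p = b + 1 - e"
  have p: "p > 0" using b e by (simp add: p_def)
  define q' where "q' u = (if 0 < u \<and> u < W then q u else 0)" for u
  have [measurable]: "q' \<in> borel_measurable borel" unfolding q'_def by measurable
  have q': "0 \<le> q' u" "q' u \<le> 1" for u using q by (auto simp: q'_def)
  define cc where "cc = (1 / (2 * pi)) powr b"
  have cc: "cc > 0" by (simp add: cc_def)
  have qs: "q (shrink lam * W) = q' (shrink lam * W)" if "0 < lam" "lam < 1" for lam
    using shrink_bounds[OF that] W by (simp add: q'_def mult_less_cancel_right2)
  define F where "F u = W powr a * (q' u * (1 + u) powr (- p))" for u
  have [measurable]: "F \<in> borel_measurable borel" unfolding F_def by measurable
  define K where "K = cc * W powr (- a) * (Gamma p * (2 / S) powr p)"
  have Gp: "Gamma p > 0" using p by (rule Gamma_real_pos)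
  have K: "K > 0" "K = norming S W e" using cc W Gp S by (simp_all add: K_def cc_def norming_def p_def)
  have int: "integrable lborel (\<lambda>u. (q' u * (1 + u) powr e) * weight W u)"
  proof (rule integrable_weight[where C = 1])
    fix u :: real assume u: "u > 0"
    have "(1 + u) powr e \<le> (1 + u) powr 1" using u e by (intro powr_mono) auto
    then have "q' u * (1 + u) powr e \<le> 1 * (1 + u)" using q' u by (intro mult_mono) auto
    then show "\<bar>q' u * (1 + u) powr e\<bar> \<le> 1 * (1 + u)" using q'[of u] by simp
  qed simp
  have "(\<integral>\<^sup>+z. ennreal (case_prod k z) \<partial>lborel) =
    (\<integral>\<^sup>+z. ennreal (case_prod k z) \<partial>(lborel \<Otimes>\<^sub>M lborel))"
    by (simp add: lborel_prod)
  also have "\<dots> = (\<integral>\<^sup>+lam. \<integral>\<^sup>+\<tau>. ennreal (k lam \<tau>) \<partial>lborel \<partial>lborel)"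
    by (subst lborel.nn_integral_fst[symmetric]) auto
  also have "\<dots> = (\<integral>\<^sup>+lam. ennreal K * ennreal (indicator {0<..<1} lam * (shrink lam powr a / lam) * F (shrink lam * W)) \<partial>lborel)"
  proof (rule nn_integral_cong)
    fix lam :: real
    show "(\<integral>\<^sup>+\<tau>. ennreal (k lam \<tau>) \<partial>lborel) =
       ennreal K * ennreal (indicator {0<..<1} lam * (shrink lam powr a / lam) * F (shrink lam * W))"
    proof (cases "lam \<in> {0<..<1}")
      case True
      then have lam: "0 < lam" "lam < 1" by auto
      define u where "u = shrink lam * W"
      have u: "u > 0" using shrink_bounds[OF lam] W by (simp add: u_def)
      define B where "B = S * (1 + u) / 2"
      have B: "B > 0" using S u by (simp add: B_def)
      define c where "c = (shrink lam powr a / lam) * q' u * cc"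
      have c: "c \<ge> 0" using lam q' cc by (simp add: c_def)
      have "(\<integral>\<^sup>+\<tau>. ennreal (k lam \<tau>) \<partial>lborel) =
        (\<integral>\<^sup>+\<tau>. ennreal c * ennreal (gamma_kernel p B \<tau>) \<partial>lborel)"
      proof (rule nn_integral_cong)
        fix \<tau> :: real
        have "k lam \<tau> = c * gamma_kernel p B \<tau>"
        proof (cases "\<tau> > 0")
          case \<tau>: True
          have "(\<tau> / (2 * pi)) powr b * \<tau> powr (- e) = cc * \<tau> powr (p - 1)"
            using \<tau> by (simp add: cc_def p_def powr_divide powr_add[symmetric] powr_one_eq_one)
          then have "(\<tau> / (2 * pi)) powr b = cc * \<tau> powr (p - 1) * \<tau> powr e"
            using \<tau> by (simp add: powr_minus field_simps)
          moreover have "hyper_kernel S W lam \<tau> = (shrink lam powr a / lam) * ((\<tau> / (2 * pi)) powr b * exp (- (B * \<tau>)))"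
            using \<tau> lam by (simp add: hyper_kernel_def B_def u_def)
          moreover have "q (shrink lam * W) = q' u" using lam by (simp add: qs u_def)
          moreover have "gamma_kernel p B \<tau> = \<tau> powr (p - 1) * exp (- (B * \<tau>))" using \<tau> by (simp add: gamma_kernel_def)
          moreover have "\<tau> powr e * \<tau> powr (- e) = 1" using \<tau> by (simp add: powr_minus)
          ultimately show ?thesis by (simp add: k_def c_def)
        qed (simp add: k_def hyper_kernel_def gamma_kernel_def)
        then show "ennreal (k lam \<tau>) = ennreal c * ennreal (gamma_kernel p B \<tau>)"
          using c by (simp add: ennreal_mult[symmetric])
      qed
      also have "\<dots> = ennreal c * ennreal (Gamma p / B powr p)"
        using p B by (subst nn_integral_cmult) (simp_all add: nn_integral_gamma_kernel)
      also have "\<dots> = ennreal (c * (Gamma p / B powr p))"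
        by (rule ennreal_mult'[OF c, symmetric])
      also have "c * (Gamma p / B powr p) = K * (indicator {0<..<1} lam * (shrink lam powr a / lam) *
          F u)"
      proof -
        have "B = (1 + u) / (2 / S)" using S by (simp add: B_def)
        then have "B powr p = (1 + u) powr p / (2 / S) powr p" using S u by (simp add: powr_divide del: divide_divide_eq_right)
        then have "Gamma p / B powr p = Gamma p * (2 / S) powr p * (1 + u) powr (- p)"
          using u by (simp add: powr_minus divide_inverse)
        moreover have "W powr (- a) * W powr a = 1" using W by (simp add: powr_minus)
        ultimately show ?thesis
          using lam by (simp add: c_def K_def F_def)
      qed
      also have "ennreal (K * (indicator {0<..<1} lam * (shrink lam powr a / lam) * F u)) =
          ennreal K * ennreal (indicator {0<..<1} lam * (shrink lam powr a / lam) * F u)"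
        by (rule ennreal_mult') (use K in simp)
      finally show ?thesis unfolding u_def .
    qed (simp add: k_def hyper_kernel_def F_def)
  qed
  also have "\<dots> = ennreal K * (\<integral>\<^sup>+lam. ennreal (indicator {0<..<1} lam * (shrink lam powr a / lam) * F (shrink lam * W)) \<partial>lborel)"
    by (rule nn_integral_cmult) measurable
  also have "(\<integral>\<^sup>+lam. ennreal (indicator {0<..<1} lam * (shrink lam powr a / lam) * F (shrink lam * W)) \<partial>lborel) =
    (\<integral>\<^sup>+u. ennreal (W powr (- a) * (u powr (a - 1) * F u * tilt W u)) \<partial>lborel)"
    using q' by (intro nn_integral_shrink_substitution[OF W]) (auto simp: F_def)
  also have "\<dots> = (\<integral>\<^sup>+u. ennreal (q' u * (1 + u) powr e * weight W u) \<partial>lborel)"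
  proof (rule nn_integral_cong)
    fix u :: real
    have "W powr (- a) * (u powr (a - 1) * F u * tilt W u) = q' u * (1 + u) powr e * weight W u"
    proof (cases "u > 0")
      case True
      have "(1 + u) powr (- p) = (1 + u) powr e * (1 + u) powr (- (b + 1))"
      proof -
        have "- p = e + - (b + 1)" by (simp add: p_def)
        then show ?thesis by (simp only: powr_add)
      qed
      moreover have "W powr (- a) * W powr a = 1" using W by (simp add: powr_minus)
      ultimately show ?thesis
        using True by (simp add: weight_def beta_prime_kernel_def F_def)
    qed (simp add: F_def q'_def)
    then show "ennreal (W powr (- a) * (u powr (a - 1) * F u * tilt W u)) = ennreal (q' u * (1 + u) powr e * weight W u)"
      by (rule arg_cong)
  qed
  also have "\<dots> = ennreal (\<integral>u. q' u * (1 + u) powr e * weight W u \<partial>lborel)"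
    using int q' by (subst nn_integral_eq_integral) auto
  also have "(\<integral>u. q' u * (1 + u) powr e * weight W u \<partial>lborel) = (\<integral>u. q u * (1 + u) powr e * weight W u \<partial>lborel)"
    by (intro Bochner_Integration.integral_cong) (auto simp: q'_def weight_eq_0 not_less)
  finally have nn: "(\<integral>\<^sup>+z. ennreal (case_prod k z) \<partial>lborel) =
     ennreal K * ennreal (\<integral>u. q u * (1 + u) powr e * weight W u \<partial>lborel)" .
  have I0: "0 \<le> (\<integral>u. q u * (1 + u) powr e * weight W u \<partial>lborel)"
  proof (rule Bochner_Integration.integral_nonneg)
    fix u
    show "0 \<le> q u * (1 + u) powr e * weight W u"
      using q[of u] by (cases "0 < u \<and> u < W") (auto simp: weight_eq_0 not_less)
  qed
  have "has_bochner_integral lborel (case_prod k) (norming S W e * (\<integral>u. q u * (1 + u) powr e * weight W u \<partial>lborel))"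
  proof (rule has_bochner_integral_nn_integral)
    show "case_prod k \<in> borel_measurable lborel"
      unfolding lborel_prod[symmetric] by measurable
    have "0 \<le> k lam \<tau>" for lam \<tau>
      using q' by (cases "0 < lam \<and> lam < 1") (auto simp: k_def qs hyper_kernel_def)
    then show "AE z in lborel. 0 \<le> case_prod k z" by auto
    show "0 \<le> norming S W e * (\<integral>u. q u * (1 + u) powr e * weight W u \<partial>lborel)"
      using I0 K by simp
    show "(\<integral>\<^sup>+z. ennreal (case_prod k z) \<partial>lborel) =
      ennreal (norming S W e * (\<integral>u. q u * (1 + u) powr e * weight W u \<partial>lborel))"
      unfolding nn K(2)[symmetric] using K(1) by (simp add: ennreal_mult')
  qed
  then show ?thesis by (simp only: k_def[abs_def])
qed

end

text \<open>
  Integrating a Gaussian mixture componentwise. The constant \<open>c\<close> allows integrands without a bound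
  in \<open>\<theta>\<close> (\<open>c = 1\<close>) and saves the variance factor for integrands that do not depend on \<open>\<theta>\<close> (\<open>c = 0\<close>).
\<close>
lemma gaussian_mixture:
  fixes M :: "'b::euclidean_space \<Rightarrow> 'a::euclidean_space" and V A r :: "'b \<Rightarrow> real"
    and F :: "'a \<Rightarrow> 'b \<Rightarrow> 'c::{banach, second_countable_topology}"
  assumes [measurable]: "M \<in> borel_measurable borel" "V \<in> borel_measurable borel" "A \<in> borel_measurable borel"
      "r \<in> borel_measurable borel" "(\<lambda>(\<theta>, y). F \<theta> y) \<in> borel_measurable (borel \<Otimes>\<^sub>M borel)"
    and A: "\<And>y. 0 \<le> A y" and V: "\<And>y. A y \<noteq> 0 \<Longrightarrow> V y > 0"
    and F: "\<And>\<theta> y. A y \<noteq> 0 \<Longrightarrow> norm (F \<theta> y) \<le> r y * (1 + c * (norm (\<theta> - M y))\<^sup>2)"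
    and c: "0 \<le> c"
    and int: "integrable lborel (\<lambda>y. A y * (r y * (1 + c * (real DIM('a) * (V y)\<^sup>2))))"
  shows "has_bochner_integral lborel (\<lambda>(\<theta>, y). (gaussian (M y) (V y) \<theta> * A y) *\<^sub>R F \<theta> y)
    (\<integral>y. A y *\<^sub>R (\<integral>\<theta>. gaussian (M y) (V y) \<theta> *\<^sub>R F \<theta> y \<partial>lborel) \<partial>lborel)"
proof -
  let ?f = "\<lambda>(\<theta>, y). (gaussian (M y) (V y) \<theta> * A y) *\<^sub>R F \<theta> y"
  have G [measurable]: "(\<lambda>(\<theta>, y). gaussian (M y) (V y) \<theta>) \<in> borel_measurable (borel \<Otimes>\<^sub>M borel)"
    unfolding gaussian_def by measurable
  have r: "0 \<le> r y" if "A y \<noteq> 0" for y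
  proof -
    have "0 \<le> r y * (1 + c * (norm (M y - M y))\<^sup>2)" using F[OF that, of "M y"] norm_ge_zero order_trans by blast
    then show ?thesis by simp
  qed
  have meas: "?f \<in> borel_measurable (lborel \<Otimes>\<^sub>M lborel)" by measurable
  have inner: "(\<integral>\<^sup>+\<theta>. ennreal (gaussian (M y) (V y) \<theta> * (1 + c * (norm (\<theta> - M y))\<^sup>2)) \<partial>lborel) = ennreal (1 + c * (real DIM('a) * (V y)\<^sup>2))"
    if "A y \<noteq> 0" for y
  proof -
    have "has_bochner_integral lborel (\<lambda>\<theta>. gaussian (M y) (V y) \<theta> + c * ((norm (\<theta> - M y))\<^sup>2 * gaussian (M y) (V y) \<theta>)) (1 + c * (real DIM('a) * (V y)\<^sup>2))"
      using V[OF that] by (intro has_bochner_integral_add has_bochner_integral_mult_right)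
        (simp_all add: has_bochner_integral_iff integral_gaussian integrable_gaussian_second_moment integral_gaussian_second_moment)
    moreover have "(\<lambda>\<theta>. gaussian (M y) (V y) \<theta> + c * ((norm (\<theta> - M y))\<^sup>2 * gaussian (M y) (V y) \<theta>)) =
       (\<lambda>\<theta>. gaussian (M y) (V y) \<theta> * (1 + c * (norm (\<theta> - M y))\<^sup>2))"
      by (simp add: fun_eq_iff algebra_simps)
    ultimately have "has_bochner_integral lborel (\<lambda>\<theta>. gaussian (M y) (V y) \<theta> * (1 + c * (norm (\<theta> - M y))\<^sup>2)) (1 + c * (real DIM('a) * (V y)\<^sup>2))"
      by simp
    then show ?thesis using c by (subst nn_integral_eq_integral) (auto simp: has_bochner_integral_iff)
  qed
  have "(\<integral>\<^sup>+z. ennreal (norm (?f z)) \<partial>(lborel \<Otimes>\<^sub>M lborel)) = (\<integral>\<^sup>+y. \<integral>\<^sup>+\<theta>. ennreal (norm (?f (\<theta>, y))) \<partial>lborel \<partial>lborel)"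
    by (rule lborel_pair.nn_integral_snd[symmetric]) measurable
  also have "\<dots> \<le> (\<integral>\<^sup>+y. ennreal (A y * (r y * (1 + c * (real DIM('a) * (V y)\<^sup>2)))) \<partial>lborel)"
  proof (rule nn_integral_mono)
    fix y :: 'b
    show "(\<integral>\<^sup>+\<theta>. ennreal (norm (?f (\<theta>, y))) \<partial>lborel) \<le> ennreal (A y * (r y * (1 + c * (real DIM('a) * (V y)\<^sup>2))))"
    proof (cases "A y = 0")
      case False
      have "(\<integral>\<^sup>+\<theta>. ennreal (norm (?f (\<theta>, y))) \<partial>lborel) \<le>
        (\<integral>\<^sup>+\<theta>. ennreal (A y * r y) * ennreal (gaussian (M y) (V y) \<theta> * (1 + c * (norm (\<theta> - M y))\<^sup>2)) \<partial>lborel)"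
      proof (rule nn_integral_mono)
        fix \<theta>
        have "norm (?f (\<theta>, y)) = gaussian (M y) (V y) \<theta> * A y * norm (F \<theta> y)" using A[of y] by simp
        also have "\<dots> \<le> gaussian (M y) (V y) \<theta> * A y * (r y * (1 + c * (norm (\<theta> - M y))\<^sup>2))"
          using A[of y] F[OF False] by (intro mult_left_mono) auto
        finally have "norm (?f (\<theta>, y)) \<le> (A y * r y) * (gaussian (M y) (V y) \<theta> * (1 + c * (norm (\<theta> - M y))\<^sup>2))"
          by (simp add: mult_ac)
        moreover have "0 \<le> A y * r y" using A[of y] r[OF False] by simp
        ultimately show "ennreal (norm (?f (\<theta>, y))) \<le> ennreal (A y * r y) * ennreal (gaussian (M y) (V y) \<theta> * (1 + c * (norm (\<theta> - M y))\<^sup>2))"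
          by (simp add: ennreal_mult'[symmetric] ennreal_leI)
      qed
      also have "\<dots> = ennreal (A y * r y) * ennreal (1 + c * (real DIM('a) * (V y)\<^sup>2))"
        unfolding inner[OF False, symmetric] by (rule nn_integral_cmult) measurable
      also have "\<dots> = ennreal (A y * (r y * (1 + c * (real DIM('a) * (V y)\<^sup>2))))"
        using A[of y] r[OF False] c by (subst ennreal_mult'[symmetric]) (auto simp: mult.assoc)
      finally show ?thesis .
    qed simp
  qed
  also have "\<dots> < \<infinity>"
    using int by (simp add: integrable_iff_bounded) (meson le_less_trans nn_integral_mono ennreal_leI abs_ge_self)
  finally have "integrable (lborel \<Otimes>\<^sub>M lborel) ?f"
    using meas by (intro integrableI_bounded)
  then have "integrable (lborel \<Otimes>\<^sub>M lborel) ?f \<and> (\<integral>z. ?f z \<partial>(lborel \<Otimes>\<^sub>M lborel)) =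
     (\<integral>y. \<integral>\<theta>. (gaussian (M y) (V y) \<theta> * A y) *\<^sub>R F \<theta> y \<partial>lborel \<partial>lborel)"
    using lborel_pair.integral_snd[of "\<lambda>\<theta> y. (gaussian (M y) (V y) \<theta> * A y) *\<^sub>R F \<theta> y"] by simp
  moreover have "(\<integral>\<theta>. (gaussian (M y) (V y) \<theta> * A y) *\<^sub>R F \<theta> y \<partial>lborel) =
      A y *\<^sub>R (\<integral>\<theta>. gaussian (M y) (V y) \<theta> *\<^sub>R F \<theta> y \<partial>lborel)" for y
  proof -
    have "(\<integral>\<theta>. (gaussian (M y) (V y) \<theta> * A y) *\<^sub>R F \<theta> y \<partial>lborel) = (\<integral>\<theta>. A y *\<^sub>R (gaussian (M y) (V y) \<theta> *\<^sub>R F \<theta> y) \<partial>lborel)"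
      by (simp add: mult.commute)
    also have "\<dots> = A y *\<^sub>R (\<integral>\<theta>. gaussian (M y) (V y) \<theta> *\<^sub>R F \<theta> y \<partial>lborel)"
      by (rule integral_scaleR_right)
    finally show ?thesis .
  qed
  ultimately show ?thesis by (simp add: has_bochner_integral_iff lborel_prod)
qed

lemma ridge_completion:
  fixes x \<theta> :: "'a::real_inner"
  assumes "n > 0" "\<rho> \<ge> 0"
  shows "n * (norm (x - \<theta>))\<^sup>2 + \<rho> * (norm \<theta>)\<^sup>2 =
    (n + \<rho>) * (norm (\<theta> - (1 - \<rho> / (n + \<rho>)) *\<^sub>R x))\<^sup>2 + n * (\<rho> / (n + \<rho>)) * (norm x)\<^sup>2"
proof -
  define k where "k = 1 - \<rho> / (n + \<rho>)"
  have k: "(n + \<rho>) * k = n" using assms by (simp add: k_def field_simps)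
  have nrm: "(norm (\<theta> - k *\<^sub>R x))\<^sup>2 = (norm \<theta>)\<^sup>2 - 2 * k * (x \<bullet> \<theta>) + k\<^sup>2 * (norm x)\<^sup>2"
    unfolding power2_norm_eq_inner by (simp add: inner_diff_left inner_diff_right inner_commute power2_eq_square algebra_simps)
  have "(n + \<rho>) * (norm (\<theta> - k *\<^sub>R x))\<^sup>2 = (n + \<rho>) * (norm \<theta>)\<^sup>2 - 2 * ((n + \<rho>) * k) * (x \<bullet> \<theta>) + ((n + \<rho>) * k) * k * (norm x)\<^sup>2"
    unfolding nrm power2_eq_square[of k] by (simp add: algebra_simps)
  also have "\<dots> = (n + \<rho>) * (norm \<theta>)\<^sup>2 - 2 * n * (x \<bullet> \<theta>) + n * k * (norm x)\<^sup>2" unfolding k by simp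
  finally have "(n + \<rho>) * (norm (\<theta> - k *\<^sub>R x))\<^sup>2 + n * (1 - k) * (norm x)\<^sup>2 = (n + \<rho>) * (norm \<theta>)\<^sup>2 - 2 * n * (x \<bullet> \<theta>) + n * (norm x)\<^sup>2"
    by (simp add: algebra_simps)
  also have "\<dots> = n * (norm (x - \<theta>))\<^sup>2 + \<rho> * (norm \<theta>)\<^sup>2"
    unfolding power2_norm_eq_inner by (simp add: inner_diff_left inner_diff_right inner_commute algebra_simps)
  finally show ?thesis by (simp add: k_def)
qed

text \<open>
  Completing the square in \<open>\<theta>\<close>, with \<open>\<rho> = lam / (1 - lam)\<close> the ratio of the prior precision to \<open>\<tau>\<close>. At the
  endpoints of the range of \<open>lam\<close> both sides vanish, because \<open>1 / 0 = 0\<close>.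
\<close>
lemma posterior_joint_density:
  fixes x :: "(real ^ 'd) ^ 'n"
  assumes S: "rss x > 0" and n: "CARD('n) \<ge> 2"
  defines "a \<equiv> real CARD('d) / 2" and "m \<equiv> real CARD('n) - 1"
    and "W \<equiv> real CARD('n) * (norm (sample_mean x))\<^sup>2 / rss x"
  shows "hierarchical_density \<theta> lam \<tau> * sample_density \<theta> (1 / sqrt \<tau>) x =
    gaussian ((1 - shrinkage_posterior.shrink m lam) *\<^sub>R sample_mean x) (sqrt ((1 - lam) / ((m + 1 - m * lam) * \<tau>))) \<theta> *
    shrinkage_posterior.hyper_kernel a m (rss x) W lam \<tau>"
proof -
  have m: "m > 0" using n by (simp add: m_def)
  interpret shrinkage_posterior a m by unfold_locales (use m in \<open>auto simp: a_def\<close>)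
  let ?n = "real CARD('n)" and ?xb = "sample_mean x"
  show ?thesis
  proof (cases "0 < lam \<and> lam < 1 \<and> \<tau> > 0")
    case False
    have "hierarchical_density \<theta> lam \<tau> = 0"
    proof (cases "lam = 0 \<or> lam = 1")
      case True
      then show ?thesis by (auto simp: hierarchical_density_def mvn_density_def power_0_left)
    next
      case F: False
      then have "lam \<notin> {0..1} \<or> \<not> \<tau> > 0" using False by auto
      then show ?thesis by (auto simp: hierarchical_density_def)
    qed
    moreover have "hyper_kernel (rss x) W lam \<tau> = 0" using False by (auto simp: hyper_kernel_def)
    ultimately show ?thesis by simp
  next
    case True
    then have lam: "0 < lam" "lam < 1" and \<tau>: "\<tau> > 0" by auto
    define \<rho> where "\<rho> = lam / (1 - lam)"
    define \<kappa> where "\<kappa> = \<rho> / (?n + \<rho>)"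
    have n0: "?n > 0" by simp
    have \<rho>: "\<rho> > 0" using lam by (simp add: \<rho>_def)
    have nm: "m + 1 = ?n" by (simp add: m_def)
    have n\<rho>: "?n + \<rho> = (m + 1 - m * lam) / (1 - lam)"
      using lam unfolding nm[symmetric] \<rho>_def by (simp add: field_simps)
    have den: "m + 1 - m * lam > 0"
    proof -
      have "m * lam < m" using lam m by simp
      then show ?thesis by simp
    qed
    have shr: "shrink lam = \<kappa>"
      unfolding \<kappa>_def n\<rho> unfolding shrink_def \<rho>_def using lam den by simp
    have \<kappa>: "\<kappa> > 0" using \<rho> n0 by (simp add: \<kappa>_def add_pos_pos)
    have s0: "(sqrt (inverse \<tau> * inverse lam * (1 - lam)))\<^sup>2 = 1 / (\<tau> * \<rho>)"
      using lam \<tau> by (simp add: \<rho>_def field_simps)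
    have v: "(sqrt ((1 - lam) / ((m + 1 - m * lam) * \<tau>)))\<^sup>2 = 1 / (\<tau> * (?n + \<rho>))"
    proof -
      have "0 \<le> (1 - lam) / ((m + 1 - m * lam) * \<tau>)" using lam \<tau> den by simp
      then have "(sqrt ((1 - lam) / ((m + 1 - m * lam) * \<tau>)))\<^sup>2 = (1 - lam) / ((m + 1 - m * lam) * \<tau>)"
        by (rule real_sqrt_pow2)
      also have "\<dots> = 1 / (\<tau> * (?n + \<rho>))"
        unfolding n\<rho> by (simp only: times_divide_eq_right divide_divide_eq_right mult_1_left mult.commute[of \<tau>])
      finally show ?thesis .
    qed
    have c0: "1 / sqrt (2 * pi * (1 / (\<tau> * \<rho>))) = 1 / sqrt (2 * pi * (1 / (\<tau> * (?n + \<rho>)))) * sqrt \<kappa>"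
    proof -
      have "1 / sqrt (2 * pi * (1 / (\<tau> * \<rho>))) = sqrt (\<tau> * \<rho> / (2 * pi))"
        by (simp add: real_sqrt_divide)
      also have "\<tau> * \<rho> / (2 * pi) = (\<tau> * (?n + \<rho>) / (2 * pi)) * \<kappa>"
        using \<rho> n0 by (simp add: \<kappa>_def add_pos_pos less_imp_neq[symmetric])
      also have "sqrt \<dots> = 1 / sqrt (2 * pi * (1 / (\<tau> * (?n + \<rho>)))) * sqrt \<kappa>"
        by (simp add: real_sqrt_divide real_sqrt_mult)
      finally show ?thesis .
    qed
    have \<kappa>a: "sqrt \<kappa> ^ CARD('d) = \<kappa> powr a"
    proof -
      have "sqrt \<kappa> ^ CARD('d) = (\<kappa> powr (1 / 2)) powr real CARD('d)"
        using \<kappa> by (simp add: powr_half_sqrt powr_realpow)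
      then show ?thesis using \<kappa> by (simp add: powr_powr a_def)
    qed
    have c1: "(1 / sqrt (2 * pi * (1 / sqrt \<tau>)\<^sup>2)) ^ (CARD('n) * CARD('d)) = (\<tau> / (2 * pi)) powr (a * (m + 1))"
    proof -
      have "1 / sqrt (2 * pi * (1 / sqrt \<tau>)\<^sup>2) = sqrt (\<tau> / (2 * pi))"
        using \<tau> by (simp add: real_sqrt_divide power_divide)
      also have "\<dots> ^ (CARD('n) * CARD('d)) = ((\<tau> / (2 * pi)) powr (1 / 2)) powr real (CARD('n) * CARD('d))"
        using \<tau> by (simp add: powr_half_sqrt powr_realpow[symmetric])
      also have "\<dots> = (\<tau> / (2 * pi)) powr (1 / 2 * real (CARD('n) * CARD('d)))" by (rule powr_powr)
      also have "1 / 2 * real (CARD('n) * CARD('d)) = a * (m + 1)" by (simp add: a_def nm)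
      finally show ?thesis .
    qed
    have hd: "hierarchical_density \<theta> lam \<tau> = ((1 / sqrt (2 * pi * (1 / (\<tau> * (?n + \<rho>))))) ^ CARD('d) * \<kappa> powr a) * exp (- (norm \<theta>)\<^sup>2 * (\<tau> * \<rho>) / 2) / lam"
    proof -
      have "mvn_density 0 (sqrt (inverse \<tau> * inverse lam * (1 - lam))) \<theta> =
        ((1 / sqrt (2 * pi * (1 / (\<tau> * (?n + \<rho>))))) ^ CARD('d) * \<kappa> powr a) * exp (- (norm \<theta>)\<^sup>2 * (\<tau> * \<rho>) / 2)"
        unfolding mvn_density_def s0 c0 power_mult_distrib \<kappa>a diff_zero
        by (simp only: times_divide_eq_right mult_1_right divide_divide_eq_right)
      moreover have "indicator {0..1} lam = (1 :: real)" "indicator {0<..} \<tau> = (1 :: real)" using lam \<tau> by simp_all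
      ultimately show ?thesis
        unfolding hierarchical_density_def by (simp only: mult_1_right divide_inverse[of _ lam])
    qed
    have sd: "sample_density \<theta> (1 / sqrt \<tau>) x = (\<tau> / (2 * pi)) powr (a * (m + 1)) * exp (- (?n * (norm (?xb - \<theta>))\<^sup>2 + rss x) * \<tau> / 2)"
    proof -
      have "(1 / sqrt \<tau>)\<^sup>2 = 1 / \<tau>" using \<tau> by (simp add: power_divide)
      then have "- (?n * (norm (?xb - \<theta>))\<^sup>2 + rss x) / (2 * (1 / sqrt \<tau>)\<^sup>2) = - (?n * (norm (?xb - \<theta>))\<^sup>2 + rss x) * \<tau> / 2"
        by (simp only: times_divide_eq_right mult_1_right divide_divide_eq_right)
      then show ?thesis unfolding sample_density_mean_rss c1 by (simp only:)
    qed
    have gd: "gaussian ((1 - shrink lam) *\<^sub>R ?xb) (sqrt ((1 - lam) / ((m + 1 - m * lam) * \<tau>))) \<theta> =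
        (1 / sqrt (2 * pi * (1 / (\<tau> * (?n + \<rho>))))) ^ CARD('d) * exp (- (norm (\<theta> - (1 - \<kappa>) *\<^sub>R ?xb))\<^sup>2 * (\<tau> * (?n + \<rho>)) / 2)"
      unfolding gaussian_def v shr by simp
    have hk: "hyper_kernel (rss x) W lam \<tau> = \<kappa> powr a / lam * ((\<tau> / (2 * pi)) powr (a * (m + 1)) * exp (- (rss x + ?n * \<kappa> * (norm ?xb)\<^sup>2) * \<tau> / 2))"
    proof -
      have eq: "rss x * (1 + \<kappa> * W) = rss x + ?n * \<kappa> * (norm ?xb)\<^sup>2" using S by (simp add: W_def field_simps)
      have "- (X / 2 * \<tau>) = - X * \<tau> / 2" for X by simp
      from this[of "rss x * (1 + \<kappa> * W)"]
      have "- (rss x * (1 + shrink lam * W) / 2 * \<tau>) = - (rss x + ?n * \<kappa> * (norm ?xb)\<^sup>2) * \<tau> / 2"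
        unfolding shr eq .
      then show ?thesis using lam \<tau> by (simp add: hyper_kernel_def shr)
    qed
    have ridge: "?n * (norm (?xb - \<theta>))\<^sup>2 + \<rho> * (norm \<theta>)\<^sup>2 = (?n + \<rho>) * (norm (\<theta> - (1 - \<kappa>) *\<^sub>R ?xb))\<^sup>2 + ?n * \<kappa> * (norm ?xb)\<^sup>2"
      unfolding \<kappa>_def by (rule ridge_completion) (use \<rho> in auto)
    have "- (norm \<theta>)\<^sup>2 * (\<tau> * \<rho>) / 2 + - (?n * (norm (?xb - \<theta>))\<^sup>2 + rss x) * \<tau> / 2 =
       - (\<tau> / 2) * ((?n * (norm (?xb - \<theta>))\<^sup>2 + \<rho> * (norm \<theta>)\<^sup>2) + rss x)"
      by (simp add: field_simps)
    also have "\<dots> = - (norm (\<theta> - (1 - \<kappa>) *\<^sub>R ?xb))\<^sup>2 * (\<tau> * (?n + \<rho>)) / 2 + - (rss x + ?n * \<kappa> * (norm ?xb)\<^sup>2) * \<tau> / 2"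
      unfolding ridge by (simp add: field_simps)
    finally have ex: "exp (- (norm \<theta>)\<^sup>2 * (\<tau> * \<rho>) / 2) * exp (- (?n * (norm (?xb - \<theta>))\<^sup>2 + rss x) * \<tau> / 2) =
      exp (- (norm (\<theta> - (1 - \<kappa>) *\<^sub>R ?xb))\<^sup>2 * (\<tau> * (?n + \<rho>)) / 2) * exp (- (rss x + ?n * \<kappa> * (norm ?xb)\<^sup>2) * \<tau> / 2)"
      by (simp only: exp_add[symmetric])
    have "C * k * E1 / lam * (T * E2) = C * E3 * (k / lam * (T * E4))" if "E1 * E2 = E3 * E4" for C k E1 E2 E3 E4 T :: real
    proof -
      have "C * k * E1 / lam * (T * E2) = C * k * T / lam * (E1 * E2)" by simp
      then show ?thesis unfolding that by simp
    qed
    from this[OF ex] show ?thesis unfolding hd sd gd hk .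
  qed
qed

lemma mvn_density_measurable2 [measurable]:
  "(\<lambda>z. mvn_density (f z) (g z) (h z)) \<in> borel_measurable N"
  if [measurable]: "f \<in> borel_measurable N" "g \<in> borel_measurable N" "h \<in> borel_measurable N"
  unfolding mvn_density_def by measurable

lemma posterior_integral:
  fixes x :: "(real ^ 'd) ^ 'n" and f :: "real ^ 'd \<Rightarrow> real \<Rightarrow> 'b::{banach, second_countable_topology}"
  assumes [measurable]: "(\<lambda>(\<theta>, s). f \<theta> s) \<in> borel_measurable (borel \<Otimes>\<^sub>M borel)"
  shows "(\<integral>(\<mu>, \<sigma>). sample_density \<mu> \<sigma> x *\<^sub>R f \<mu> \<sigma> \<partial>hierarchical_prior) =
    (\<integral>(\<theta>, lam, \<tau>). (hierarchical_density \<theta> lam \<tau> * sample_density \<theta> (1 / sqrt \<tau>) x) *\<^sub>R f \<theta> (1 / sqrt \<tau>) \<partial>lborel)"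
proof -
  have [measurable]: "(\<lambda>(\<theta>, lam, \<tau>). hierarchical_density \<theta> lam \<tau>) \<in> borel_measurable (lborel :: ((real ^ 'd) \<times> real \<times> real) measure)"
    unfolding hierarchical_density_def lborel_prod[symmetric] by measurable
  have T [measurable]: "(\<lambda>(\<theta>, lam, \<tau>). (\<theta>, 1 / sqrt \<tau>)) \<in> (lborel :: ((real ^ 'd) \<times> real \<times> real) measure) \<rightarrow>\<^sub>M borel"
    unfolding borel_prod[symmetric] lborel_prod[symmetric] by measurable
  have sm [measurable]: "(\<lambda>(\<mu>, \<sigma>). sample_density \<mu> \<sigma> x *\<^sub>R f \<mu> \<sigma>) \<in> borel_measurable borel"
    unfolding sample_density_def borel_prod[symmetric] by measurable
  have hn: "0 \<le> hierarchical_density \<theta> lam \<tau>" for \<theta> :: "real ^ 'd" and lam \<tau>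
    by (auto simp: hierarchical_density_def mvn_density_def indicator_def)
  have "(\<integral>(\<mu>, \<sigma>). sample_density \<mu> \<sigma> x *\<^sub>R f \<mu> \<sigma> \<partial>hierarchical_prior) =
    (\<integral>z. (\<lambda>(\<mu>, \<sigma>). sample_density \<mu> \<sigma> x *\<^sub>R f \<mu> \<sigma>) ((\<lambda>(\<theta>, lam, \<tau>). (\<theta>, 1 / sqrt \<tau>)) z)
      \<partial>density lborel (\<lambda>(\<theta>, lam, \<tau>). ennreal (hierarchical_density \<theta> lam \<tau>)))"
    unfolding hierarchical_prior_def by (rule integral_distr) (use T sm in simp_all)
  also have "\<dots> = (\<integral>z. (\<lambda>(\<theta>, lam, \<tau>). hierarchical_density \<theta> lam \<tau>) z *\<^sub>R
      (\<lambda>(\<mu>, \<sigma>). sample_density \<mu> \<sigma> x *\<^sub>R f \<mu> \<sigma>) ((\<lambda>(\<theta>, lam, \<tau>). (\<theta>, 1 / sqrt \<tau>)) z) \<partial>lborel)"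
  proof -
    have "(\<lambda>(\<theta>, lam, \<tau>). ennreal (hierarchical_density \<theta> lam \<tau>)) = (\<lambda>z :: (real ^ 'd) \<times> real \<times> real. ennreal ((\<lambda>(\<theta>, lam, \<tau>). hierarchical_density \<theta> lam \<tau>) z))"
      by (simp add: fun_eq_iff)
    then show ?thesis
      by (simp only:) (rule integral_density, measurable, auto simp: hn)
  qed
  also have "\<dots> = (\<integral>(\<theta>, lam, \<tau>). (hierarchical_density \<theta> lam \<tau> * sample_density \<theta> (1 / sqrt \<tau>) x) *\<^sub>R f \<theta> (1 / sqrt \<tau>) \<partial>lborel)"
    by (intro Bochner_Integration.integral_cong) auto
  finally show ?thesis .
qed

lemma hierarchical_posterior:
  fixes x :: "(real ^ 'd) ^ 'n"
  assumes S: "rss x > 0" and n: "CARD('n) \<ge> 2" and x: "sample_mean x \<noteq> 0"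
  defines "a \<equiv> real CARD('d) / 2" and "m \<equiv> real CARD('n) - 1"
    and "W \<equiv> real CARD('n) * (norm (sample_mean x))\<^sup>2 / rss x"
  shows "posterior_expectation hierarchical_prior (\<lambda>\<mu> \<sigma>. \<mu>) x =
      (1 - shrinkage_posterior.post a m W (\<lambda>u. u) / W) *\<^sub>R sample_mean x" (is ?mean)
    and "posterior_expectation hierarchical_prior (\<lambda>\<mu> \<sigma>. \<sigma>) x =
      scale_factor (a * (m + 1)) * shrinkage_posterior.post a m W (\<lambda>u. sqrt (1 + u)) * sqrt (rss x)" (is ?scale)
proof -
  have m: "m > 0" using n by (simp add: m_def)
  interpret shrinkage_posterior a m by unfold_locales (use m in \<open>auto simp: a_def\<close>)
  let ?S = "rss x" and ?xb = "sample_mean x"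
  have W: "W > 0" using S x by (simp add: W_def)
  define A where "A y = (case y of (lam, \<tau>) \<Rightarrow> hyper_kernel ?S W lam \<tau>)" for y
  define M where "M y = (1 - shrink (fst y)) *\<^sub>R ?xb" for y :: "real \<times> real"
  define V where "V y = sqrt ((1 - fst y) / ((m + 1 - m * fst y) * snd y))" for y :: "real \<times> real"
  have [measurable]: "A \<in> borel_measurable borel"
    unfolding A_def borel_prod[symmetric] by measurable
  have [measurable]: "(snd :: real \<times> real \<Rightarrow> real) \<in> borel_measurable borel"
    unfolding borel_prod[symmetric] by measurable
  have [measurable]: "M \<in> borel_measurable borel" "V \<in> borel_measurable borel"
    unfolding M_def V_def borel_prod[symmetric] by measurable
  have A0: "0 \<le> A y" for y by (simp add: A_def split: prod.split)
  have Apos: "0 < fst y \<and> fst y < 1 \<and> 0 < snd y" if "A y \<noteq> 0" for y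
    using that by (auto simp: A_def hyper_kernel_def indicator_def split: prod.splits if_splits)
  have den: "0 < m + 1 - m * lam" if "0 < lam" "lam < 1" for lam
  proof -
    have "m * lam < m" using that m by simp
    then show ?thesis by simp
  qed
  have V: "V y > 0" if "A y \<noteq> 0" for y
    using Apos[OF that] den[of "fst y"] by (simp add: V_def)
  have V2: "(V y)\<^sup>2 \<le> snd y powr (- 1)" if "A y \<noteq> 0" for y
  proof -
    note * = Apos[OF that]
    have "m * fst y \<le> m" using * m by simp
    then have "1 - fst y \<le> m + 1 - m * fst y" using * by linarith
    then have "(1 - fst y) / ((m + 1 - m * fst y) * snd y) \<le> 1 / snd y"
      using * den[of "fst y"] by (simp add: divide_simps)
    moreover have "0 \<le> (1 - fst y) / ((m + 1 - m * fst y) * snd y)" using * den[of "fst y"] by simp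
    ultimately show ?thesis using * by (simp add: V_def powr_minus divide_inverse)
  qed
  have hb: "has_bochner_integral lborel (\<lambda>y. A y * (snd y powr (- e) * q (shrink (fst y) * W)))
     (norming ?S W e * (\<integral>u. q u * (1 + u) powr e * weight W u \<partial>lborel))"
    if "0 \<le> e" "e \<le> 1" "q \<in> borel_measurable borel" "\<And>u. 0 < u \<Longrightarrow> u < W \<Longrightarrow> 0 \<le> q u \<and> q u \<le> 1" for e q
    using has_bochner_integral_hyper_kernel[OF S W that] by (simp add: A_def case_prod_beta')
  have Apow0: "A y * (snd y powr 0 * z) = A y * z" for y z
    using Apos[of y] by (cases "A y = 0") simp_all
  have intA: "has_bochner_integral lborel A (norming ?S W 0 * (\<integral>u. weight W u \<partial>lborel))"
    "has_bochner_integral lborel (\<lambda>y. A y * (1 - shrink (fst y))) (norming ?S W 0 * (\<integral>u. (1 - u / W) * weight W u \<partial>lborel))"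
    "has_bochner_integral lborel (\<lambda>y. A y * snd y powr (- (1 / 2))) (norming ?S W (1 / 2) * (\<integral>u. sqrt (1 + u) * weight W u \<partial>lborel))"
    "integrable lborel (\<lambda>y. A y * snd y powr (- 1))"
  proof -
    have w0: "f u * (1 + u) powr 0 * weight W u = f u * weight W u" for f :: "real \<Rightarrow> real" and u
      by (cases "u > 0") (simp_all add: weight_eq_0)
    have w1: "(1 + u) powr (1 / 2) * weight W u = sqrt (1 + u) * weight W u" for u
      by (cases "u > 0") (simp_all add: weight_eq_0 powr_half_sqrt)
    have hb0: "has_bochner_integral lborel (\<lambda>y. A y * q (shrink (fst y) * W)) (norming ?S W 0 * (\<integral>u. q u * weight W u \<partial>lborel))"
      if "q \<in> borel_measurable borel" "\<And>u. 0 < u \<Longrightarrow> u < W \<Longrightarrow> 0 \<le> q u \<and> q u \<le> 1" for q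
    proof -
      have "has_bochner_integral lborel (\<lambda>y. A y * (snd y powr (- 0) * q (shrink (fst y) * W)))
         (norming ?S W 0 * (\<integral>u. q u * (1 + u) powr 0 * weight W u \<partial>lborel))"
        by (rule hb) (use that in auto)
      then show ?thesis unfolding minus_zero Apow0 w0 .
    qed
    show "has_bochner_integral lborel A (norming ?S W 0 * (\<integral>u. weight W u \<partial>lborel))"
      using hb0[of "\<lambda>_. 1"] by simp
    show "has_bochner_integral lborel (\<lambda>y. A y * (1 - shrink (fst y))) (norming ?S W 0 * (\<integral>u. (1 - u / W) * weight W u \<partial>lborel))"
      using hb0[of "\<lambda>u. 1 - u / W"] W by simp
    show "has_bochner_integral lborel (\<lambda>y. A y * snd y powr (- (1 / 2))) (norming ?S W (1 / 2) * (\<integral>u. sqrt (1 + u) * weight W u \<partial>lborel))"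
      using hb[of "1 / 2" "\<lambda>_. 1"] unfolding mult_1_left mult_1_right w1 by simp
    show "integrable lborel (\<lambda>y. A y * snd y powr (- 1))"
      using hb[of 1 "\<lambda>_. 1"] by (simp add: has_bochner_integral_iff)
  qed
  have joint: "hierarchical_density \<theta> lam \<tau> * sample_density \<theta> (1 / sqrt \<tau>) x =
      gaussian (M (lam, \<tau>)) (V (lam, \<tau>)) \<theta> * A (lam, \<tau>)" for \<theta> lam \<tau>
    unfolding M_def V_def A_def fst_conv snd_conv prod.case a_def m_def W_def
    by (rule posterior_joint_density[OF S n])
  have post_int: "(\<integral>(\<mu>, \<sigma>). sample_density \<mu> \<sigma> x *\<^sub>R f \<mu> \<sigma> \<partial>hierarchical_prior) =
     (\<integral>(\<theta>, y). (gaussian (M y) (V y) \<theta> * A y) *\<^sub>R f \<theta> (1 / sqrt (snd y)) \<partial>lborel)"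
    if "(\<lambda>(\<theta>, s). f \<theta> s) \<in> borel_measurable (borel \<Otimes>\<^sub>M borel)"
    for f :: "real ^ 'd \<Rightarrow> real \<Rightarrow> 'b::{banach, second_countable_topology}"
    by (rule trans[OF posterior_integral[OF that]]) (simp only: joint case_prod_beta' prod.collapse)
  define D0 where "D0 = norming ?S W 0 * (\<integral>u. weight W u \<partial>lborel)"
  have D0: "D0 > 0" unfolding D0_def using norming_pos[OF S W] integral_weight_pos'[OF W] by simp
  have one: "(\<integral>(\<mu>, \<sigma>). sample_density \<mu> \<sigma> x \<partial>hierarchical_prior) = D0"
  proof -
    have "(\<integral>(\<mu>, \<sigma>). sample_density \<mu> \<sigma> x \<partial>hierarchical_prior) = (\<integral>(\<mu>, \<sigma>). sample_density \<mu> \<sigma> x *\<^sub>R (1 :: real) \<partial>hierarchical_prior)"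
      by (simp only: real_scaleR_def mult_1_right)
    also have "\<dots> = (\<integral>(\<theta>, y). (gaussian (M y) (V y) \<theta> * A y) *\<^sub>R (1 :: real) \<partial>lborel)"
      by (rule post_int) simp
    also have "\<dots> = (\<integral>y. A y *\<^sub>R (\<integral>\<theta>. gaussian (M y) (V y) \<theta> *\<^sub>R (1 :: real) \<partial>lborel) \<partial>lborel)"
    proof (rule has_bochner_integral_integral_eq, rule gaussian_mixture[where r = "\<lambda>_. 1" and c = 0])
      show "integrable lborel (\<lambda>y. A y * (1 * (1 + 0 * (real DIM(real ^ 'd) * (V y)\<^sup>2))))"
        using intA(1) unfolding mult_zero_left add_0_right mult_1_right by (simp only: has_bochner_integral_iff)
    qed (use A0 V in simp_all)
    also have "\<dots> = (\<integral>y. A y \<partial>lborel)"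
    proof (rule Bochner_Integration.integral_cong[OF refl])
      fix y show "A y *\<^sub>R (\<integral>\<theta>. gaussian (M y) (V y) \<theta> *\<^sub>R (1 :: real) \<partial>lborel) = A y"
        using V[of y] by (cases "A y = 0") (simp_all add: integral_gaussian)
    qed
    also have "\<dots> = D0" unfolding D0_def by (rule has_bochner_integral_integral_eq[OF intA(1)])
    finally show ?thesis .
  qed
  have scale: "(\<integral>(\<mu>, \<sigma>). sample_density \<mu> \<sigma> x *\<^sub>R \<sigma> \<partial>hierarchical_prior) = norming ?S W (1 / 2) * (\<integral>u. sqrt (1 + u) * weight W u \<partial>lborel)"
  proof -
    have eq: "A y * (1 / sqrt (snd y)) = A y * snd y powr (- (1 / 2))" for y
    proof (cases "A y = 0")
      case False
      then have "0 \<le> snd y" using Apos[OF False] by simp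
      then have "snd y powr (- (1 / 2)) = 1 / sqrt (snd y)"
        by (simp only: powr_minus powr_half_sqrt inverse_eq_divide)
      then show ?thesis by (simp only:)
    qed simp
    have "(\<integral>(\<mu>, \<sigma>). sample_density \<mu> \<sigma> x *\<^sub>R \<sigma> \<partial>hierarchical_prior) = (\<integral>(\<theta>, y). (gaussian (M y) (V y) \<theta> * A y) *\<^sub>R (1 / sqrt (snd y)) \<partial>lborel)"
      by (rule post_int) simp
    also have "\<dots> = (\<integral>y. A y *\<^sub>R (\<integral>\<theta>. gaussian (M y) (V y) \<theta> *\<^sub>R (1 / sqrt (snd y)) \<partial>lborel) \<partial>lborel)"
    proof (rule has_bochner_integral_integral_eq, rule gaussian_mixture[where r = "\<lambda>y. 1 / sqrt (snd y)" and c = 0])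
      show "integrable lborel (\<lambda>y. A y * (1 / sqrt (snd y) * (1 + 0 * (real DIM(real ^ 'd) * (V y)\<^sup>2))))"
        using intA(3) unfolding mult_zero_left add_0_right mult_1_right eq by (simp only: has_bochner_integral_iff)
      show "norm (1 / sqrt (snd y)) \<le> 1 / sqrt (snd y) * (1 + 0 * (norm (\<theta> - M y))\<^sup>2)" if "A y \<noteq> 0" for y \<theta>
        using Apos[OF that] by simp
    qed (use A0 V in simp_all)
    also have "\<dots> = (\<integral>y. A y * snd y powr (- (1 / 2)) \<partial>lborel)"
    proof (rule Bochner_Integration.integral_cong[OF refl])
      fix y show "A y *\<^sub>R (\<integral>\<theta>. gaussian (M y) (V y) \<theta> *\<^sub>R (1 / sqrt (snd y)) \<partial>lborel) = A y * snd y powr (- (1 / 2))"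
        using V[of y] eq[of y] by (cases "A y = 0") (simp_all add: integral_gaussian)
    qed
    also have "\<dots> = norming ?S W (1 / 2) * (\<integral>u. sqrt (1 + u) * weight W u \<partial>lborel)"
      by (rule has_bochner_integral_integral_eq[OF intA(3)])
    finally show ?thesis .
  qed
  have mean: "(\<integral>(\<mu>, \<sigma>). sample_density \<mu> \<sigma> x *\<^sub>R \<mu> \<partial>hierarchical_prior) = (norming ?S W 0 * (\<integral>u. (1 - u / W) * weight W u \<partial>lborel)) *\<^sub>R ?xb"
  proof -
    have "(\<integral>(\<mu>, \<sigma>). sample_density \<mu> \<sigma> x *\<^sub>R \<mu> \<partial>hierarchical_prior) = (\<integral>(\<theta>, y). (gaussian (M y) (V y) \<theta> * A y) *\<^sub>R \<theta> \<partial>lborel)"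
      by (rule post_int) simp
    also have "\<dots> = (\<integral>y. A y *\<^sub>R (\<integral>\<theta>. gaussian (M y) (V y) \<theta> *\<^sub>R \<theta> \<partial>lborel) \<partial>lborel)"
    proof (rule has_bochner_integral_integral_eq, rule gaussian_mixture[where r = "\<lambda>y. 1 + norm ?xb" and c = 1])
      show "integrable lborel (\<lambda>y. A y * ((1 + norm ?xb) * (1 + 1 * (real DIM(real ^ 'd) * (V y)\<^sup>2))))"
      proof (rule Bochner_Integration.integrable_bound)
        show "integrable lborel (\<lambda>y. (1 + norm ?xb) * A y + ((1 + norm ?xb) * real DIM(real ^ 'd)) * (A y * snd y powr (- 1)))"
          using intA(1,4) by (intro Bochner_Integration.integrable_add integrable_mult_right) (simp_all add: has_bochner_integral_iff)
        show "AE y in lborel. norm (A y * ((1 + norm ?xb) * (1 + 1 * (real DIM(real ^ 'd) * (V y)\<^sup>2)))) \<le>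
           norm ((1 + norm ?xb) * A y + ((1 + norm ?xb) * real DIM(real ^ 'd)) * (A y * snd y powr (- 1)))"
        proof (rule AE_I2)
          fix y
          show "norm (A y * ((1 + norm ?xb) * (1 + 1 * (real DIM(real ^ 'd) * (V y)\<^sup>2)))) \<le>
           norm ((1 + norm ?xb) * A y + ((1 + norm ?xb) * real DIM(real ^ 'd)) * (A y * snd y powr (- 1)))"
          proof (cases "A y = 0")
            case False
            have "A y * ((1 + norm ?xb) * (1 + 1 * (real DIM(real ^ 'd) * (V y)\<^sup>2))) \<le> A y * ((1 + norm ?xb) * (1 + 1 * (real DIM(real ^ 'd) * snd y powr (- 1))))"
              using A0 V2[OF False] by (intro mult_left_mono add_left_mono) auto
            also have "\<dots> = (1 + norm ?xb) * A y + ((1 + norm ?xb) * real DIM(real ^ 'd)) * (A y * snd y powr (- 1))"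
              by (simp only: mult_1_left distrib_left distrib_right mult_1_right mult_ac)
            also have "\<dots> \<le> norm \<dots>" unfolding real_norm_def by (rule abs_ge_self)
            finally show ?thesis using A0[of y] by (simp add: abs_mult)
          qed simp
        qed
      qed measurable
      show "norm \<theta> \<le> (1 + norm ?xb) * (1 + 1 * (norm (\<theta> - M y))\<^sup>2)" if "A y \<noteq> 0" for \<theta> y
      proof -
        have "0 < shrink (fst y)" "shrink (fst y) < 1" using Apos[OF that] shrink_bounds by auto
        then have "norm (M y) \<le> 1 * norm ?xb" unfolding M_def norm_scaleR by (intro mult_right_mono) auto
        moreover have "norm \<theta> \<le> norm (M y) + norm (\<theta> - M y)"
          using norm_triangle_ineq[of "M y" "\<theta> - M y"] by simp
        moreover have "norm (\<theta> - M y) \<le> 1 + (norm (\<theta> - M y))\<^sup>2"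
          using zero_le_power2[of "norm (\<theta> - M y) - 1/2"] by (simp add: power2_eq_square algebra_simps)
        moreover have "0 \<le> norm ?xb * (norm (\<theta> - M y))\<^sup>2" by simp
        moreover have "(1 + norm ?xb) * (1 + 1 * (norm (\<theta> - M y))\<^sup>2) =
            1 + norm ?xb + (norm (\<theta> - M y))\<^sup>2 + norm ?xb * (norm (\<theta> - M y))\<^sup>2"
          by (simp add: algebra_simps)
        ultimately show ?thesis by linarith
      qed
    qed (use A0 V in simp_all)
    also have "\<dots> = (\<integral>y. (A y * (1 - shrink (fst y))) *\<^sub>R ?xb \<partial>lborel)"
    proof (rule Bochner_Integration.integral_cong[OF refl])
      fix y show "A y *\<^sub>R (\<integral>\<theta>. gaussian (M y) (V y) \<theta> *\<^sub>R \<theta> \<partial>lborel) = (A y * (1 - shrink (fst y))) *\<^sub>R ?xb"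
      proof (cases "A y = 0")
        case False
        have "has_bochner_integral lborel (\<lambda>\<theta>. gaussian (M y) (V y) \<theta> *\<^sub>R (\<theta> - M y) + gaussian (M y) (V y) \<theta> *\<^sub>R M y) (0 + 1 *\<^sub>R M y)"
          using V[OF False]
          by (intro has_bochner_integral_add has_bochner_integral_scaleR_left)
             (simp_all add: has_bochner_integral_iff integral_gaussian integrable_gaussian_first_moment integral_gaussian_first_moment)
        then have "(\<integral>\<theta>. gaussian (M y) (V y) \<theta> *\<^sub>R \<theta> \<partial>lborel) = M y"
          by (simp add: scaleR_diff_right has_bochner_integral_integral_eq)
        then show ?thesis by (simp add: M_def)
      qed simp
    qed
    also have "\<dots> = (norming ?S W 0 * (\<integral>u. (1 - u / W) * weight W u \<partial>lborel)) *\<^sub>R ?xb"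
      by (rule has_bochner_integral_integral_eq, rule has_bochner_integral_scaleR_left, rule intA(2))
    finally show ?thesis .
  qed
  have n0: "norming ?S W 0 > 0" by (rule norming_pos[OF S W]) simp
  have w0: "(\<integral>u. weight W u \<partial>lborel) > 0" by (rule integral_weight_pos'[OF W])
  show ?mean
  proof -
    have "(\<integral>u. (1 - u / W) * weight W u \<partial>lborel) = (\<integral>u. weight W u - (1 / W) * (u * weight W u) \<partial>lborel)"
      by (intro Bochner_Integration.integral_cong) (auto simp: algebra_simps)
    also have "\<dots> = (\<integral>u. weight W u \<partial>lborel) - (1 / W) * (\<integral>u. u * weight W u \<partial>lborel)"
      using integrable_weight[of "\<lambda>u. u" 1 W] by simp
    finally have ratio: "(\<integral>u. (1 - u / W) * weight W u \<partial>lborel) / (\<integral>u. weight W u \<partial>lborel) = 1 - post W (\<lambda>u. u) / W"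
      using w0 by (simp add: post_def diff_divide_distrib)
    have cancel: "inverse (N * D) *\<^sub>R ((N * X) *\<^sub>R v) = (X / D) *\<^sub>R v" if "N > 0" for N D X :: real and v :: "real ^ 'd"
      using that by (simp add: divide_inverse mult_ac)
    show ?thesis
      unfolding posterior_expectation_def mean one D0_def cancel[OF n0] ratio ..
  qed
  show ?scale
  proof -
    have b0: "b > 0" using a m by simp
    have "norming ?S W (1 / 2) / norming ?S W 0 = scale_factor b * sqrt ?S"
    proof -
      have "(2 / ?S) powr (b + 1) = (2 / ?S) powr (b + 1 / 2) * sqrt (2 / ?S)"
      proof -
        have "(2 / ?S) powr (b + 1 / 2) * (2 / ?S) powr (1 / 2) = (2 / ?S) powr (b + 1 / 2 + 1 / 2)" by (rule powr_add[symmetric])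
        also have "b + 1 / 2 + 1 / 2 = b + 1" by simp
        finally show ?thesis using S by (simp add: powr_half_sqrt)
      qed
      moreover have "Gamma (b + 1) > 0" using b0 by (intro Gamma_real_pos) simp
      moreover have "b + 1 - 1 / 2 = b + 1 / 2" "b + 1 - 0 = b + 1" by simp_all
      moreover have "(1 / (2 * pi)) powr b > 0" "W powr (- a) > 0" "(2 / ?S) powr (b + 1 / 2) > 0" using W S by simp_all
      moreover have "(c * w * (g1 * p)) / (c * w * (g2 * (p * s))) = g1 / (s * g2)" if "c > 0" "w > 0" "p > 0" for c w g1 g2 p s :: real
        using that by simp
      ultimately have "norming ?S W (1 / 2) / norming ?S W 0 = Gamma (b + 1 / 2) / (sqrt (2 / ?S) * Gamma (b + 1))"
        unfolding norming_def by (simp only:)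
      then show ?thesis using S by (simp add: scale_factor_def real_sqrt_divide)
    qed
    then have half: "norming ?S W (1 / 2) = scale_factor b * sqrt ?S * norming ?S W 0"
      using n0 by (simp only: divide_eq_eq)
    have cancel: "inverse (N * D) *\<^sub>R (f * s * N * X) = f * (X / D) * s" if "N > 0" for N D X f s :: real
      using that by (simp add: divide_inverse mult_ac)
    show ?thesis
      unfolding posterior_expectation_def scale one D0_def half cancel[OF n0] post_def ..
  qed
qed

section \<open>Comparison of the risks\<close>

lemma Gamma_midpoint:
  fixes x :: real
  assumes "x > 1 / 2"
  shows "(Gamma x)\<^sup>2 \<le> Gamma (x - 1 / 2) * Gamma (x + 1 / 2)"
proof -
  have G: "Gamma x > 0" "Gamma (x - 1 / 2) > 0" "Gamma (x + 1 / 2) > 0"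
    using assms by (auto intro!: Gamma_real_pos)
  have "(ln \<circ> Gamma) ((1 - 1 / 2) *\<^sub>R (x - 1 / 2) + (1 / 2) *\<^sub>R (x + 1 / 2)) \<le>
     (1 - 1 / 2) * (ln \<circ> Gamma) (x - 1 / 2) + (1 / 2) * (ln \<circ> Gamma) (x + 1 / 2)"
    by (rule convex_onD[OF log_convex_Gamma_real]) (use assms in auto)
  moreover have "(1 - 1 / 2) *\<^sub>R (x - 1 / 2) + (1 / 2) *\<^sub>R (x + 1 / 2) = x" by (simp add: field_simps)
  ultimately have "2 * ln (Gamma x) \<le> ln (Gamma (x - 1 / 2)) + ln (Gamma (x + 1 / 2))" by simp
  then have "ln ((Gamma x)\<^sup>2) \<le> ln (Gamma (x - 1 / 2) * Gamma (x + 1 / 2))"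
    using G by (simp add: ln_mult ln_realpow)
  then show ?thesis using G by simp
qed

lemma scale_factor_pos: "p > 0 \<Longrightarrow> 0 < scale_factor p"
  unfolding scale_factor_def by (intro divide_pos_pos mult_pos_pos Gamma_real_pos) auto

text \<open>
  With \<open>k = 2 p\<close> this says \<open>1 - 1 / k \<le> k c\<^sup>2 \<le> 1\<close>; since \<open>k c\<^sup>2 = (E sqrt S)\<^sup>2 / E S\<close>, the relative variance of
  \<open>sqrt S\<close> is at most \<open>1 / k\<close>.
\<close>
lemma scale_factor_square:
  assumes p: "p > 1 / 2"
  shows "2 * p * (scale_factor p)\<^sup>2 \<le> 1" and "1 - 1 / (2 * p) \<le> 2 * p * (scale_factor p)\<^sup>2"
proof -
  define X Y where "X = Gamma (p + 1 / 2)" and "Y = Gamma p"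
  have pos: "X > 0" "Y > 0" using p by (auto simp: X_def Y_def intro!: Gamma_real_pos)
  have G1: "Gamma (p + 1) = p * Y" using p unfolding Y_def by (intro Gamma_plus1) auto
  have sf: "2 * p * (scale_factor p)\<^sup>2 = X\<^sup>2 / (p * Y\<^sup>2)"
  proof -
    have "(scale_factor p)\<^sup>2 = X\<^sup>2 / (2 * (p\<^sup>2 * Y\<^sup>2))"
      unfolding scale_factor_def G1 X_def[symmetric] by (simp add: power_divide power_mult_distrib)
    then show ?thesis using p pos by (simp add: power2_eq_square)
  qed
  have "X\<^sup>2 \<le> Gamma (p + 1 / 2 - 1 / 2) * Gamma (p + 1 / 2 + 1 / 2)"
    unfolding X_def by (rule Gamma_midpoint) (use p in auto)
  also have "p + 1 / 2 - 1 / 2 = p" by simp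
  also have "p + 1 / 2 + 1 / 2 = p + 1" by simp
  finally have 1: "X\<^sup>2 \<le> p * Y\<^sup>2" unfolding G1 Y_def[symmetric] by (simp add: power2_eq_square mult_ac)
  then show "2 * p * (scale_factor p)\<^sup>2 \<le> 1" unfolding sf using p pos by (simp add: divide_le_eq)
  have "Gamma (p - 1 / 2 + 1) = (p - 1 / 2) * Gamma (p - 1 / 2)" using p by (intro Gamma_plus1) auto
  moreover have "p - 1 / 2 + 1 = p + 1 / 2" by simp
  ultimately have X: "X = (p - 1 / 2) * Gamma (p - 1 / 2)" by (simp only: X_def)
  have "(p - 1 / 2) * Y\<^sup>2 \<le> (p - 1 / 2) * (Gamma (p - 1 / 2) * X)"
    unfolding Y_def X_def using p by (intro mult_left_mono Gamma_midpoint) auto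
  also have "\<dots> = X\<^sup>2" unfolding power2_eq_square by (subst (3) X) simp
  finally have "(p - 1 / 2) * Y\<^sup>2 \<le> X\<^sup>2" .
  then have "((p - 1 / 2) * Y\<^sup>2) / (p * Y\<^sup>2) \<le> X\<^sup>2 / (p * Y\<^sup>2)" using p pos by (intro divide_right_mono) auto
  moreover have "((p - 1 / 2) * Y\<^sup>2) / (p * Y\<^sup>2) = 1 - 1 / (2 * p)" using p pos by (simp add: field_simps)
  ultimately show "1 - 1 / (2 * p) \<le> 2 * p * (scale_factor p)\<^sup>2" unfolding sf by simp
qed

text \<open>
  The first summand is the location gain, the second minus the scale loss; \<open>\<delta>\<close> is the amount by
  which the factor of \<open>sqrt S\<close> falls short of \<open>c\<close>. With \<open>\<epsilon> = \<delta> / c\<close> the loss is at most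
  \<open>\<epsilon> / k + \<epsilon>\<^sup>2 \<le> h / (2 k) + h \<eta> / 4\<close>, and the coefficients of \<open>h\<close> and \<open>h \<eta>\<close> in the gain are larger.
\<close>
lemma risk_margin_pos:
  fixes n d m k c \<delta> \<phi> h \<eta> :: real
  assumes n: "n \<ge> 4" and d: "d \<ge> 5" and m: "m = n - 1" and k: "k = d * m"
    and nd: "n / 2 + 2 < m * (d - 4)"
    and h: "0 < h" and \<eta>: "\<eta> = 1 / m - \<phi>" "0 \<le> \<eta>" "\<eta> \<le> h"
    and c: "0 < c" and kc: "k * c\<^sup>2 \<le> 1" "1 - 1 / k \<le> k * c\<^sup>2"
    and \<delta>: "0 \<le> \<delta>" "\<delta> \<le> c * (\<eta> / 2)"
  shows "0 < (1 / n) * (2 * (d - 2) * h - (k + 2) * (h * \<phi>)) + d * (k * (\<delta> * (c - \<delta>)) - \<delta> / c)"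
proof -
  have m0: "m > 0" "n > 0" and d0: "d > 0" and k0: "k > 0" using n d m k by auto
  define \<epsilon> where "\<epsilon> = \<delta> / c"
  have \<delta>e: "\<delta> = c * \<epsilon>" using c by (simp add: \<epsilon>_def)
  have e: "0 \<le> \<epsilon>" "\<epsilon> \<le> \<eta> / 2" using \<delta> c by (simp_all add: \<epsilon>_def divide_le_eq mult.commute)
  have "k * (\<delta> * (c - \<delta>)) - \<delta> / c = - (\<epsilon> * (1 - k * c\<^sup>2)) - (k * c\<^sup>2) * \<epsilon>\<^sup>2"
    unfolding \<delta>e using c by (simp add: power2_eq_square algebra_simps)
  also have "\<dots> \<ge> - (\<epsilon> * (1 / k)) - 1 * \<epsilon>\<^sup>2"
  proof -
    have "\<epsilon> * (1 - k * c\<^sup>2) \<le> \<epsilon> * (1 / k)" using e kc by (intro mult_left_mono) auto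
    moreover have "(k * c\<^sup>2) * \<epsilon>\<^sup>2 \<le> 1 * \<epsilon>\<^sup>2" using kc by (intro mult_right_mono) auto
    ultimately show ?thesis by linarith
  qed
  also have "- (\<epsilon> * (1 / k)) - 1 * \<epsilon>\<^sup>2 \<ge> - (h / 2 / k) - h * \<eta> / 4"
  proof -
    have "\<epsilon> * (1 / k) \<le> h / 2 * (1 / k)" using e \<eta> k0 by (intro mult_right_mono) auto
    moreover have "\<epsilon>\<^sup>2 \<le> (\<eta> / 2)\<^sup>2" using e by (intro power_mono) auto
    moreover have "(\<eta> / 2)\<^sup>2 \<le> h * \<eta> / 4"
      using mult_right_mono[OF \<eta>(3) \<eta>(2)] by (simp add: power2_eq_square)
    ultimately show ?thesis by simp
  qed
  finally have 1: "- (h / 2 / k) - h * \<eta> / 4 \<le> k * (\<delta> * (c - \<delta>)) - \<delta> / c" .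
  have "0 < h * ((m * (d - 4) - 2 - n / 2) / (n * m) + \<eta> * ((k + 2) / n - d / 4))"
  proof (intro mult_pos_pos add_pos_nonneg)
    show "0 < (m * (d - 4) - 2 - n / 2) / (n * m)" using nd m0 by simp
    have "d * n / 4 \<le> k + 2"
    proof -
      have "d * (n / 4) \<le> d * (n - 1)" using n d by (intro mult_left_mono) auto
      then show ?thesis using k m by simp
    qed
    then show "0 \<le> \<eta> * ((k + 2) / n - d / 4)" using \<eta>(2) m0 by (intro mult_nonneg_nonneg) (simp_all add: field_simps)
  qed (rule h)
  also have "h * ((m * (d - 4) - 2 - n / 2) / (n * m) + \<eta> * ((k + 2) / n - d / 4)) =
      (1 / n) * (2 * (d - 2) * h - (k + 2) * (h * \<phi>)) + d * (- (h / 2 / k) - h * \<eta> / 4)"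
  proof -
    have \<phi>: "\<phi> = 1 / m - \<eta>" using \<eta>(1) by simp
    show ?thesis unfolding \<phi> k using m0 d0 by (simp add: field_simps)
  qed
  also have "\<dots> \<le> (1 / n) * (2 * (d - 2) * h - (k + 2) * (h * \<phi>)) + d * (k * (\<delta> * (c - \<delta>)) - \<delta> / c)"
    using 1 d0 by (intro add_left_mono mult_left_mono) auto
  finally show ?thesis .
qed

lemma sample_size_conditions:
  fixes n d :: nat
  assumes "(int n - 3) * (int d - 4) \<ge> 8" "n > 0" "d > 0"
  shows "n \<ge> 4" "d \<ge> 5" "real n / 2 + 2 < (real n - 1) * (real d - 4)"
proof -
  have n4: "n \<ge> 4"
  proof (rule ccontr)
    assume "\<not> n \<ge> 4"
    then have "n = 1 \<or> n = 2 \<or> n = 3" using assms by auto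
    then show False using assms by auto
  qed
  have d5: "d \<ge> 5"
  proof (rule ccontr)
    assume "\<not> d \<ge> 5"
    then have "(int n - 3) * (int d - 4) \<le> 0" using n4 by (intro mult_nonneg_nonpos) auto
    then show False using assms by simp
  qed
  show "n \<ge> 4" "d \<ge> 5" by fact+
  show "real n / 2 + 2 < (real n - 1) * (real d - 4)"
  proof (cases "d = 5")
    case True
    then have "n \<ge> 11" using assms by simp
    then have "real n \<ge> 11" by simp
    then show ?thesis using True by simp
  next
    case False
    then have d2: "real d - 4 \<ge> 2" using d5 by simp
    define z where "z = (real n - 1) * (real d - 4)"
    have "(real n - 1) * 2 \<le> z" unfolding z_def using n4 d2 by (intro mult_left_mono) auto
    moreover have "real n \<ge> 4" using n4 by simp
    ultimately show ?thesis unfolding z_def[symmetric] by (simp add: field_simps)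
  qed
qed

lemma integrable_sample_quadratic:
  fixes g :: "(real ^ 'd) ^ 'n \<Rightarrow> real"
  assumes \<sigma>: "\<sigma> > 0" and [measurable]: "g \<in> borel_measurable borel"
    and g: "\<And>x. \<bar>g x\<bar> \<le> K * (1 + (real CARD('n) * (norm (sample_mean x - \<mu>))\<^sup>2 + rss x))"
  shows "integrable lborel (\<lambda>x. sample_density \<mu> \<sigma> x * g x)"
proof (rule Bochner_Integration.integrable_bound)
  let ?m = "(\<chi> i. \<mu>) :: (real ^ 'd) ^ 'n"
  show "integrable lborel (\<lambda>x. K * (sample_density \<mu> \<sigma> x + (norm (x - ?m))\<^sup>2 * sample_density \<mu> \<sigma> x))"
    unfolding sample_density_gaussian using \<sigma>
    by (intro integrable_mult_right Bochner_Integration.integrable_add integrable_gaussian integrable_gaussian_second_moment)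
  show "AE x in lborel. norm (sample_density \<mu> \<sigma> x * g x) \<le> norm (K * (sample_density \<mu> \<sigma> x + (norm (x - ?m))\<^sup>2 * sample_density \<mu> \<sigma> x))"
  proof (rule AE_I2)
    fix x :: "(real ^ 'd) ^ 'n"
    have eq: "real CARD('n) * (norm (sample_mean x - \<mu>))\<^sup>2 + rss x = (norm (x - ?m))\<^sup>2"
      unfolding sum_square_deviation[symmetric] by (simp add: power2_norm_eq_inner inner_vec_def)
    have "norm (sample_density \<mu> \<sigma> x * g x) = sample_density \<mu> \<sigma> x * \<bar>g x\<bar>" by (simp add: abs_mult)
    also have "\<dots> \<le> sample_density \<mu> \<sigma> x * (K * (1 + (norm (x - ?m))\<^sup>2))"
      using g[of x] unfolding eq by (intro mult_left_mono) auto
    also have "\<dots> = K * (sample_density \<mu> \<sigma> x + (norm (x - ?m))\<^sup>2 * sample_density \<mu> \<sigma> x)"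
      by (simp only: distrib_left distrib_right mult_1_right mult_ac)
    also have "\<dots> \<le> norm \<dots>" by simp
    finally show "norm (sample_density \<mu> \<sigma> x * g x) \<le> norm (K * (sample_density \<mu> \<sigma> x + (norm (x - ?m))\<^sup>2 * sample_density \<mu> \<sigma> x))" .
  qed
qed measurable

text \<open>
  An equivariant \<open>s\<close> may be negative; the plug-in density then uses \<open>|s|\<close>, which is equivariant too.
\<close>
lemma W2_risk_plug_in_ge:
  fixes m :: "(real ^ 'd) ^ 'n \<Rightarrow> real ^ 'd"
  assumes n: "CARD('n) \<ge> 2" and m: "equivariant_mean m" and s: "equivariant_scale s" and \<sigma>: "\<sigma> > 0"
  defines "p \<equiv> real (CARD('d) * (CARD('n) - 1)) / 2"
  shows "(\<integral>\<^sup>+x. ennreal (sample_density \<mu> \<sigma> x * ((norm (sample_mean x - \<mu>))\<^sup>2 +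
      real CARD('d) * (scale_factor p * sqrt (rss x) - \<sigma>)\<^sup>2)) \<partial>(lborel :: ((real ^ 'd) ^ 'n) measure)) \<le> W2_risk \<mu> \<sigma> (plug_in m s)"
proof -
  have split: "(\<integral>\<^sup>+x. ennreal (sample_density \<mu> \<sigma> x * ((norm (u x - \<mu>))\<^sup>2 + real CARD('d) * (v x - \<sigma>)\<^sup>2)) \<partial>lborel) =
      mean_risk \<mu> \<sigma> u + ennreal (real CARD('d)) * scale_risk \<mu> \<sigma> v"
    if [measurable]: "u \<in> borel_measurable borel" "v \<in> borel_measurable borel"
    for u :: "(real ^ 'd) ^ 'n \<Rightarrow> real ^ 'd" and v
  proof -
    have "(\<integral>\<^sup>+x. ennreal (sample_density \<mu> \<sigma> x * ((norm (u x - \<mu>))\<^sup>2 + real CARD('d) * (v x - \<sigma>)\<^sup>2)) \<partial>lborel) =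
      (\<integral>\<^sup>+x. ennreal ((norm (u x - \<mu>))\<^sup>2) * ennreal (sample_density \<mu> \<sigma> x) +
        ennreal (real CARD('d)) * (ennreal ((v x - \<sigma>)\<^sup>2) * ennreal (sample_density \<mu> \<sigma> x)) \<partial>lborel)"
      by (intro nn_integral_cong) (simp add: ennreal_mult[symmetric] ennreal_plus[symmetric] algebra_simps del: ennreal_plus)
    also have "\<dots> = mean_risk \<mu> \<sigma> u + ennreal (real CARD('d)) * scale_risk \<mu> \<sigma> v"
      unfolding mean_risk_def scale_risk_def by (subst nn_integral_add) (simp_all add: nn_integral_cmult)
    finally show ?thesis .
  qed
  have [measurable]: "m \<in> borel_measurable borel" "s \<in> borel_measurable borel"
    using m s by (simp_all add: equivariant_mean_def equivariant_scale_def)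
  have s': "equivariant_scale (\<lambda>x. \<bar>s x\<bar>)"
    using s by (auto simp: equivariant_scale_def abs_mult)
  have "(\<integral>\<^sup>+x. ennreal (sample_density \<mu> \<sigma> x * ((norm (sample_mean x - \<mu>))\<^sup>2 +
      real CARD('d) * (scale_factor p * sqrt (rss x) - \<sigma>)\<^sup>2)) \<partial>(lborel :: ((real ^ 'd) ^ 'n) measure)) =
    mean_risk \<mu> \<sigma> (sample_mean :: (real ^ 'd) ^ 'n \<Rightarrow> _) + ennreal (real CARD('d)) * scale_risk \<mu> \<sigma> (\<lambda>x :: (real ^ 'd) ^ 'n. scale_factor p * sqrt (rss x))"
    by (rule split) simp_all
  also have "\<dots> \<le> mean_risk \<mu> \<sigma> m + ennreal (real CARD('d)) * scale_risk \<mu> \<sigma> (\<lambda>x. \<bar>s x\<bar>)"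
    unfolding p_def by (intro add_mono mult_left_mono mean_risk_minimal scale_risk_minimal m s' n \<sigma>) simp
  also have "\<dots> = (\<integral>\<^sup>+x. ennreal (sample_density \<mu> \<sigma> x * ((norm (m x - \<mu>))\<^sup>2 + real CARD('d) * (\<bar>s x\<bar> - \<sigma>)\<^sup>2)) \<partial>lborel)"
    by (rule split[symmetric]) simp_all
  also have "\<dots> \<le> W2_risk \<mu> \<sigma> (plug_in m s)"
    unfolding W2_risk_def
  proof (rule nn_integral_mono)
    fix x :: "(real ^ 'd) ^ 'n"
    have "ennreal (sample_density \<mu> \<sigma> x * ((norm (m x - \<mu>))\<^sup>2 + real CARD('d) * (\<bar>s x\<bar> - \<sigma>)\<^sup>2)) =
      ennreal ((norm (m x - \<mu>))\<^sup>2 + real CARD('d) * (\<bar>s x\<bar> - \<sigma>)\<^sup>2) * ennreal (sample_density \<mu> \<sigma> x)"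
      by (subst ennreal_mult[symmetric]) (simp_all add: mult.commute)
    also have "\<dots> \<le> W2_loss \<mu> \<sigma> (plug_in m s x) * ennreal (sample_density \<mu> \<sigma> x)"
      unfolding plug_in_def by (intro mult_right_mono W2_loss_ge \<sigma>) simp
    finally show "ennreal (sample_density \<mu> \<sigma> x * ((norm (m x - \<mu>))\<^sup>2 + real CARD('d) * (\<bar>s x\<bar> - \<sigma>)\<^sup>2)) \<le>
       W2_loss \<mu> \<sigma> (plug_in m s x) * ennreal (sample_density \<mu> \<sigma> x)" .
  qed
  finally show ?thesis .
qed

text \<open>
  The dilation inequalities are used three times: for \<open>h\<close> under dilations of the mean, where
  \<open>W h = \<phi>\<close> is increasing; for \<open>G1 = W h\<^sup>2\<close> under dilations of the residuals, where \<open>\<phi>\<^sup>2\<close> is increasing in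
  \<open>W\<close>; and for \<open>G2 = \<delta> (c - \<delta>)\<close>, which decreases in \<open>W\<close> because \<open>\<delta>\<close> does and \<open>\<delta> \<le> c / 2\<close>.
\<close>
lemma bayes_estimator_improves:
  fixes \<mu> :: "real ^ 'd" and \<sigma> :: real
  assumes n4: "CARD('n) \<ge> 4" and d5: "CARD('d) \<ge> 5"
    and nd: "real CARD('n) / 2 + 2 < (real CARD('n) - 1) * (real CARD('d) - 4)" and \<sigma>: "\<sigma> > 0"
  defines "p \<equiv> real (CARD('d) * (CARD('n) - 1)) / 2"
  shows "W2_risk \<mu> \<sigma> (bayes_predictive hierarchical_prior :: (real ^ 'd) ^ 'n \<Rightarrow> real ^ 'd \<Rightarrow> real) <
     (\<integral>\<^sup>+x. ennreal (sample_density \<mu> \<sigma> x * ((norm (sample_mean x - \<mu>))\<^sup>2 +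
      real CARD('d) * (scale_factor p * sqrt (rss x) - \<sigma>)\<^sup>2)) \<partial>(lborel :: ((real ^ 'd) ^ 'n) measure))"
proof -
  define n d where "n = real CARD('n)" and "d = real CARD('d)"
  define a m where "a = d / 2" and "m = n - 1"
  have n: "n \<ge> 4" and d: "d \<ge> 5" using n4 d5 by (simp_all add: n_def d_def)
  have m0: "m > 0" and a0: "a > 0" using n d by (simp_all add: m_def a_def)
  interpret shrinkage_posterior a m by unfold_locales (fact a0, fact m0)
  define k where "k = d * m"
  have k0: "k > 0" using d m0 by (simp add: k_def)
  have card_k: "real (CARD('d) * (CARD('n) - 1)) = k"
    using n4 by (simp add: k_def d_def m_def n_def of_nat_diff)
  have p: "p = k / 2" "p = a * m" unfolding p_def card_k by (simp_all add: k_def a_def)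
  have k15: "k \<ge> 15"
  proof -
    have "5 * 3 \<le> d * m" using d n by (intro mult_mono) (auto simp: m_def)
    then show ?thesis by (simp add: k_def)
  qed
  have n2: "CARD('n) \<ge> 2" using n4 by simp
  define c C where "c = scale_factor p" and "C = scale_factor b"
  have "p > 0" "b > 0" using p k0 a0 m0 by auto
  then have c: "c > 0" and C: "C > 0" by (auto simp: c_def C_def intro: scale_factor_pos)
  have kc: "k * c\<^sup>2 \<le> 1" "1 - 1 / k \<le> k * c\<^sup>2"
  proof -
    have "p > 1 / 2" "2 * p = k" using k15 p by auto
    then show "k * c\<^sup>2 \<le> 1" "1 - 1 / k \<le> k * c\<^sup>2" using scale_factor_square[of p] by (simp_all add: c_def)
  qed
  have am: "a + m + 1 \<le> a * m"
  proof -
    have "2 * 3 \<le> (n - 2) * (d - 2)" using n d by (intro mult_mono) auto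
    then show ?thesis unfolding a_def m_def by (simp add: field_simps)
  qed
  define \<phi> r where "\<phi> w = post w (\<lambda>u. u)" and "r w = post w (\<lambda>u. sqrt (1 + u))" for w
  have [measurable]: "\<phi> \<in> borel_measurable borel" "r \<in> borel_measurable borel"
    unfolding \<phi>_def r_def by measurable
  have \<phi>: "0 < \<phi> w" "\<phi> w \<le> w" "\<phi> w \<le> 1 / m" "1 / m - \<phi> w \<le> \<phi> w / w" if "w > 0" for w
    unfolding \<phi>_def using that post_id_pos post_id_le post_id_le_limit post_id_deficit am by auto
  have \<phi>_mono: "\<phi> v \<le> \<phi> w" if "0 < v" "v \<le> w" for v w
    unfolding \<phi>_def by (rule post_mono[where C = 1]) (use that in auto)
  have r: "1 \<le> r w" "C * r w \<le> c" "c - C * r w \<le> C * ((1 / m - \<phi> w) / 2)" if "w > 0" for w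
  proof -
    show "1 \<le> r w" unfolding r_def by (rule post_sqrt_ge_1[OF that])
    have "r w \<le> c / C" using post_sqrt_le_limit[OF that] by (simp add: r_def c_def C_def p(2))
    then show "C * r w \<le> c" using C by (simp add: pos_le_divide_eq mult.commute)
    have "c / C - r w \<le> (1 / m - \<phi> w) / 2" using post_sqrt_deficit[OF that] by (simp add: r_def \<phi>_def c_def C_def p(2))
    then have "C * (c / C - r w) \<le> C * ((1 / m - \<phi> w) / 2)" using C by (intro mult_left_mono) auto
    moreover have "C * (c / C - r w) = c - C * r w" using C by (simp add: right_diff_distrib)
    ultimately show "c - C * r w \<le> C * ((1 / m - \<phi> w) / 2)" by simp
  qed
  have r_mono: "r v \<le> r w" if "0 < v" "v \<le> w" for v w
    unfolding r_def by (rule post_mono[where C = 1]) (use that sqrt_le_linear in auto)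
  have Cc: "C \<le> c"
  proof -
    have "C * 1 \<le> C * r 1" using r(1)[of 1] C by (intro mult_left_mono) auto
    then show ?thesis using r(2)[of 1] by simp
  qed

  \<comment> \<open>On the null set where \<open>W\<close> vanishes, \<open>h\<close> and \<open>\<delta>\<close> are set to 0, which the dilations respect.\<close>
  define W where "W x = n * (norm (sample_mean x))\<^sup>2 / rss x" for x :: "(real ^ 'd) ^ 'n"
  define h where "h x = (if W x > 0 then \<phi> (W x) / W x else 0)" for x :: "(real ^ 'd) ^ 'n"
  define \<delta> where "\<delta> x = (if W x > 0 then c - C * r (W x) else 0)" for x :: "(real ^ 'd) ^ 'n"
  define G1 where "G1 x = h x * \<phi> (W x)" for x :: "(real ^ 'd) ^ 'n"
  define G2 where "G2 x = \<delta> x * (c - \<delta> x)" for x :: "(real ^ 'd) ^ 'n"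
  have W_meas [measurable]: "W \<in> borel_measurable borel" unfolding W_def by measurable
  have [measurable]: "h \<in> borel_measurable borel" "\<delta> \<in> borel_measurable borel" unfolding h_def \<delta>_def by measurable
  have [measurable]: "G1 \<in> borel_measurable borel" "G2 \<in> borel_measurable borel" unfolding G1_def G2_def by measurable
  have W_nonneg: "0 \<le> W x" for x using n by (simp add: W_def)
  have h: "0 \<le> h x" "h x \<le> 1" for x
    using \<phi>[of "W x"] by (auto simp: h_def divide_le_eq)
  have \<delta>: "0 \<le> \<delta> x" "\<delta> x \<le> c / 2" for x
  proof -
    show "0 \<le> \<delta> x" using r(2)[of "W x"] by (auto simp: \<delta>_def)
    show "\<delta> x \<le> c / 2"
    proof (cases "W x > 0")
      case True
      have "1 / m \<le> 1" using n by (simp add: m_def)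
      then have "(1 / m - \<phi> (W x)) / 2 \<le> 1 / 2" using \<phi>(1)[OF True] by simp
      then have "C * ((1 / m - \<phi> (W x)) / 2) \<le> C * (1 / 2)" using C by (intro mult_left_mono) auto
      also have "\<dots> \<le> c * (1 / 2)" using Cc by simp
      finally show ?thesis using r(3)[OF True] True by (simp add: \<delta>_def)
    qed (use c in \<open>simp add: \<delta>_def\<close>)
  qed
  have G1: "0 \<le> G1 x" "G1 x \<le> 1 / m" for x
  proof -
    show "0 \<le> G1 x" using \<phi>(1)[of "W x"] by (auto simp: G1_def h_def)
    show "G1 x \<le> 1 / m"
    proof (cases "W x > 0")
      case True
      have "h x * \<phi> (W x) \<le> 1 * (1 / m)" using h[of x] \<phi>[OF True] by (intro mult_mono) auto
      then show ?thesis by (simp add: G1_def)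
    qed (use m0 in \<open>simp add: G1_def h_def\<close>)
  qed
  have G2: "0 \<le> G2 x" "G2 x \<le> c * c" for x
  proof -
    have *: "0 \<le> c - \<delta> x" "c - \<delta> x \<le> c" "\<delta> x \<le> c" using \<delta>[of x] c by auto
    show "0 \<le> G2 x" unfolding G2_def using * \<delta> by (intro mult_nonneg_nonneg) auto
    show "G2 x \<le> c * c" unfolding G2_def using * \<delta>[of x] c by (intro mult_mono) auto
  qed
  have W_mean: "W (dilate_mean t x) = t\<^sup>2 * W x" for t x
    by (simp add: W_def power_mult_distrib)
  have W_res: "W (dilate_residuals t x) = W x / t\<^sup>2" for t x
    by (simp add: W_def)

  let ?f = "sample_density \<mu> \<sigma> :: (real ^ 'd) ^ 'n \<Rightarrow> real"
  define A where "A x = n * (sample_mean x \<bullet> (sample_mean x - \<mu>)) / \<sigma>\<^sup>2" for x :: "(real ^ 'd) ^ 'n"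
  define B where "B x = n * (norm (sample_mean x))\<^sup>2 / (2 * \<sigma>\<^sup>2)" for x :: "(real ^ 'd) ^ 'n"
  define S where "S x = rss x / \<sigma>\<^sup>2" for x :: "(real ^ 'd) ^ 'n"
  have [measurable]: "A \<in> borel_measurable borel" "B \<in> borel_measurable borel" "S \<in> borel_measurable borel"
    unfolding A_def B_def S_def by measurable
  have f_mean: "?f (dilate_mean t x) = ?f x * exp (- ((t - 1) * A x + (t - 1)\<^sup>2 * B x))" for t x
  proof -
    let ?y = "sample_mean x"
    have expand: "(norm (u + s *\<^sub>R v))\<^sup>2 = (norm u)\<^sup>2 + 2 * s * (v \<bullet> u) + s\<^sup>2 * (norm v)\<^sup>2" for u v :: "real ^ 'd" and s
      unfolding power2_norm_eq_inner by (simp add: inner_add_left inner_add_right inner_commute algebra_simps power2_eq_square)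
    have "t *\<^sub>R ?y - \<mu> = (?y - \<mu>) + (t - 1) *\<^sub>R ?y" by (simp add: algebra_simps)
    then have "(norm (t *\<^sub>R ?y - \<mu>))\<^sup>2 = (norm (?y - \<mu>))\<^sup>2 + 2 * (t - 1) * (?y \<bullet> (?y - \<mu>)) + (t - 1)\<^sup>2 * (norm ?y)\<^sup>2"
      by (simp only: expand)
    moreover have "- (n * (N + 2 * s * I + q * M) + R) / (2 * \<sigma>\<^sup>2) = - (n * N + R) / (2 * \<sigma>\<^sup>2) + - (s * (n * I / \<sigma>\<^sup>2) + q * (n * M / (2 * \<sigma>\<^sup>2)))" for N s I q M R
      using \<sigma> by (simp add: field_simps)
    ultimately have "- (n * (norm (t *\<^sub>R ?y - \<mu>))\<^sup>2 + rss x) / (2 * \<sigma>\<^sup>2) = - (n * (norm (?y - \<mu>))\<^sup>2 + rss x) / (2 * \<sigma>\<^sup>2) + - ((t - 1) * A x + (t - 1)\<^sup>2 * B x)"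
      by (simp only: A_def B_def)
    then show ?thesis
      unfolding sample_density_mean_rss sample_mean_dilate_mean rss_dilate_mean n_def[symmetric]
      by (simp only: exp_add mult.assoc)
  qed
  have f_res: "?f (dilate_residuals t x) = ?f x * exp (- ((t - 1) * S x + (t - 1)\<^sup>2 * (S x / 2)))" for t x
  proof -
    have "- (N + t\<^sup>2 * R) / (2 * \<sigma>\<^sup>2) = - (N + R) / (2 * \<sigma>\<^sup>2) + - ((t - 1) * (R / \<sigma>\<^sup>2) + (t - 1)\<^sup>2 * (R / \<sigma>\<^sup>2 / 2))" for N R
      using \<sigma> by (simp add: field_simps power2_eq_square)
    then show ?thesis
      unfolding sample_density_mean_rss sample_mean_dilate_residuals rss_dilate_residuals S_def
      by (simp only: exp_add mult.assoc)
  qed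

  \<comment> \<open>All integrands below are a bounded function times one of 1, \<open>A\<close>, \<open>B\<close>, \<open>S\<close>, hence of at most
    quadratic growth.\<close>
  let ?Q = "\<lambda>x. n * (norm (sample_mean x - \<mu>))\<^sup>2 + rss (x :: (real ^ 'd) ^ 'n)"
  have int: "integrable lborel (\<lambda>x. ?f x * (g x * v x))"
    if [measurable]: "g \<in> borel_measurable borel" "v \<in> borel_measurable borel"
      and g: "\<And>x. 0 \<le> g x \<and> g x \<le> L" and v: "\<And>x. \<bar>v x\<bar> \<le> K * (1 + ?Q x)" for g v L K
  proof (rule integrable_sample_quadratic[where K = "L * K", OF \<sigma>])
    fix x :: "(real ^ 'd) ^ 'n"
    have "0 \<le> L" using g[of x] by linarith
    have "\<bar>g x * v x\<bar> = g x * \<bar>v x\<bar>" using g[of x] by (simp add: abs_mult)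
    also have "\<dots> \<le> L * (K * (1 + ?Q x))" using g[of x] v[of x] \<open>0 \<le> L\<close> by (intro mult_mono) auto
    finally show "\<bar>g x * v x\<bar> \<le> L * K * (1 + (real CARD('n) * (norm (sample_mean x - \<mu>))\<^sup>2 + rss x))"
      by (simp add: n_def mult.assoc)
  qed simp
  have Q0: "0 \<le> ?Q x" for x using n by simp
  have mean_sq: "(norm (sample_mean x))\<^sup>2 \<le> 2 * (1 + (norm \<mu>)\<^sup>2) * (1 + ?Q x)" for x :: "(real ^ 'd) ^ 'n"
  proof -
    have "norm (sample_mean x) \<le> norm (sample_mean x - \<mu>) + norm \<mu>" using norm_triangle_sub[of "sample_mean x" \<mu>] by simp
    then have "(norm (sample_mean x))\<^sup>2 \<le> (norm (sample_mean x - \<mu>) + norm \<mu>)\<^sup>2" by (intro power_mono) auto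
    also have "\<dots> \<le> 2 * (norm (sample_mean x - \<mu>))\<^sup>2 + 2 * (norm \<mu>)\<^sup>2"
      using sum_squares_bound[of "norm (sample_mean x - \<mu>)" "norm \<mu>"] by (simp add: power2_sum)
    also have "(norm (sample_mean x - \<mu>))\<^sup>2 \<le> ?Q x"
    proof -
      have "1 * (norm (sample_mean x - \<mu>))\<^sup>2 \<le> n * (norm (sample_mean x - \<mu>))\<^sup>2" using n by (intro mult_right_mono) auto
      then show ?thesis using rss_nonneg[of x] unfolding mult_1_left by linarith
    qed
    also have "2 * ?Q x + 2 * (norm \<mu>)\<^sup>2 \<le> 2 * (1 + (norm \<mu>)\<^sup>2) * (1 + ?Q x)"
    proof -
      have "0 \<le> (norm \<mu>)\<^sup>2 * ?Q x" using Q0 by simp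
      then show ?thesis by (simp add: algebra_simps)
    qed
    finally show ?thesis by simp
  qed
  have inner_bd: "\<bar>sample_mean x \<bullet> (sample_mean x - \<mu>)\<bar> \<le> (2 * (1 + (norm \<mu>)\<^sup>2) + 1) * (1 + ?Q x)" for x :: "(real ^ 'd) ^ 'n"
  proof -
    have "\<bar>sample_mean x \<bullet> (sample_mean x - \<mu>)\<bar> \<le> norm (sample_mean x) * norm (sample_mean x - \<mu>)" by (rule Cauchy_Schwarz_ineq2)
    also have "\<dots> \<le> (norm (sample_mean x))\<^sup>2 + (norm (sample_mean x - \<mu>))\<^sup>2"
    proof -
      have "2 * norm (sample_mean x) * norm (sample_mean x - \<mu>) \<le> (norm (sample_mean x))\<^sup>2 + (norm (sample_mean x - \<mu>))\<^sup>2"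
        by (rule sum_squares_bound)
      moreover have "0 \<le> norm (sample_mean x) * norm (sample_mean x - \<mu>)" by simp
      ultimately show ?thesis by linarith
    qed
    also have "\<dots> \<le> 2 * (1 + (norm \<mu>)\<^sup>2) * (1 + ?Q x) + 1 * (1 + ?Q x)"
    proof (intro add_mono mean_sq)
      have "1 * (norm (sample_mean x - \<mu>))\<^sup>2 \<le> n * (norm (sample_mean x - \<mu>))\<^sup>2" using n by (intro mult_right_mono) auto
      then show "(norm (sample_mean x - \<mu>))\<^sup>2 \<le> 1 * (1 + ?Q x)" using rss_nonneg[of x] unfolding mult_1_left by linarith
    qed
    finally show ?thesis by (simp only: distrib_right)
  qed
  have bound1: "\<bar>1\<bar> \<le> 1 * (1 + ?Q x)" for x using Q0[of x] by simp
  have boundA: "\<bar>A x\<bar> \<le> (n / \<sigma>\<^sup>2 * (2 * (1 + (norm \<mu>)\<^sup>2) + 1)) * (1 + ?Q x)" for x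
  proof -
    have "\<bar>A x\<bar> = n / \<sigma>\<^sup>2 * \<bar>sample_mean x \<bullet> (sample_mean x - \<mu>)\<bar>" using n by (simp add: A_def abs_mult)
    also have "\<dots> \<le> n / \<sigma>\<^sup>2 * ((2 * (1 + (norm \<mu>)\<^sup>2) + 1) * (1 + ?Q x))" using n by (intro mult_left_mono inner_bd) auto
    finally show ?thesis by (simp only: mult.assoc)
  qed
  have boundB: "\<bar>B x\<bar> \<le> (n / (2 * \<sigma>\<^sup>2) * (2 * (1 + (norm \<mu>)\<^sup>2))) * (1 + ?Q x)" for x
  proof -
    have "\<bar>B x\<bar> = n / (2 * \<sigma>\<^sup>2) * (norm (sample_mean x))\<^sup>2" using n by (simp add: B_def)
    also have "\<dots> \<le> n / (2 * \<sigma>\<^sup>2) * (2 * (1 + (norm \<mu>)\<^sup>2) * (1 + ?Q x))" using n by (intro mult_left_mono mean_sq) auto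
    finally show ?thesis by (simp only: mult.assoc)
  qed
  have boundS: "\<bar>S x\<bar> \<le> (1 / \<sigma>\<^sup>2) * (1 + ?Q x)" for x
  proof -
    have "\<bar>S x\<bar> = (1 / \<sigma>\<^sup>2) * rss x" by (simp add: S_def)
    also have "\<dots> \<le> (1 / \<sigma>\<^sup>2) * (1 + ?Q x)" using n by (intro mult_left_mono) auto
    finally show ?thesis .
  qed
  have boundS2: "\<bar>S x / 2\<bar> \<le> (1 / \<sigma>\<^sup>2) * (1 + ?Q x)" for x
  proof -
    have "\<bar>S x / 2\<bar> \<le> \<bar>S x\<bar>" by simp
    then show ?thesis using boundS[of x] by (rule order_trans)
  qed
  have int1: "integrable lborel (\<lambda>x. ?f x * g x)"
    if "g \<in> borel_measurable borel" "\<And>x. 0 \<le> g x \<and> g x \<le> L" for g L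
    using int[of g "\<lambda>_. 1" L 1] that bound1 by (simp only: mult_1_right) simp
  have ih: "integrable lborel (\<lambda>x. ?f x * h x)" "integrable lborel (\<lambda>x. ?f x * (h x * A x))" "integrable lborel (\<lambda>x. ?f x * (h x * B x))"
    by (rule int1[where L = 1] int[OF _ _ _ boundA, where L = 1] int[OF _ _ _ boundB, where L = 1]; use h in simp)+
  have i1: "integrable lborel (\<lambda>x. ?f x * G1 x)" "integrable lborel (\<lambda>x. ?f x * (G1 x * S x))" "integrable lborel (\<lambda>x. ?f x * (G1 x * (S x / 2)))"
    by (rule int1[where L = "1 / m"] int[OF _ _ _ boundS, where L = "1 / m"] int[OF _ _ _ boundS2, where L = "1 / m"]; use G1 in simp)+
  have i2: "integrable lborel (\<lambda>x. ?f x * G2 x)" "integrable lborel (\<lambda>x. ?f x * (G2 x * S x))" "integrable lborel (\<lambda>x. ?f x * (G2 x * (S x / 2)))"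
    by (rule int1[where L = "c * c"] int[OF _ _ _ boundS, where L = "c * c"] int[OF _ _ _ boundS2, where L = "c * c"]; use G2 in simp)+
  have i\<delta>: "integrable lborel (\<lambda>x. ?f x * \<delta> x)"
    by (rule int1[where L = "c / 2"]) (use \<delta> in simp_all)

  define Ih IA I1 I1S I2 I2S I\<delta> where "Ih = (\<integral>x. ?f x * h x \<partial>lborel)" and "IA = (\<integral>x. ?f x * (h x * A x) \<partial>lborel)"
    and "I1 = (\<integral>x. ?f x * G1 x \<partial>lborel)" and "I1S = (\<integral>x. ?f x * (G1 x * S x) \<partial>lborel)"
    and "I2 = (\<integral>x. ?f x * G2 x \<partial>lborel)" and "I2S = (\<integral>x. ?f x * (G2 x * S x) \<partial>lborel)"
    and "I\<delta> = (\<integral>x. ?f x * \<delta> x \<partial>lborel)"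

  interpret dil_mean: dilation_family dilate_mean "CARD('d)" ?f A B
  proof
    show "ennreal (t ^ CARD('d)) * (\<integral>\<^sup>+x. g (dilate_mean t x) \<partial>lborel) = (\<integral>\<^sup>+x. g x \<partial>lborel)"
      if "t > 0" "g \<in> borel_measurable borel" for t and g :: "(real ^ 'd) ^ 'n \<Rightarrow> ennreal"
      using nn_integral_dilate_mean[OF that(2), of t] that(1) by simp
  qed (simp_all only: f_mean sample_density_nonneg dilate_mean_measurable sample_density_measurable)
  interpret dil_res: dilation_family dilate_residuals "CARD('d) * (CARD('n) - 1)" ?f S "\<lambda>x. S x / 2"
    by unfold_locales (simp_all add: nn_integral_dilate_residuals f_res del: One_nat_def)

  \<comment> \<open>Stein's inequality: \<open>A\<close> is the radial score in the sample mean, and the growth exponent is \<open>-2\<close>.\<close>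
  have stein: "(d - 2) * Ih \<le> IA"
  proof -
    have "(real CARD('d) + (- 2)) * (\<integral>x. ?f x * h x \<partial>lborel) \<le> (\<integral>x. ?f x * h x * A x \<partial>lborel)"
    proof (rule dil_mean.dilation_inequality_up)
      fix t :: real and x :: "(real ^ 'd) ^ 'n" assume t: "t > 1"
      show "t powr - 2 * h x \<le> h (dilate_mean t x)"
      proof (cases "W x > 0")
        case True
        have "1 \<le> t\<^sup>2" using t by simp
        then have "W x \<le> t\<^sup>2 * W x" using True by simp
        then have "\<phi> (W x) / (t\<^sup>2 * W x) \<le> \<phi> (t\<^sup>2 * W x) / (t\<^sup>2 * W x)"
          using \<phi>_mono[OF True] True t by (intro divide_right_mono) auto
        moreover have "t powr - 2 = 1 / t\<^sup>2" using t by (simp add: powr_minus_divide)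
        ultimately show ?thesis using True t by (simp add: h_def W_mean)
      next
        case False
        then have "W x = 0" using W_nonneg[of x] by simp
        then show ?thesis by (simp add: h_def W_mean)
      qed
    qed (use h ih d5 in \<open>auto simp: mult.assoc\<close>)
    then show ?thesis by (simp add: Ih_def IA_def d_def mult.assoc)
  qed
  \<comment> \<open>\<open>S\<close> is the radial score in the residuals; \<open>G1 = \<phi>\<^sup>2 / W\<close> grows at most like \<open>t\<^sup>2\<close>.\<close>
  have chi1: "I1S \<le> (k + 2) * I1"
  proof -
    have "(\<integral>x. ?f x * G1 x * S x \<partial>lborel) \<le> (real (CARD('d) * (CARD('n) - 1)) + 2) * (\<integral>x. ?f x * G1 x \<partial>lborel)"
    proof (rule dil_res.dilation_inequality_down)
      fix t :: real and x :: "(real ^ 'd) ^ 'n" assume t: "0 < t" "t < 1"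
      show "t powr 2 * G1 x \<le> G1 (dilate_residuals t x)"
      proof (cases "W x > 0")
        case True
        have t2: "0 < t\<^sup>2" "t\<^sup>2 \<le> 1" using t by (auto simp: power_le_one)
        then have "W x \<le> W x / t\<^sup>2" using True by (simp add: pos_le_divide_eq mult_left_le)
        then have "\<phi> (W x) \<le> \<phi> (W x / t\<^sup>2)" using \<phi>_mono True by simp
        then have "\<phi> (W x) * \<phi> (W x) \<le> \<phi> (W x / t\<^sup>2) * \<phi> (W x / t\<^sup>2)"
          using \<phi>(1)[OF True] by (intro mult_mono) auto
        then have "t\<^sup>2 * (\<phi> (W x) * \<phi> (W x)) / W x \<le> t\<^sup>2 * (\<phi> (W x / t\<^sup>2) * \<phi> (W x / t\<^sup>2)) / W x"
          using True t2 by (intro divide_right_mono mult_left_mono) auto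
        moreover have "t powr 2 = t\<^sup>2" using t by simp
        ultimately show ?thesis using True t t2 by (simp add: G1_def h_def W_res mult_ac)
      next
        case False
        then have "W x = 0" using W_nonneg[of x] by simp
        then show ?thesis by (simp add: G1_def h_def W_res)
      qed
    qed (use G1 i1 in \<open>auto simp: mult.assoc\<close>)
    then show ?thesis unfolding card_k by (simp add: I1_def I1S_def mult.assoc)
  qed
  have chi2: "k * I2 \<le> I2S"
  proof -
    have "(real (CARD('d) * (CARD('n) - 1)) + 0) * (\<integral>x. ?f x * G2 x \<partial>lborel) \<le> (\<integral>x. ?f x * G2 x * S x \<partial>lborel)"
    proof (rule dil_res.dilation_inequality_up)
      fix t :: real and x :: "(real ^ 'd) ^ 'n" assume t: "t > 1"
      show "t powr 0 * G2 x \<le> G2 (dilate_residuals t x)"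
      proof (cases "W x > 0")
        case True
        have "1 \<le> t\<^sup>2" using t by simp
        then have t2: "W x / t\<^sup>2 \<le> W x" "W x / t\<^sup>2 > 0" using True t by (simp_all add: divide_le_eq)
        then have "C * r (W x / t\<^sup>2) \<le> C * r (W x)" using r_mono C by (intro mult_left_mono) auto
        then have le: "\<delta> x \<le> \<delta> (dilate_residuals t x)"
          using True t t2(2) by (simp add: \<delta>_def W_res)
        define e where "e = \<delta> (dilate_residuals t x)"
        have "0 \<le> (e - \<delta> x) * (c - e - \<delta> x)"
          using le \<delta>[of x] \<delta>[of "dilate_residuals t x"] by (intro mult_nonneg_nonneg) (auto simp: e_def)
        then have "\<delta> x * (c - \<delta> x) \<le> e * (c - e)" by (simp add: algebra_simps)
        then show ?thesis using t by (simp add: G2_def e_def)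
      next
        case False
        then have "W x = 0" using W_nonneg[of x] by simp
        then show ?thesis using t by (simp add: G2_def \<delta>_def W_res)
      qed
    qed (use G2 i2 in \<open>auto simp: mult.assoc\<close>)
    then show ?thesis unfolding card_k by (simp add: I2_def I2S_def mult.assoc)
  qed

  \<comment> \<open>The lower bound for the risk difference, up to the factor \<open>\<sigma>\<^sup>2\<close>, that the three inequalities
    leave; it is positive almost everywhere.\<close>
  define M where "M x = (1 / n) * (2 * (d - 2) * h x - (k + 2) * G1 x) + d * (k * G2 x - \<delta> x / c)" for x
  have M_int: "has_bochner_integral lborel (\<lambda>x. (2 * (d - 2) / n) * (?f x * h x) - ((k + 2) / n) * (?f x * G1 x) + (d * k) * (?f x * G2 x) - (d / c) * (?f x * \<delta> x))
     ((2 * (d - 2) / n) * Ih - ((k + 2) / n) * I1 + (d * k) * I2 - (d / c) * I\<delta>)"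
    by (intro has_bochner_integral_add has_bochner_integral_diff has_bochner_integral_mult_right)
       (simp_all only: has_bochner_integral_iff ih i1 i2 i\<delta> Ih_def I1_def I2_def I\<delta>_def simp_thms)
  have M_eq: "(2 * (d - 2) / n) * (?f x * h x) - ((k + 2) / n) * (?f x * G1 x) + (d * k) * (?f x * G2 x) - (d / c) * (?f x * \<delta> x) = ?f x * M x" for x
    unfolding M_def by (simp add: diff_divide_distrib add_divide_distrib algebra_simps)
  have M_pos: "M x > 0" if "W x > 0" for x
  proof -
    have "0 < (1 / n) * (2 * (d - 2) * h x - (k + 2) * (h x * \<phi> (W x))) + d * (k * (\<delta> x * (c - \<delta> x)) - \<delta> x / c)"
    proof (rule risk_margin_pos[where m = m and \<eta> = "1 / m - \<phi> (W x)", OF n d m_def k_def])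
      show "n / 2 + 2 < m * (d - 4)" using nd by (simp add: n_def d_def m_def)
      show "0 < h x" "1 / m - \<phi> (W x) \<le> h x" using that \<phi>[OF that] by (simp_all add: h_def)
      show "0 \<le> 1 / m - \<phi> (W x)" using \<phi>(3)[OF that] by simp
      have "C * ((1 / m - \<phi> (W x)) / 2) \<le> c * ((1 / m - \<phi> (W x)) / 2)"
        using Cc \<phi>(3)[OF that] by (intro mult_right_mono) auto
      then show "\<delta> x \<le> c * ((1 / m - \<phi> (W x)) / 2)" using r(3)[OF that] that by (simp add: \<delta>_def)
    qed (use c kc \<delta> in auto)
    then show ?thesis by (simp add: M_def G1_def G2_def)
  qed
  have AE_pos: "AE x in lborel. rss (x :: (real ^ 'd) ^ 'n) > 0 \<and> sample_mean x \<noteq> 0"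
    using AE_rss_pos[OF n2, where 'd = 'd] AE_sample_mean_nonzero by eventually_elim simp
  have W_pos: "W x > 0" if "rss x > 0 \<and> sample_mean x \<noteq> 0" for x
    using that n by (simp add: W_def)
  have M_integral_pos: "0 < (2 * (d - 2) / n) * Ih - ((k + 2) / n) * I1 + (d * k) * I2 - (d / c) * I\<delta>"
  proof -
    have iM: "integrable lborel (\<lambda>x. ?f x * M x)" and eM: "(\<integral>x. ?f x * M x \<partial>lborel) = (2 * (d - 2) / n) * Ih - ((k + 2) / n) * I1 + (d * k) * I2 - (d / c) * I\<delta>"
      using M_int unfolding M_eq by (simp_all only: has_bochner_integral_iff)
    have pos: "AE x in lborel. 0 < ?f x * M x"
      using AE_pos by eventually_elim (intro mult_pos_pos sample_density_pos \<sigma> M_pos W_pos)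
    have "(\<integral>x. ?f x * M x \<partial>lborel) \<noteq> 0"
    proof
      assume "(\<integral>x. ?f x * M x \<partial>lborel) = 0"
      then have "AE x in lborel. ?f x * M x = 0"
        by (subst (asm) integral_nonneg_eq_0_iff_AE[OF iM]) (use pos in \<open>auto elim: eventually_mono\<close>)
      with pos have "AE x in (lborel :: ((real ^ 'd) ^ 'n) measure). False" by eventually_elim simp
      then show False by (simp add: AE_iff_measurable[OF _ refl])
    qed
    moreover have "0 \<le> (\<integral>x. ?f x * M x \<partial>lborel)"
      by (rule integral_nonneg_AE) (use pos in \<open>auto elim: eventually_mono\<close>)
    ultimately show ?thesis unfolding eM by linarith
  qed

  \<comment> \<open>Before taking expectations the difference of the losses is at least \<open>L\<close>: the location part is
    expanded exactly, and \<open>2 \<sigma> sqrt S \<le> c S + \<sigma>\<^sup>2 / c\<close> removes the square root from the scale part.\<close>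
  define R0 where "R0 x = (norm (sample_mean x - \<mu>))\<^sup>2 + d * (c * sqrt (rss x) - \<sigma>)\<^sup>2" for x :: "(real ^ 'd) ^ 'n"
  define RB where "RB x = (norm ((1 - h x) *\<^sub>R sample_mean x - \<mu>))\<^sup>2 + d * ((c - \<delta> x) * sqrt (rss x) - \<sigma>)\<^sup>2" for x :: "(real ^ 'd) ^ 'n"
  have [measurable]: "R0 \<in> borel_measurable borel" "RB \<in> borel_measurable borel"
    unfolding R0_def RB_def by measurable
  define L where "L x = \<sigma>\<^sup>2 * ((2 / n) * (h x * A x) - (1 / n) * (G1 x * S x) + d * (G2 x * S x) - (d / c) * \<delta> x)" for x
  have RL: "RB x + L x \<le> R0 x" if x: "rss x > 0 \<and> sample_mean x \<noteq> 0" for x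
  proof -
    have Wx: "W x > 0" by (rule W_pos[OF x])
    let ?y = "sample_mean x"
    have expand: "(norm (u - s *\<^sub>R v))\<^sup>2 = (norm u)\<^sup>2 - 2 * s * (v \<bullet> u) + s\<^sup>2 * (norm v)\<^sup>2" for u v :: "real ^ 'd" and s
      unfolding power2_norm_eq_inner by (simp add: inner_diff_left inner_diff_right inner_commute algebra_simps power2_eq_square)
    have "(1 - h x) *\<^sub>R ?y - \<mu> = (?y - \<mu>) - h x *\<^sub>R ?y" by (simp add: algebra_simps)
    then have 1: "(norm ((1 - h x) *\<^sub>R ?y - \<mu>))\<^sup>2 = (norm (?y - \<mu>))\<^sup>2 - 2 * h x * (?y \<bullet> (?y - \<mu>)) + (h x)\<^sup>2 * (norm ?y)\<^sup>2"
      by (simp only: expand)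
    have 2: "\<sigma>\<^sup>2 * ((2 / n) * (h x * A x)) = 2 * h x * (?y \<bullet> (?y - \<mu>))"
      using n \<sigma> by (simp add: A_def)
    have 3: "\<sigma>\<^sup>2 * ((1 / n) * (G1 x * S x)) = (h x)\<^sup>2 * (norm ?y)\<^sup>2"
    proof -
      have "\<phi> (W x) = h x * W x" using Wx by (simp add: h_def)
      moreover have "W x * rss x = n * (norm ?y)\<^sup>2" using x by (simp add: W_def)
      ultimately have "G1 x * rss x = (h x)\<^sup>2 * (n * (norm ?y)\<^sup>2)" by (simp add: G1_def power2_eq_square)
      then show ?thesis using n \<sigma> by (simp add: S_def)
    qed
    have 4: "\<sigma>\<^sup>2 * (d * (G2 x * S x) - (d / c) * \<delta> x) \<le> d * (c * sqrt (rss x) - \<sigma>)\<^sup>2 - d * ((c - \<delta> x) * sqrt (rss x) - \<sigma>)\<^sup>2"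
    proof -
      define s where "s = sqrt (rss x)"
      have s2: "rss x = s\<^sup>2" by (simp add: s_def)
      have "0 \<le> \<delta> x / c * (c * s - \<sigma>)\<^sup>2" using \<delta>[of x] c by simp
      also have "\<dots> = \<delta> x * c * s\<^sup>2 - 2 * \<sigma> * \<delta> x * s + \<sigma>\<^sup>2 * \<delta> x / c"
        using c by (simp add: power2_eq_square field_simps)
      finally have "rss x * G2 x - \<sigma>\<^sup>2 * \<delta> x / c \<le> (c * s - \<sigma>)\<^sup>2 - ((c - \<delta> x) * s - \<sigma>)\<^sup>2"
        unfolding s2 G2_def by (simp add: power2_eq_square algebra_simps)
      then have "d * (rss x * G2 x - \<sigma>\<^sup>2 * \<delta> x / c) \<le> d * ((c * s - \<sigma>)\<^sup>2 - ((c - \<delta> x) * s - \<sigma>)\<^sup>2)"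
        using d by (intro mult_left_mono) auto
      moreover have "\<sigma>\<^sup>2 * (d * (G2 x * S x) - (d / c) * \<delta> x) = d * (rss x * G2 x - \<sigma>\<^sup>2 * \<delta> x / c)"
        using \<sigma> by (simp add: S_def right_diff_distrib)
      ultimately show ?thesis by (simp add: s_def right_diff_distrib)
    qed
    have "L x = \<sigma>\<^sup>2 * ((2 / n) * (h x * A x)) - \<sigma>\<^sup>2 * ((1 / n) * (G1 x * S x)) + \<sigma>\<^sup>2 * (d * (G2 x * S x) - (d / c) * \<delta> x)"
      unfolding L_def by (simp only: right_diff_distrib distrib_left add_diff_eq)
    then show ?thesis using 4 unfolding RB_def R0_def 1 2 3 by linarith
  qed
  have L_int: "has_bochner_integral lborel (\<lambda>x. \<sigma>\<^sup>2 * ((2 / n) * (?f x * (h x * A x)) - (1 / n) * (?f x * (G1 x * S x)) + d * (?f x * (G2 x * S x)) - (d / c) * (?f x * \<delta> x)))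
     (\<sigma>\<^sup>2 * ((2 / n) * IA - (1 / n) * I1S + d * I2S - (d / c) * I\<delta>))"
    by (intro has_bochner_integral_add has_bochner_integral_diff has_bochner_integral_mult_right)
       (simp_all only: has_bochner_integral_iff ih i1 i2 i\<delta> IA_def I1S_def I2S_def I\<delta>_def simp_thms)
  have L_eq: "\<sigma>\<^sup>2 * ((2 / n) * (?f x * (h x * A x)) - (1 / n) * (?f x * (G1 x * S x)) + d * (?f x * (G2 x * S x)) - (d / c) * (?f x * \<delta> x)) = ?f x * L x" for x
    unfolding L_def by (simp only: right_diff_distrib distrib_left mult_ac)
  have L_pos: "0 < \<sigma>\<^sup>2 * ((2 / n) * IA - (1 / n) * I1S + d * I2S - (d / c) * I\<delta>)"
  proof -
    have "(2 * (d - 2) / n) * Ih \<le> (2 / n) * IA"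
      using mult_left_mono[OF stein, of "2 / n"] n by (simp add: mult_ac)
    moreover have "(1 / n) * I1S \<le> ((k + 2) / n) * I1"
      using mult_left_mono[OF chi1, of "1 / n"] n by simp
    moreover have "(d * k) * I2 \<le> d * I2S"
      using mult_left_mono[OF chi2, of d] d by (simp add: mult.assoc)
    ultimately have "0 < (2 / n) * IA - (1 / n) * I1S + d * I2S - (d / c) * I\<delta>"
      using M_integral_pos by linarith
    then show ?thesis using \<sigma> by simp
  qed
  have iR0: "integrable lborel (\<lambda>x. ?f x * R0 x)"
  proof (rule integrable_sample_quadratic[OF \<sigma>, where K = "1 + d * (2 * c\<^sup>2 + 2 * \<sigma>\<^sup>2)"])
    fix x :: "(real ^ 'd) ^ 'n"
    have 1: "(norm (sample_mean x - \<mu>))\<^sup>2 \<le> 1 * (1 + ?Q x)"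
    proof -
      have "1 * (norm (sample_mean x - \<mu>))\<^sup>2 \<le> n * (norm (sample_mean x - \<mu>))\<^sup>2" using n by (intro mult_right_mono) auto
      then show ?thesis using rss_nonneg[of x] unfolding mult_1_left by linarith
    qed
    have "(c * sqrt (rss x) - \<sigma>)\<^sup>2 \<le> 2 * (c * sqrt (rss x))\<^sup>2 + 2 * \<sigma>\<^sup>2"
      using zero_le_power2[of "c * sqrt (rss x) + \<sigma>"] by (simp add: power2_sum power2_diff)
    also have "\<dots> = 2 * c\<^sup>2 * rss x + 2 * \<sigma>\<^sup>2 * 1" by (simp add: power_mult_distrib)
    also have "\<dots> \<le> 2 * c\<^sup>2 * (1 + ?Q x) + 2 * \<sigma>\<^sup>2 * (1 + ?Q x)"
      using n Q0[of x] by (intro add_mono mult_left_mono) auto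
    also have "\<dots> = (2 * c\<^sup>2 + 2 * \<sigma>\<^sup>2) * (1 + ?Q x)" by (simp only: distrib_right)
    finally have "d * (c * sqrt (rss x) - \<sigma>)\<^sup>2 \<le> d * ((2 * c\<^sup>2 + 2 * \<sigma>\<^sup>2) * (1 + ?Q x))"
      using d by (intro mult_left_mono) auto
    with 1 have "R0 x \<le> (1 + d * (2 * c\<^sup>2 + 2 * \<sigma>\<^sup>2)) * (1 + ?Q x)"
      unfolding R0_def distrib_right[of 1] mult.assoc by (rule add_mono)
    moreover have "0 \<le> R0 x" using d by (simp add: R0_def)
    ultimately show "\<bar>R0 x\<bar> \<le> (1 + d * (2 * c\<^sup>2 + 2 * \<sigma>\<^sup>2)) * (1 + (real CARD('n) * (norm (sample_mean x - \<mu>))\<^sup>2 + rss x))"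
      by (simp add: n_def)
  qed simp
  have iL: "integrable lborel (\<lambda>x. ?f x * L x)" and eL: "0 < (\<integral>x. ?f x * L x \<partial>lborel)"
    using L_int L_pos unfolding L_eq by (simp_all only: has_bochner_integral_iff)
  have R0n: "0 \<le> R0 x" and RBn: "0 \<le> RB x" for x using d by (simp_all add: R0_def RB_def)

  have "W2_risk \<mu> \<sigma> (bayes_predictive hierarchical_prior :: (real ^ 'd) ^ 'n \<Rightarrow> real ^ 'd \<Rightarrow> real) \<le> (\<integral>\<^sup>+x. ennreal (?f x * (R0 x - L x)) \<partial>lborel)"
    unfolding W2_risk_def
  proof (rule nn_integral_mono_AE, use AE_pos in eventually_elim)
    fix x :: "(real ^ 'd) ^ 'n" assume x: "rss x > 0 \<and> sample_mean x \<noteq> 0"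
    then have S0: "rss x > 0" and y0: "sample_mean x \<noteq> 0" by auto
    have Wx: "W x > 0" by (rule W_pos[OF x])
    note post = hierarchical_posterior[OF S0 n2 y0, folded n_def d_def, folded a_def m_def W_def]
    have pm: "posterior_expectation hierarchical_prior (\<lambda>\<mu> \<sigma>. \<mu>) x = (1 - h x) *\<^sub>R sample_mean x"
      using post(1) Wx by (simp add: h_def \<phi>_def)
    have ps: "posterior_expectation hierarchical_prior (\<lambda>\<mu> \<sigma>. \<sigma>) x = (c - \<delta> x) * sqrt (rss x)"
      using post(2) Wx by (simp add: \<delta>_def r_def C_def)
    have "c - \<delta> x > 0" using \<delta>[of x] c by linarith
    then have sp: "(c - \<delta> x) * sqrt (rss x) > 0" using S0 by simp
    have "W2_loss \<mu> \<sigma> (bayes_predictive hierarchical_prior x) \<le> ennreal (RB x)"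
      unfolding bayes_predictive_def plug_in_def pm ps RB_def d_def by (rule W2_loss_le[OF \<sigma> sp])
    also have "\<dots> \<le> ennreal (R0 x - L x)" using RL[OF x] by (intro ennreal_leI) simp
    finally have "W2_loss \<mu> \<sigma> (bayes_predictive hierarchical_prior x) * ennreal (?f x) \<le> ennreal (R0 x - L x) * ennreal (?f x)"
      by (rule mult_right_mono) simp
    also have "\<dots> = ennreal (?f x * (R0 x - L x))"
      using RL[OF x] RBn[of x] by (subst ennreal_mult[symmetric]) (auto simp: mult.commute)
    finally show "W2_loss \<mu> \<sigma> (bayes_predictive hierarchical_prior x) * ennreal (?f x) \<le> ennreal (?f x * (R0 x - L x))" .
  qed
  also have "\<dots> = ennreal (\<integral>x. ?f x * (R0 x - L x) \<partial>lborel)"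
  proof (rule nn_integral_eq_integral)
    show "integrable lborel (\<lambda>x. ?f x * (R0 x - L x))"
      unfolding right_diff_distrib by (intro Bochner_Integration.integrable_diff iR0 iL)
    show "AE x in lborel. 0 \<le> ?f x * (R0 x - L x)"
      using AE_pos
    proof eventually_elim
      case (elim x)
      then show ?case using RL[OF elim] RBn[of x] by (intro mult_nonneg_nonneg) auto
    qed
  qed
  also have "\<dots> < ennreal (\<integral>x. ?f x * R0 x \<partial>lborel)"
  proof -
    have "(\<integral>x. ?f x * (R0 x - L x) \<partial>lborel) = (\<integral>x. ?f x * R0 x \<partial>lborel) - (\<integral>x. ?f x * L x \<partial>lborel)"
      unfolding right_diff_distrib by (rule Bochner_Integration.integral_diff[OF iR0 iL])
    moreover have "0 \<le> (\<integral>x. ?f x * (R0 x - L x) \<partial>lborel)"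
    proof (rule integral_nonneg_AE)
      show "AE x in lborel. 0 \<le> ?f x * (R0 x - L x)"
        using AE_pos
      proof eventually_elim
        case (elim x)
        then show ?case using RL[OF elim] RBn[of x] by (intro mult_nonneg_nonneg) auto
      qed
    qed
    ultimately show ?thesis using eL by (intro ennreal_lessI) auto
  qed
  also have "\<dots> = (\<integral>\<^sup>+x. ennreal (?f x * R0 x) \<partial>lborel)"
    by (rule nn_integral_eq_integral[symmetric, OF iR0]) (simp add: R0n)
  finally show ?thesis unfolding R0_def d_def c_def .
qed

theorem theorem4p3:
  assumes "(int CARD('n::finite) - 3) * (int CARD('d::finite) - 4) \<ge> 8"
  shows "(\<exists>p0 :: (real ^ 'd) ^ 'n \<Rightarrow> real ^ 'd \<Rightarrow> real. best_equivariant_predictive p0) \<and>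
         (\<forall>p0 :: (real ^ 'd) ^ 'n \<Rightarrow> real ^ 'd \<Rightarrow> real. best_equivariant_predictive p0 \<longrightarrow>
            dominates (bayes_predictive hierarchical_prior) p0)"
proof -
  note cond = sample_size_conditions[OF assms zero_less_card_finite zero_less_card_finite]
  have n2: "CARD('n) \<ge> 2" using cond(1) by simp
  let ?p = "real (CARD('d) * (CARD('n) - 1)) / 2"
  let ?s = "\<lambda>x :: (real ^ 'd) ^ 'n. scale_factor ?p * sqrt (rss x)"
  have "best_equivariant_mean (sample_mean :: (real ^ 'd) ^ 'n \<Rightarrow> _)"
    unfolding best_equivariant_mean_def using equivariant_sample_mean mean_risk_minimal by blast
  moreover have "best_equivariant_scale ?s"
    unfolding best_equivariant_scale_def using equivariant_scale_rss scale_risk_minimal[OF n2] by blast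
  ultimately have "best_equivariant_predictive (plug_in sample_mean ?s)"
    unfolding best_equivariant_predictive_def by blast
  moreover have "W2_risk \<mu> \<sigma> (bayes_predictive hierarchical_prior :: (real ^ 'd) ^ 'n \<Rightarrow> _) < W2_risk \<mu> \<sigma> p0"
    if p0: "best_equivariant_predictive p0" and \<sigma>: "\<sigma> > 0" for p0 :: "(real ^ 'd) ^ 'n \<Rightarrow> real ^ 'd \<Rightarrow> real" and \<mu> \<sigma>
  proof -
    obtain m s where ms: "equivariant_mean m" "equivariant_scale s" "p0 = plug_in m s"
      using p0 unfolding best_equivariant_predictive_def best_equivariant_mean_def best_equivariant_scale_def by blast
    show ?thesis
      unfolding ms(3)
      by (rule less_le_trans[OF bayes_estimator_improves[OF cond \<sigma>] W2_risk_plug_in_ge[OF n2 ms(1,2) \<sigma>]])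
  qed
  then have "dominates (bayes_predictive hierarchical_prior) p0"
    if "best_equivariant_predictive p0" for p0 :: "(real ^ 'd) ^ 'n \<Rightarrow> real ^ 'd \<Rightarrow> real"
    unfolding dominates_def using that zero_less_one less_imp_le by metis
  ultimately show ?thesis by blast
qed

end
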